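(* Let $\beta\in(0,1)$. Assume the cost function $c:\mathcal{X}\times\mathcal{U}\to\mathbb{R}$ is bounded, non-negative and measurable, and assume the filter is universally exponentially stable in total variation in expectation with coefficient $\alpha\in(0,1)$. Let $$\|J_\beta^*\|_{sp}=\sup_{\mu_1\in\mathcal{P}(\mathcal{X})}J_\beta^*(\mu_1)-\inf_{\mu_2\in\mathcal{P}(\mathcal{X})}J_\beta^*(\mu_2),\qquad \rho=\left(\frac{\|c\|_\infty}{1-\beta}-\|J_\beta^*\|_{sp}\right)\left(\frac{\|c\|_\infty}{1-\beta}\right)^{-1},$$ $$f(n)=\beta^n(\rho-4\alpha^n),\qquad n^*=\frac{\ln\left(\left(\frac{\rho}{4}\right)\left(\frac{\ln\beta}{\ln\alpha+\ln\beta}\right)\right)}{\ln\alpha},$$ where $\|c\|_\infty>0$ and $\rho>0$ (so that these quantities are defined). Then for any priors $\mu,\nu\in\mathcal{P}(\mathcal{X})$ with $\mu\ll\nu$, $$J_\beta(\mu,\gamma^\nu)-J_\beta^*(\mu)\le\frac{\|c\|_\infty}{1-\beta}\Big(1-\max\big(f(\lfloor n^*\rfloor),f(\lceil n^*\rceil)\big)\Big),$$ where $\gamma^\nu$ is the policy that is optimal for the discounted cost problem with prior $\nu$.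
   Context: Setting (POMDP). $\mathcal{X},\mathcal{Y},\mathcal{U}$ (state, measurement, action spaces) are Polish spaces with their Borel sigma fields; $\mathcal{X}$ is also $\sigma$-compact. $\mathcal{P}(\mathcal{X})$ is the set of Borel probability measures on $\mathcal{X}$. $T(dx'|x,u)$ is a transition kernel from $\mathcal{X}\times\mathcal{U}$ to $\mathcal{X}$, and $Q(dy|x)$ is an observation kernel from $\mathcal{X}$ to $\mathcal{Y}$. An admissible policy $\gamma=\{\gamma_n\}_{n\ge0}$ is a sequence of measurable maps $\gamma_n:\mathcal{Y}^{n+1}\times\mathcal{U}^{n}\to\mathcal{U}$, with actions $U_n=\gamma_n(Y_{[0,n]},U_{[0,n-1]})$ (so each $U_n$ is a function of $Y_{[0,n]}=(Y_0,\dots,Y_n)$); $\Gamma$ is the set of admissible policies. For a prior $\mu\in\mathcal{P}(\mathcal{X})$ and $\gamma\in\Gamma$, the strategic measure $P^{\mu,\gamma}$ (expectation $E^{\mu,\gamma}$) is the law of $(X_n,Y_n)_{n\ge0}$ on $\mathcal{X}^{\mathbb{Z}_+}\times\mathcal{Y}^{\mathbb{Z}_+}$ with $P^{\mu,\gamma}((X_0,Y_0)\in A)=\int_A Q(dy|x)\mu(dx)$ and, for $n\ge1$, $P^{\mu,\gamma}((X_n,Y_n)\in A\mid (X,Y)_{[0,n-1]}=(x,y)_{[0,n-1]})=\int_A Q(dy|x)T(dx|x_{n-1},u_{n-1})$, where $u_{n-1}=\gamma_{n-1}(y_{[0,n-1]},u_{[0,n-2]})$. Filter: $\pi_n^{\mu,\gamma}(\cdot)=P^{\mu,\gamma}(X_n\in\cdot\mid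 Y_{[0,n]})$, $n\ge0$. Total variation: $\|P-Q\|_{TV}=\sup_{\|f\|_\infty\le1}|\int f\,dP-\int f\,dQ|$ over measurable $f$. Universal exponential stability with coefficient $\alpha\in(0,1)$: for all $\mu\ll\nu$, all $\gamma\in\Gamma$ and all $n\in\{0,1,\dots\}$, $E^{\mu,\gamma}[\|\pi_{n+1}^{\mu,\gamma}-\pi_{n+1}^{\nu,\gamma}\|_{TV}]\le\alpha\,E^{\mu,\gamma}[\|\pi_n^{\mu,\gamma}-\pi_n^{\nu,\gamma}\|_{TV}]$. Discounted cost: $J_\beta(\mu,\gamma)=E^{\mu,\gamma}\left[\sum_{i=0}^\infty\beta^ic(X_i,U_i)\right]$ and $J_\beta^*(\mu)=\inf_{\gamma\in\Gamma}J_\beta(\mu,\gamma)$; $\|c\|_\infty$ is the supremum norm. Optimal policies (standing assumption). For each prior $\lambda\in\mathcal{P}(\mathcal{X})$ there is an optimal policy $\gamma^\lambda\in\Gamma$, $J_\beta(\lambda,\gamma^\lambda)=J_\beta^*(\lambda)$, which is a stationary function of the filter: there is a measurable map $\Phi:\mathcal{P}(\mathcal{X})\to\mathcal{U}$, not depending on $\lambda$ or $n$, such that $\gamma_n^\lambda(y_{[0,n]})=\Phi(\pi_n^{\lambda,\gamma^\lambda})$ for all $n\geq 0$, where $\pi_n^{\lambda,\gamma^\lambda}$ is the filter realization given $Y_{[0,n]}=y_{[0,n]}$. In $J_\beta(\mu,\gamma^\nu)$, the policy $\gamma^\nu$ is applied as a map from measurements to actions while the true prior is $\mu$. *)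

theory Defs
  imports "HOL-Probability.Probability"
begin

text \<open>
  Conventions. Polish spaces are types of class \<open>polish_space\<close> with their Borel sigma field
  \<open>borel\<close>. The set \<open>\<P>(X)\<close> is \<open>space (prob_algebra borel)\<close>; measurability of maps into or out of
  \<open>\<P>(X)\<close> refers to the sigma field generated by the evaluations \<open>P \<mapsto> P B\<close>, which on a Polish
  space is the Borel sigma field of the weak topology. A transition kernel is a measurable map
  into \<open>prob_algebra borel\<close>.

  A trajectory \<open>\<omega> :: nat \<Rightarrow> 'x \<times> 'y\<close> is the sequence of pairs \<open>(X\<^sub>n, Y\<^sub>n)\<close>. Finite histories such
  as \<open>Y\<^bsub>[0,n]\<^esub>\<close> are the extensional functions of the product space \<open>PiM {..n} (\<lambda>_. borel)\<close>.
\<close>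

type_synonym ('y, 'u) policy = "nat \<Rightarrow> (nat \<Rightarrow> 'y) \<times> (nat \<Rightarrow> 'u) \<Rightarrow> 'u"

definition admissible :: "('y::topological_space, 'u::topological_space) policy set" where
  "admissible = {\<gamma>. \<forall>n. \<gamma> n \<in> PiM {..n} (\<lambda>_. borel) \<Otimes>\<^sub>M PiM {..<n} (\<lambda>_. borel) \<rightarrow>\<^sub>M borel}"

lemma restrict_fundef_cong [fundef_cong]:
  "I = J \<Longrightarrow> (\<And>i. i \<in> J \<Longrightarrow> f i = g i) \<Longrightarrow> restrict f I = restrict g J"
  by (auto simp: restrict_def)

text \<open>The action \<open>U\<^sub>n\<close> that the policy generates along a measurement sequence.\<close>

fun action :: "('y, 'u) policy \<Rightarrow> (nat \<Rightarrow> 'y) \<Rightarrow> nat \<Rightarrow> 'u" where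
  "action \<gamma> y n = \<gamma> n (\<lambda>i\<in>{..n}. y i, \<lambda>i\<in>{..<n}. action \<gamma> y i)"

declare action.simps [simp del]

definition meas_seq :: "(nat \<Rightarrow> 'x \<times> 'y) \<Rightarrow> nat \<Rightarrow> 'y" where
  "meas_seq \<omega> = (\<lambda>i. snd (\<omega> i))"

definition meas_hist :: "nat \<Rightarrow> (nat \<Rightarrow> 'x \<times> 'y) \<Rightarrow> nat \<Rightarrow> 'y" where
  "meas_hist n \<omega> = (\<lambda>i\<in>{..n}. meas_seq \<omega> i)"

definition step_kernel ::
  "('x::topological_space \<times> 'u \<Rightarrow> 'x measure) \<Rightarrow> ('x \<Rightarrow> 'y::topological_space measure) \<Rightarrow>
   'x measure \<Rightarrow> ('y, 'u) policy \<Rightarrow> nat \<Rightarrow> (nat \<Rightarrow> 'x \<times> 'y) \<Rightarrow> ('x \<times> 'y) measure" where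
  "step_kernel T Q \<mu> \<gamma> n \<omega> =
     (case n of 0 \<Rightarrow> \<mu> | Suc m \<Rightarrow> T (fst (\<omega> m), action \<gamma> (meas_seq \<omega>) m)) \<bind>
       (\<lambda>x. Q x \<bind> (\<lambda>y. return borel (x, y)))"

text \<open>
  The strategic measure: the Ionescu-Tulcea projective limit whose \<open>n\<close>-th coordinate has
  conditional law \<open>step_kernel T Q \<mu> \<gamma> n\<close> given the coordinates before \<open>n\<close>. The assumptions of
  the library construction are verified below.
\<close>

definition strategic ::
  "('x::topological_space \<times> 'u \<Rightarrow> 'x measure) \<Rightarrow> ('x \<Rightarrow> 'y::topological_space measure) \<Rightarrow>
   'x measure \<Rightarrow> ('y, 'u) policy \<Rightarrow> (nat \<Rightarrow> 'x \<times> 'y) measure" where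
  "strategic T Q \<mu> \<gamma> =
     projective_family.lim UNIV (Ionescu_Tulcea.CI (step_kernel T Q \<mu> \<gamma>) (\<lambda>_. borel)) (\<lambda>_. borel)"

text \<open>
  A version of the filter at time \<open>n\<close>: a kernel \<open>\<pi>\<close> from measurement histories to \<open>\<P>(X)\<close> with
  \<open>\<pi>(Y\<^bsub>[0,n]\<^esub>)(B) = P\<^bsup>\<mu>,\<gamma>\<^esup>(X\<^sub>n \<in> B | Y\<^bsub>[0,n]\<^esub>)\<close> almost surely, for every Borel set \<open>B\<close>.
\<close>

definition filter_version ::
  "('x::topological_space \<times> 'u \<Rightarrow> 'x measure) \<Rightarrow> ('x \<Rightarrow> 'y::topological_space measure) \<Rightarrow>
   'x measure \<Rightarrow> ('y, 'u) policy \<Rightarrow> nat \<Rightarrow> ((nat \<Rightarrow> 'y) \<Rightarrow> 'x measure) \<Rightarrow> bool" where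
  "filter_version T Q \<mu> \<gamma> n \<pi> \<longleftrightarrow>
     \<pi> \<in> PiM {..n} (\<lambda>_. borel) \<rightarrow>\<^sub>M prob_algebra borel \<and>
     (\<forall>B\<in>sets borel. AE \<omega> in strategic T Q \<mu> \<gamma>.
        measure (\<pi> (meas_hist n \<omega>)) B =
        real_cond_exp (strategic T Q \<mu> \<gamma>)
          (vimage_algebra (space (strategic T Q \<mu> \<gamma>)) (meas_hist n) (PiM {..n} (\<lambda>_. borel)))
          (indicator {\<omega>. fst (\<omega> n) \<in> B}) \<omega>)"

text \<open>
  The filter is unique only up to a null set of measurement histories under \<open>P\<^bsup>\<mu>,\<gamma>\<^esup>\<close>; we fix
  one version. It is only used under \<open>P\<^bsup>\<mu>,\<gamma>\<^esup>\<close> or under \<open>P\<^bsup>\<mu>',\<gamma>\<^esup>\<close> with \<open>\<mu>' \<lless> \<mu>\<close>, and then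
  \<open>P\<^bsup>\<mu>',\<gamma>\<^esup> \<lless> P\<^bsup>\<mu>,\<gamma>\<^esup>\<close>, so that the choice of version is immaterial.
\<close>

definition pomdp_filter ::
  "('x::topological_space \<times> 'u \<Rightarrow> 'x measure) \<Rightarrow> ('x \<Rightarrow> 'y::topological_space measure) \<Rightarrow>
   'x measure \<Rightarrow> ('y, 'u) policy \<Rightarrow> nat \<Rightarrow> (nat \<Rightarrow> 'y) \<Rightarrow> 'x measure" where
  "pomdp_filter T Q \<mu> \<gamma> n = (SOME \<pi>. filter_version T Q \<mu> \<gamma> n \<pi>)"

definition tv_norm :: "'a::topological_space measure \<Rightarrow> 'a measure \<Rightarrow> real" where
  "tv_norm P R = (SUP f\<in>{f \<in> borel_measurable borel. \<forall>x. \<bar>f x\<bar> \<le> 1}.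
     \<bar>(\<integral>x. f x \<partial>P) - (\<integral>x. f x \<partial>R)\<bar>)"

text \<open>
  The relation \<open>\<mu> \<lless> \<nu>\<close> is \<open>absolutely_continuous \<nu> \<mu>\<close> in the library's argument order.
\<close>

definition universally_exponentially_stable ::
  "('x::topological_space \<times> 'u::topological_space \<Rightarrow> 'x measure) \<Rightarrow>
   ('x \<Rightarrow> 'y::topological_space measure) \<Rightarrow> real \<Rightarrow> bool" where
  "universally_exponentially_stable T Q \<alpha> \<longleftrightarrow>
     (\<forall>\<mu>\<in>space (prob_algebra borel). \<forall>\<nu>\<in>space (prob_algebra borel).
      absolutely_continuous \<nu> \<mu> \<longrightarrow> (\<forall>\<gamma>\<in>admissible. \<forall>n.
        (\<integral>\<omega>. tv_norm (pomdp_filter T Q \<mu> \<gamma> (Suc n) (meas_hist (Suc n) \<omega>))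
                    (pomdp_filter T Q \<nu> \<gamma> (Suc n) (meas_hist (Suc n) \<omega>)) \<partial>strategic T Q \<mu> \<gamma>)
        \<le> \<alpha> * (\<integral>\<omega>. tv_norm (pomdp_filter T Q \<mu> \<gamma> n (meas_hist n \<omega>))
                    (pomdp_filter T Q \<nu> \<gamma> n (meas_hist n \<omega>)) \<partial>strategic T Q \<mu> \<gamma>)))"

definition discounted_cost ::
  "('x::topological_space \<times> 'u \<Rightarrow> 'x measure) \<Rightarrow> ('x \<Rightarrow> 'y::topological_space measure) \<Rightarrow>
   real \<Rightarrow> ('x \<times> 'u \<Rightarrow> real) \<Rightarrow> 'x measure \<Rightarrow> ('y, 'u) policy \<Rightarrow> real" where
  "discounted_cost T Q \<beta> c \<mu> \<gamma> =
     (\<integral>\<omega>. (\<Sum>i. \<beta> ^ i * c (fst (\<omega> i), action \<gamma> (meas_seq \<omega>) i)) \<partial>strategic T Q \<mu> \<gamma>)"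

definition optimal_cost ::
  "('x::topological_space \<times> 'u::topological_space \<Rightarrow> 'x measure) \<Rightarrow>
   ('x \<Rightarrow> 'y::topological_space measure) \<Rightarrow>
   real \<Rightarrow> ('x \<times> 'u \<Rightarrow> real) \<Rightarrow> 'x measure \<Rightarrow> real" where
  "optimal_cost T Q \<beta> c \<mu> = (INF \<gamma>\<in>admissible. discounted_cost T Q \<beta> c \<mu> \<gamma>)"

text \<open>
  \<open>opt \<lambda>\<close> is the policy \<open>\<gamma>\<^sup>\<lambda>\<close>. The identity \<open>U\<^sub>n = \<Phi>(\<pi>\<^sub>n)\<close> is required almost surely under
  \<open>P\<^bsup>\<lambda>,\<gamma>\<^sup>\<lambda>\<^esup>\<close>, because the filter is defined only up to null sets.
\<close>

definition optimal_policies ::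
  "('x::topological_space \<times> 'u::topological_space \<Rightarrow> 'x measure) \<Rightarrow>
   ('x \<Rightarrow> 'y::topological_space measure) \<Rightarrow>
   real \<Rightarrow> ('x \<times> 'u \<Rightarrow> real) \<Rightarrow> ('x measure \<Rightarrow> ('y, 'u) policy) \<Rightarrow> bool" where
  "optimal_policies T Q \<beta> c opt \<longleftrightarrow>
     (\<forall>l\<in>space (prob_algebra borel).
        opt l \<in> admissible \<and> discounted_cost T Q \<beta> c l (opt l) = optimal_cost T Q \<beta> c l) \<and>
     (\<exists>\<Phi>\<in>prob_algebra borel \<rightarrow>\<^sub>M borel. \<forall>l\<in>space (prob_algebra borel). \<forall>n.
        AE \<omega> in strategic T Q l (opt l).
          action (opt l) (meas_seq \<omega>) n = \<Phi> (pomdp_filter T Q l (opt l) n (meas_hist n \<omega>)))"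

definition sigma_compact :: "'a::topological_space set \<Rightarrow> bool" where
  "sigma_compact S \<longleftrightarrow> (\<exists>K::nat \<Rightarrow> 'a set. (\<forall>n. compact (K n)) \<and> (\<Union>n. K n) = S)"

lemma measurable_action:
  fixes \<gamma> :: "('y::topological_space, 'u::topological_space) policy"
    and Y :: "'a \<Rightarrow> nat \<Rightarrow> 'y"
  assumes g: "\<gamma> \<in> admissible" and Y: "\<And>i. i \<le> n \<Longrightarrow> (\<lambda>z. Y z i) \<in> N \<rightarrow>\<^sub>M borel"
  shows "(\<lambda>z. action \<gamma> (Y z) n) \<in> N \<rightarrow>\<^sub>M borel"
  using Y
proof (induction n rule: less_induct)
  case (less n)
  have "(\<lambda>z. (\<lambda>i\<in>{..n}. Y z i, \<lambda>i\<in>{..<n}. action \<gamma> (Y z) i))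
      \<in> N \<rightarrow>\<^sub>M PiM {..n} (\<lambda>_. borel) \<Otimes>\<^sub>M PiM {..<n} (\<lambda>_. borel)"
    using less by (intro measurable_Pair measurable_restrict) auto
  moreover have "\<gamma> n \<in> PiM {..n} (\<lambda>_. borel) \<Otimes>\<^sub>M PiM {..<n} (\<lambda>_. borel) \<rightarrow>\<^sub>M borel"
    using g by (auto simp: admissible_def)
  ultimately show ?case
    by (subst action.simps) (rule measurable_compose)
qed

lemma measurable_step_kernel:
  fixes T :: "'x::polish_space \<times> 'u::polish_space \<Rightarrow> 'x measure"
    and Q :: "'x \<Rightarrow> 'y::polish_space measure"
  assumes T: "T \<in> borel \<rightarrow>\<^sub>M prob_algebra borel"
    and Q [measurable]: "Q \<in> borel \<rightarrow>\<^sub>M prob_algebra borel"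
    and mu: "\<mu> \<in> space (prob_algebra borel)" and g: "\<gamma> \<in> admissible"
  shows "step_kernel T Q \<mu> \<gamma> n \<in> PiM {0..<n} (\<lambda>_. borel) \<rightarrow>\<^sub>M prob_algebra borel"
proof -
  have "(\<lambda>\<omega>. case n of 0 \<Rightarrow> \<mu> | Suc m \<Rightarrow> T (fst (\<omega> m), action \<gamma> (meas_seq \<omega>) m))
      \<in> PiM {0..<n} (\<lambda>_. borel) \<rightarrow>\<^sub>M prob_algebra borel"
  proof (cases n)
    case (Suc m)
    have comp: "(\<lambda>\<omega>. \<omega> i) \<in> PiM {0..<n} (\<lambda>_. borel) \<rightarrow>\<^sub>M (borel :: ('x \<times> 'y) measure)"
      if "i \<le> m" for i
      using that Suc by (intro measurable_component_singleton) auto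
    have "(\<lambda>\<omega>. fst (\<omega> m)) \<in> PiM {0..<n} (\<lambda>_. borel :: ('x \<times> 'y) measure) \<rightarrow>\<^sub>M borel"
      using comp[of m] by (auto simp: borel_prod[symmetric])
    moreover have "(\<lambda>\<omega>. action \<gamma> (meas_seq \<omega>) m)
        \<in> PiM {0..<n} (\<lambda>_. borel :: ('x \<times> 'y) measure) \<rightarrow>\<^sub>M borel"
      unfolding meas_seq_def using comp
      by (intro measurable_action[OF g]) (auto simp: borel_prod[symmetric])
    ultimately have "(\<lambda>\<omega>. (fst (\<omega> m), action \<gamma> (meas_seq \<omega>) m))
        \<in> PiM {0..<n} (\<lambda>_. borel) \<rightarrow>\<^sub>M (borel :: ('x \<times> 'u) measure)"
      by (subst borel_prod[symmetric]) (rule measurable_Pair)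
    from measurable_compose[OF this T] show ?thesis
      by (simp add: Suc)
  qed (simp add: mu)
  moreover have "(\<lambda>x. Q x \<bind> (\<lambda>y. return borel (x, y))) \<in> borel \<rightarrow>\<^sub>M prob_algebra borel"
    unfolding borel_prod[symmetric] by measurable
  ultimately show ?thesis
    unfolding step_kernel_def[abs_def] by (rule measurable_bind_prob_space)
qed

lemma Ionescu_Tulcea_step_kernel:
  fixes T :: "'x::polish_space \<times> 'u::polish_space \<Rightarrow> 'x measure"
    and Q :: "'x \<Rightarrow> 'y::polish_space measure"
  assumes "T \<in> borel \<rightarrow>\<^sub>M prob_algebra borel" "Q \<in> borel \<rightarrow>\<^sub>M prob_algebra borel"
    and "\<mu> \<in> space (prob_algebra borel)" "\<gamma> \<in> admissible"
  shows "Ionescu_Tulcea (step_kernel T Q \<mu> \<gamma>) (\<lambda>_. borel)"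
proof -
  note m = measurable_step_kernel[OF assms]
  have "step_kernel T Q \<mu> \<gamma> i \<in> PiM {0..<i} (\<lambda>_. borel) \<rightarrow>\<^sub>M subprob_algebra borel" for i
    by (rule measurable_prob_algebraD[OF m])
  moreover have "prob_space (step_kernel T Q \<mu> \<gamma> i x)"
    if "x \<in> space (PiM {0..<i} (\<lambda>_. borel))" for i x
    using measurable_space[OF m that] by (simp add: space_prob_algebra)
  ultimately show ?thesis
    by (intro Ionescu_Tulcea.intro)
qed

end

theory Submission
  imports Defs
begin

text \<open>
  Put \<open>B = \<parallel>c\<parallel>\<^sub>\<infinity> / (1 - \<beta>)\<close> and \<open>\<gamma> = \<gamma>\<^sup>\<nu>\<close>. The theorem follows from the bounds, one for every
  natural number \<open>n\<close>,
  \<open>J(\<mu>, \<gamma>) \<le> B (1 - \<beta>\<^sup>n) + \<beta>\<^sup>n (sup J\<^sup>* + 4 B \<alpha>\<^sup>n)\<close>: subtract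
  \<open>J\<^sup>*(\<mu>) \<ge> inf J\<^sup>* \<ge> \<beta>\<^sup>n inf J\<^sup>*\<close>, and note that \<open>n\<^sup>* > 0\<close>, so that its floor and
  ceiling are possible values of \<open>n\<close>. The term \<open>B (1 - \<beta>\<^sup>n)\<close> is the trivial bound on the cost
  of the first \<open>n\<close> stages; the rest is about the expected cost-to-go at time \<open>n\<close> under
  \<open>P\<^bsup>\<mu>,\<gamma>\<^esup>\<close>.

  Compare \<open>\<gamma>\<close> with the policy \<open>\<gamma>'\<close> that follows \<open>\<gamma>\<close> before time \<open>n\<close>, then forgets the past and
  starts afresh with a policy that is optimal for the prior \<open>p\<close>, the law of \<open>X\<^sub>n\<close> under
  \<open>P\<^bsup>\<mu>,\<gamma>\<^esup>\<close>. Its expected cost-to-go is \<open>J\<^sup>*(p) \<le> sup J\<^sup>*\<close>. For the prior \<open>\<nu>\<close> the policy \<open>\<gamma>\<close>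
  is optimal, so switching to \<open>\<gamma>'\<close> on an event of the measurements up to time \<open>n\<close> never pays.
  Hence for almost every measurement history the cost-to-go of \<open>\<gamma>\<close>, averaged over the filter
  \<open>\<pi>\<^sub>n\<close> of \<open>\<nu>\<close>, is at most that of \<open>\<gamma>'\<close> (\<open>optimal_policy_cost_to_go_le\<close>). The exceptional
  histories form a null set under \<open>P\<^bsup>\<nu>,\<gamma>\<^esup>\<close>, hence under \<open>P\<^bsup>\<mu>,\<gamma>\<^esup>\<close>
  (\<open>AE_SP_absolutely_continuous\<close>). Under \<open>P\<^bsup>\<mu>,\<gamma>\<^esup>\<close> the cost-to-go is averaged over the filter
  of \<open>\<mu>\<close> instead. Passing to the filter of \<open>\<nu>\<close> for \<open>\<gamma>\<close>, and back for \<open>\<gamma>'\<close>, each costs at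
  most \<open>B\<close> times the total variation between the filters, whose expectation is at most
  \<open>2 \<alpha>\<^sup>n\<close> by stability. This is \<open>discounted_cost_mismatched_le\<close>.

  Two facts from measure theory give these integrals their meaning. The filter has a version,
  since regular conditional probabilities exist on Polish spaces
  (\<open>regular_conditional_probability\<close>), and the total variation between two kernels is measurable
  (\<open>measurable_tv_norm\<close>). Expectations under the strategic measure are computed with the
  transition operators \<open>ahead\<close>, which separate the prior from the dynamics
  (\<open>nn_integral_SP_eq_init\<close>).
\<close>

section \<open>Polish spaces as Borel retracts of the real line\<close>

text \<open>
  Digits 0 and 1 in base 4 leave a tail of at most 1/3, so that, unlike in base 2, the digit sequence
  is determined by the number; the preceding digits contribute a multiple of 4 to the scaled
  number, so a digit is read off as the parity of an integer part.
\<close>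

lemma odd_floor_binary_digit:
  fixes b :: "nat \<Rightarrow> bool"
  defines "t \<equiv> (\<Sum>j. of_bool (b j) * (1/4::real) ^ Suc j)"
  shows "0 \<le> t" "t < 1" "odd \<lfloor>4 ^ Suc i * t\<rfloor> \<longleftrightarrow> b i"
proof -
  have sums: "(\<lambda>j. (1/4::real) ^ Suc j) sums (1/3)"
    using sums_mult[OF geometric_sums[of "1/4::real"], of "1/4"] by simp
  have bnd: "0 \<le> (\<Sum>j. of_bool (c j) * (1/4::real) ^ Suc j)"
       "(\<Sum>j. of_bool (c j) * (1/4::real) ^ Suc j) < 1"
       and smb: "summable (\<lambda>j. of_bool (c j) * (1/4::real) ^ Suc j)" for c :: "nat \<Rightarrow> bool"
  proof -
    show s: "summable (\<lambda>j. of_bool (c j) * (1/4::real) ^ Suc j)"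
      by (rule summable_comparison_test'[OF sums_summable[OF sums], of 0]) auto
    show "0 \<le> (\<Sum>j. of_bool (c j) * (1/4::real) ^ Suc j)"
      by (rule suminf_nonneg[OF s]) auto
    have "(\<Sum>j. of_bool (c j) * (1/4::real) ^ Suc j) \<le> (\<Sum>j. (1/4::real) ^ Suc j)"
      by (rule suminf_le[OF _ s sums_summable[OF sums]]) auto
    then show "(\<Sum>j. of_bool (c j) * (1/4::real) ^ Suc j) < 1"
      using sums_unique[OF sums] by simp
  qed
  show "0 \<le> t" "t < 1" unfolding t_def by (rule bnd)+
  define r where "r = (\<Sum>j. of_bool (b (j + Suc i)) * (1/4::real) ^ Suc j)"
  have r: "0 \<le> r" "r < 1" unfolding r_def by (rule bnd)+
  define z :: int where "z = (\<Sum>j<Suc i. of_bool (b j) * 4 ^ (i - j))"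
  have "t = (\<Sum>j. of_bool (b (j + Suc i)) * (1/4::real) ^ Suc (j + Suc i))
          + (\<Sum>j<Suc i. of_bool (b j) * (1/4::real) ^ Suc j)"
    unfolding t_def by (rule suminf_split_initial_segment[OF smb])
  also have "(\<Sum>j. of_bool (b (j + Suc i)) * (1/4::real) ^ Suc (j + Suc i)) = r * (1/4) ^ Suc i"
    unfolding r_def by (subst suminf_mult2[OF smb]) (simp add: power_add mult_ac)
  finally have "4 ^ Suc i * t = r + 4 ^ Suc i * (\<Sum>j<Suc i. of_bool (b j) * (1/4::real) ^ Suc j)"
    by (simp add: field_simps power_divide)
  also have "4 ^ Suc i * (\<Sum>j<Suc i. of_bool (b j) * (1/4::real) ^ Suc j) = of_int z"
    unfolding z_def sum_distrib_left of_int_sum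
  proof (intro sum.cong refl)
    fix j assume "j \<in> {..<Suc i}"
    then have "(4::real) ^ Suc i = 4 ^ (i - j) * 4 ^ Suc j"
      by (simp flip: power_add power_Suc)
    then show "4 ^ Suc i * (of_bool (b j) * (1 / 4) ^ Suc j)
        = real_of_int (of_bool (b j) * 4 ^ (i - j))"
      by (simp add: power_divide del: power_Suc)
  qed
  finally have "\<lfloor>4 ^ Suc i * t\<rfloor> = z"
    using r by (simp add: floor_unique)
  moreover have "even (\<Sum>j<i. of_bool (b j) * (4::int) ^ (i - j))"
    by (rule dvd_sum) auto
  ultimately show "odd \<lfloor>4 ^ Suc i * t\<rfloor> \<longleftrightarrow> b i"
    by (simp add: z_def)
qed

text \<open>
  A point is encoded by the answers to the countably many questions whether it lies within
  \<open>2\<^sup>-\<^sup>k\<close> of the \<open>j\<close>-th point of a dense sequence. The decoder takes for every \<open>k\<close> the first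
  \<open>j\<close> with a positive answer and passes to the limit. As a limit of measurable functions it is
  measurable on all of \<open>\<real>\<close>, whatever the image of the encoder.
\<close>

lemma polish_borel_retract_real:
  obtains \<phi> :: "'a::polish_space \<Rightarrow> real" and \<psi> :: "real \<Rightarrow> 'a"
  where "\<phi> \<in> borel_measurable borel" "\<psi> \<in> borel_measurable borel"
    "\<And>x. \<psi> (\<phi> x) = x" "\<And>x. 0 \<le> \<phi> x" "\<And>x. \<phi> x < 1"
proof -
  obtain D :: "'a set" where D: "countable D" "\<And>S. open S \<Longrightarrow> S \<noteq> {} \<Longrightarrow> \<exists>d\<in>D. d \<in> S"
    by (rule countable_dense_setE) blast
  have "D \<noteq> {}" using D(2)[of UNIV] by auto
  define d where "d = from_nat_into D"
  have dense: "\<exists>j. dist x (d j) < e" if e: "0 < e" for x e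
  proof -
    obtain y where "y \<in> D" "dist x y < e" using D(2)[of "ball x e"] e by auto
    then show ?thesis using from_nat_into_surj[OF D(1)] by (auto simp: d_def)
  qed
  define bit where "bit x i \<longleftrightarrow> dist x (d (snd (prod_decode i))) < (1/2) ^ fst (prod_decode i)"
    for x i
  define \<phi> where "\<phi> x = (\<Sum>i. of_bool (bit x i) * (1/4::real) ^ Suc i)" for x
  define s where "s k t = d (LEAST j. odd \<lfloor>4 ^ Suc (prod_encode (k, j)) * t\<rfloor>)" for k and t :: real
  \<comment> \<open>The real numbers that encode no point may give a divergent sequence; the default \<open>d 0\<close> makes \<open>\<psi>\<close> total.\<close>
  define \<psi> where "\<psi> t = lim (\<lambda>k. if Cauchy (\<lambda>k. s k t) then s k t else d 0)" for t
  have "\<phi> \<in> borel_measurable borel"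
    unfolding \<phi>_def bit_def of_bool_def by measurable
  moreover have "\<psi> \<in> borel_measurable borel"
  proof (rule borel_measurable_LIMSEQ_metric)
    have [measurable]: "s k \<in> borel_measurable borel" for k
      unfolding s_def by measurable
    show "(\<lambda>t. if Cauchy (\<lambda>k. s k t) then s k t else d 0) \<in> borel_measurable borel" for k
      by measurable
    show "(\<lambda>k. if Cauchy (\<lambda>k. s k t) then s k t else d 0) \<longlonglongrightarrow> \<psi> t" for t
      unfolding \<psi>_def convergent_LIMSEQ_iff[symmetric]
      by (cases "Cauchy (\<lambda>k. s k t)") (auto simp: Cauchy_convergent_iff convergent_const)
  qed
  moreover have "\<psi> (\<phi> x) = x" for x
  proof -
    have "odd \<lfloor>4 ^ Suc i * \<phi> x\<rfloor> \<longleftrightarrow> bit x i" for i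
      unfolding \<phi>_def by (rule odd_floor_binary_digit)
    then have s: "s k (\<phi> x) = d (LEAST j. dist x (d j) < (1/2) ^ k)" for k
      by (simp add: s_def bit_def del: power_Suc)
    have "norm (dist (s k (\<phi> x)) x) \<le> (1/2) ^ k" for k
      unfolding s real_norm_def abs_of_nonneg[OF zero_le_dist] dist_commute[of _ x]
      by (rule less_imp_le, rule LeastI_ex, rule dense) simp
    then have "\<forall>k. norm (dist (s k (\<phi> x)) x) \<le> (1/2) ^ k" ..
    then have "(\<lambda>k. dist (s k (\<phi> x)) x) \<longlonglongrightarrow> 0"
      by (rule Lim_null_comparison[OF always_eventually]) (rule LIMSEQ_realpow_zero; simp)
    then have "(\<lambda>k. s k (\<phi> x)) \<longlonglongrightarrow> x" by (subst tendsto_dist_iff)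
    then show ?thesis
      unfolding \<psi>_def by (simp only: LIMSEQ_imp_Cauchy limI if_True)
  qed
  moreover have "0 \<le> \<phi> x" "\<phi> x < 1" for x
    unfolding \<phi>_def by (rule odd_floor_binary_digit)+
  ultimately show ?thesis by (rule that)
qed

section \<open>Regular conditional probabilities\<close>

lemma AE_le_if_set_nn_integral_le:
  fixes f g :: "'a \<Rightarrow> ennreal"
  assumes [measurable]: "f \<in> borel_measurable M" "g \<in> borel_measurable M"
    and le: "(\<integral>\<^sup>+x\<in>{x \<in> space M. g x < f x}. f x \<partial>M) \<le> (\<integral>\<^sup>+x\<in>{x \<in> space M. g x < f x}. g x \<partial>M)"
    and fin: "(\<integral>\<^sup>+x. g x \<partial>M) \<noteq> \<infinity>"
  shows "AE x in M. f x \<le> g x"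
proof -
  define A where "A = {x \<in> space M. g x < f x}"
  have [measurable]: "A \<in> sets M" unfolding A_def by measurable
  have "(\<integral>\<^sup>+x\<in>A. g x \<partial>M) \<le> (\<integral>\<^sup>+x. g x \<partial>M)"
    by (intro nn_integral_mono) (auto split: split_indicator)
  then have "(\<integral>\<^sup>+x\<in>A. g x \<partial>M) \<noteq> \<infinity>"
    using fin by (auto simp: top_unique)
  then have "(\<integral>\<^sup>+x. f x * indicator A x - g x * indicator A x \<partial>M)
      = (\<integral>\<^sup>+x\<in>A. f x \<partial>M) - (\<integral>\<^sup>+x\<in>A. g x \<partial>M)"
    by (intro nn_integral_diff AE_I2) (auto simp: A_def split: split_indicator)
  also have "\<dots> = 0"
    using le \<open>(\<integral>\<^sup>+x\<in>A. g x \<partial>M) \<noteq> \<infinity>\<close> unfolding A_def[symmetric]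
    by (simp add: diff_eq_0_iff_ennreal less_top)
  finally have "AE x in M. f x * indicator A x - g x * indicator A x = 0"
    by (subst (asm) nn_integral_0_iff_AE) auto
  with AE_space show ?thesis
    by eventually_elim
       (auto simp: A_def diff_eq_0_iff_ennreal not_less[symmetric] split: split_indicator_asm)
qed

text \<open>
  The conditional distribution function at a rational \<open>q\<close> is a Radon-Nikodym derivative. Off one
  null set these derivatives are monotone in \<open>q\<close>, and the infimum over the rationals above \<open>x\<close>
  makes them right-continuous. Since \<open>Z\<close> takes values in \<open>[0,1)\<close>, the function may be set to 0
  below 0 and to 1 from 1 on, which gives the right limits at infinity for free.
\<close>

lemma regular_conditional_probability_real:
  fixes Z :: "'a \<Rightarrow> real" and Y :: "'a \<Rightarrow> 'b"
  assumes P: "prob_space P"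
    and Y [measurable]: "Y \<in> P \<rightarrow>\<^sub>M N" and Z [measurable]: "Z \<in> borel_measurable P"
    and Z01: "\<And>\<omega>. 0 \<le> Z \<omega>" "\<And>\<omega>. Z \<omega> < 1"
  obtains \<kappa> where "\<kappa> \<in> N \<rightarrow>\<^sub>M prob_algebra borel"
    "\<And>A B. A \<in> sets N \<Longrightarrow> B \<in> sets borel \<Longrightarrow>
       emeasure P {\<omega>\<in>space P. Y \<omega> \<in> A \<and> Z \<omega> \<in> B} = (\<integral>\<^sup>+y\<in>A. emeasure (\<kappa> y) B \<partial>distr P N Y)"
proof -
  interpret P: prob_space P by (rule P)
  define L where "L = distr P N Y"
  interpret L: prob_space L unfolding L_def by (rule P.prob_space_distr) simp
  have sL [measurable_cong, simp]: "sets L = sets N" by (simp add: L_def)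
  have spL [simp]: "space L = space N" by (simp add: L_def)
  \<comment> \<open>\<open>D q\<close> is the measure \<open>A \<mapsto> P (Y \<in> A, Z \<le> q)\<close>.\<close>
  define D where "D q = distr (density P (\<lambda>\<omega>. indicator {..q} (Z \<omega>))) N Y" for q :: real
  have D: "emeasure (D q) A = emeasure P {\<omega>\<in>space P. Y \<omega> \<in> A \<and> Z \<omega> \<le> q}"
    if [measurable]: "A \<in> sets N" for q A
  proof -
    have "emeasure (D q) A = (\<integral>\<^sup>+\<omega>. indicator {..q} (Z \<omega>) * indicator (Y -` A \<inter> space P) \<omega> \<partial>P)"
      unfolding D_def by (simp add: emeasure_distr emeasure_density)
    also have "\<dots> = (\<integral>\<^sup>+\<omega>. indicator {\<omega>\<in>space P. Y \<omega> \<in> A \<and> Z \<omega> \<le> q} \<omega> \<partial>P)"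
      by (intro nn_integral_cong) (auto split: split_indicator)
    finally show ?thesis by simp
  qed
  have "absolutely_continuous L (D q)" for q
  proof (unfold absolutely_continuous_def, safe)
    fix A assume A: "A \<in> null_sets L"
    then have [measurable]: "A \<in> sets N" by (auto dest: null_setsD2)
    have "emeasure (D q) A \<le> emeasure P (Y -` A \<inter> space P)"
      unfolding D[OF \<open>A \<in> sets N\<close>] by (intro emeasure_mono) auto
    also have "\<dots> = 0"
      using null_setsD1[OF A] by (simp add: L_def emeasure_distr)
    finally show "A \<in> null_sets (D q)" by (auto simp: D_def)
  qed
  then have RN: "density L (RN_deriv L (D q)) = D q" for q
    by (intro L.density_RN_deriv) (simp_all add: D_def)
  define G0 where "G0 q y = (if q < 0 then 0 else if 1 \<le> q then 1 else enn2real (RN_deriv L (D q) y))"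
    for q :: real and y
  have [measurable]: "G0 q \<in> borel_measurable L" for q
    unfolding G0_def by measurable
  have G0_int: "(\<integral>\<^sup>+y\<in>A. ennreal (G0 q y) \<partial>L) = emeasure P {\<omega>\<in>space P. Y \<omega> \<in> A \<and> Z \<omega> \<le> q}"
    if A [measurable]: "A \<in> sets N" for q A
  proof -
    consider "q < 0" | "1 \<le> q" | "0 \<le> q" "q < 1" by linarith
    then show ?thesis
    proof cases
      case 1
      then have "Z \<omega> \<le> q \<longleftrightarrow> False" for \<omega> using Z01(1)[of \<omega>] by auto
      with 1 show ?thesis by (simp add: G0_def)
    next
      case 2
      then have "Z \<omega> \<le> q \<longleftrightarrow> True" for \<omega> using Z01(2)[of \<omega>] by auto
      with 2 show ?thesis
        by (simp add: G0_def L_def emeasure_distr Int_def vimage_def conj_commute)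
    next
      case 3
      have int: "(\<integral>\<^sup>+y\<in>A. RN_deriv L (D q) y \<partial>L) = emeasure P {\<omega>\<in>space P. Y \<omega> \<in> A \<and> Z \<omega> \<le> q}"
        if [measurable]: "A \<in> sets N" for A
        by (subst emeasure_density[symmetric]) (auto simp: RN D)
      have "(\<integral>\<^sup>+y. RN_deriv L (D q) y \<partial>L) = (\<integral>\<^sup>+y\<in>space N. RN_deriv L (D q) y \<partial>L)"
        by (intro nn_integral_cong) auto
      also have "\<dots> \<noteq> \<infinity>" by (subst int) auto
      finally have "AE y in L. RN_deriv L (D q) y \<noteq> \<infinity>"
        by (intro nn_integral_PInf_AE) auto
      then have "(\<integral>\<^sup>+y\<in>A. ennreal (G0 q y) \<partial>L) = (\<integral>\<^sup>+y\<in>A. RN_deriv L (D q) y \<partial>L)"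
        using 3 by (intro nn_integral_cong_AE) (auto simp: G0_def less_top)
      then show ?thesis by (simp add: int)
    qed
  qed
  define good where "good y \<longleftrightarrow> (\<forall>q r::rat. q \<le> r \<longrightarrow> G0 (of_rat q) y \<le> G0 (of_rat r) y)" for y
  have [measurable]: "Measurable.pred L good" unfolding good_def[abs_def] by measurable
  have "AE y in L. G0 q y \<le> G0 r y" if "q \<le> r" for q r
  proof -
    have "(\<integral>\<^sup>+y\<in>A. ennreal (G0 q y) \<partial>L) \<le> (\<integral>\<^sup>+y\<in>A. ennreal (G0 r y) \<partial>L)"
      if A [measurable]: "A \<in> sets N" for A
      unfolding G0_int[OF A] using \<open>q \<le> r\<close> by (intro emeasure_mono) auto
    moreover have "(\<integral>\<^sup>+y. ennreal (G0 r y) \<partial>L) = (\<integral>\<^sup>+y\<in>space N. ennreal (G0 r y) \<partial>L)"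
      by (intro nn_integral_cong) auto
    then have "(\<integral>\<^sup>+y. ennreal (G0 r y) \<partial>L) \<noteq> \<infinity>"
      by (simp add: G0_int)
    moreover have "{y \<in> space L. ennreal (G0 r y) < ennreal (G0 q y)} \<in> sets N"
      unfolding sL[symmetric] by measurable
    ultimately have "AE y in L. ennreal (G0 q y) \<le> ennreal (G0 r y)"
      by (intro AE_le_if_set_nn_integral_le) simp_all
    moreover have "0 \<le> G0 r y" for y
      by (simp add: G0_def)
    ultimately show ?thesis by (simp add: ennreal_le_iff)
  qed
  then have good: "AE y in L. good y"
    unfolding good_def AE_all_countable by (simp add: of_rat_less_eq)
  \<comment> \<open>On the exceptional null set any distribution function serves, here that of the point mass at 1.\<close>
  define G where "G q y = (if good y then G0 (of_rat q) y else of_bool (1 \<le> q))" for q y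
  have [measurable]: "G q \<in> borel_measurable L" for q
    unfolding G_def by measurable
  have G_mono: "G q y \<le> G r y" if "q \<le> r" for q r y
    using that by (auto simp: G_def good_def)
  have G_0: "G q y = 0" if "q < 0" for q y
    using that by (auto simp: G_def G0_def)
  have G_1: "G q y = 1" if "1 \<le> q" for q y
    using that by (auto simp: G_def G0_def)
  have G_nonneg: "0 \<le> G q y" for q y
    by (auto simp: G_def G0_def)
  have G_int: "(\<integral>\<^sup>+y\<in>A. ennreal (G q y) \<partial>L) = emeasure P {\<omega>\<in>space P. Y \<omega> \<in> A \<and> Z \<omega> \<le> of_rat q}"
    if A: "A \<in> sets N" for q A
    unfolding G0_int[OF A, symmetric] using good
    by (intro nn_integral_cong_AE) (auto simp: G_def)
  define H where "H y x = (INF q\<in>{q. x < of_rat q}. G q y)" for y and x :: real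
  have bdd: "bdd_below ((\<lambda>q. G q y) ` S)" for S y
    by (rule bdd_belowI[of _ 0]) (auto simp: G_nonneg)
  have ne: "{q. x < of_rat q} \<noteq> {}" for x :: real
    using of_rat_dense[of x "x + 1"] by auto
  have H_le: "H y x \<le> G q y" if "x < of_rat q" for x y q
    unfolding H_def by (rule cINF_lower[OF bdd]) (use that in auto)
  have H_ge: "G q y \<le> H y x" if "of_rat q \<le> x" for x y q
    unfolding H_def
    by (rule cINF_greatest[OF ne]) (metis G_mono of_rat_less_eq mem_Collect_eq less_imp_le order_trans that)
  have H_0: "H y x = 0" if x0: "x < 0" for x y
  proof (rule antisym)
    obtain q where "x < of_rat q" "of_rat q < (0::real)" using of_rat_dense[OF x0] by auto
    then show "H y x \<le> 0" using H_le[of x q y] G_0[of q y] by simp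
    show "0 \<le> H y x" unfolding H_def by (rule cINF_greatest[OF ne]) (rule G_nonneg)
  qed
  have H_1: "H y x = 1" if "1 \<le> x" for x y
  proof (rule antisym)
    obtain q where "x < of_rat q" using ne by auto
    moreover from this that have "1 \<le> q"
      by (metis of_rat_1 of_rat_less_eq less_imp_le order_trans)
    ultimately show "H y x \<le> 1" using H_le[of x q y] G_1[of q y] by simp
    show "1 \<le> H y x" using H_ge[of 1 x y] that G_1[of 1 y] by simp
  qed
  have H_mono: "H y a \<le> H y b" if "a \<le> b" for y a b
    unfolding H_def using that by (intro cINF_superset_mono[OF ne bdd]) auto
  have H_rc: "continuous (at_right a) (H y)" for y a
  proof (subst continuous_at_right_real_increasing[OF H_mono], assumption, safe)
    fix e :: real assume "0 < e"
    then have "(INF q\<in>{q. a < of_rat q}. G q y) < H y a + e" unfolding H_def by simp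
    then obtain q where q: "a < of_rat q" "G q y < H y a + e"
      by (subst (asm) cINF_less_iff[OF ne bdd]) auto
    have "H y (a + (of_rat q - a) / 2) \<le> G q y"
      by (rule H_le) (use q(1) in \<open>simp add: field_simps\<close>)
    with q show "\<exists>d>0. H y (a + d) - H y a < e"
      by (intro exI[of _ "(of_rat q - a) / 2"]) auto
  qed
  have H_bot: "(H y \<longlongrightarrow> 0) at_bot" for y
    by (rule tendsto_eventually) (auto simp: eventually_at_bot_dense intro!: exI[of _ 0] H_0)
  have H_top: "(H y \<longlongrightarrow> 1) at_top" for y
    by (rule tendsto_eventually) (auto simp: eventually_at_top_linorder intro!: exI[of _ 1] H_1)
  have [measurable]: "(\<lambda>y. H y x) \<in> borel_measurable N" for x
  proof -
    have "(\<lambda>y. H y x) \<in> borel_measurable L"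
      unfolding H_def by (rule borel_measurable_cINF) (auto intro: bdd)
    then show ?thesis by (simp cong: measurable_cong_sets)
  qed
  define \<kappa> where "\<kappa> y = interval_measure (H y)" for y
  have \<kappa>_Iic: "emeasure (\<kappa> y) {..x} = ennreal (H y x)" for x y
    unfolding \<kappa>_def by (rule emeasure_interval_measure_Iic[OF H_mono H_rc H_bot])
  have \<kappa>_dist: "real_distribution (\<kappa> y)" for y
    unfolding \<kappa>_def by (rule real_distribution_interval_measure[OF H_mono H_rc H_bot H_top])
  have \<kappa>: "\<kappa> \<in> N \<rightarrow>\<^sub>M prob_algebra borel"
  proof (rule measurable_prob_algebra_generated)
    show "sets borel = sigma_sets UNIV (range (\<lambda>a::real. {..a}))"
      unfolding borel_eq_atMost by simp
    show "Int_stable (range (\<lambda>a::real. {..a}))"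
      by (auto simp: Int_stable_def)
    show "prob_space (\<kappa> y)" "sets (\<kappa> y) = sets borel" for y
      using \<kappa>_dist[of y] by (auto simp: real_distribution_def \<kappa>_def)
    show "(\<lambda>y. emeasure (\<kappa> y) A) \<in> borel_measurable N" if "A \<in> range (\<lambda>a::real. {..a})" for A
      using that by (auto simp: \<kappa>_Iic)
  qed simp
  have \<kappa>_sub [measurable]: "\<kappa> \<in> N \<rightarrow>\<^sub>M subprob_algebra borel"
    by (rule measurable_prob_algebraD[OF \<kappa>])
  have "emeasure P {\<omega>\<in>space P. Y \<omega> \<in> A \<and> Z \<omega> \<in> B} = (\<integral>\<^sup>+y\<in>A. emeasure (\<kappa> y) B \<partial>L)"
    if A [measurable]: "A \<in> sets N" and B [measurable]: "B \<in> sets borel" for A B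
  proof -
    \<comment> \<open>For fixed \<open>A\<close> both sides are finite Borel measures in \<open>B\<close>. At a rational \<open>q\<close> the infimum is at least \<open>G\<close>, and at any \<open>x < q\<close> it is at most \<open>G\<close> at \<open>q\<close>, so right-continuity identifies their distribution functions.\<close>
    define m1 where "m1 = distr (density P (\<lambda>\<omega>. indicator A (Y \<omega>))) borel Z"
    define m2 where "m2 = density L (indicator A) \<bind> \<kappa>"
    have m1: "emeasure m1 B = emeasure P {\<omega>\<in>space P. Y \<omega> \<in> A \<and> Z \<omega> \<in> B}"
      if [measurable]: "B \<in> sets borel" for B
    proof -
      have "emeasure m1 B = (\<integral>\<^sup>+\<omega>. indicator A (Y \<omega>) * indicator (Z -` B \<inter> space P) \<omega> \<partial>P)"
        unfolding m1_def by (simp add: emeasure_distr emeasure_density)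
      also have "\<dots> = (\<integral>\<^sup>+\<omega>. indicator {\<omega>\<in>space P. Y \<omega> \<in> A \<and> Z \<omega> \<in> B} \<omega> \<partial>P)"
        by (intro nn_integral_cong) (auto split: split_indicator)
      finally show ?thesis by simp
    qed
    have neN: "space (density L (indicator A)) \<noteq> {}" using L.not_empty by simp
    have m2: "emeasure m2 B = (\<integral>\<^sup>+y\<in>A. emeasure (\<kappa> y) B \<partial>L)" if [measurable]: "B \<in> sets borel" for B
      unfolding m2_def
      by (subst emeasure_bind[OF neN, of _ borel])
         (auto simp: nn_integral_density mult.commute)
    have "sets m2 = sets borel"
      unfolding m2_def by (rule sets_bind[OF _ neN]) (use \<kappa>_dist in \<open>simp add: \<kappa>_def\<close>)
    moreover have "emeasure m2 (space m2) \<noteq> \<infinity>"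
    proof -
      have "emeasure m2 UNIV = (\<integral>\<^sup>+y\<in>A. emeasure (\<kappa> y) UNIV \<partial>L)"
        by (rule m2) simp
      also have "\<dots> \<le> (\<integral>\<^sup>+y. 1 \<partial>L)"
        using \<kappa>_dist by (intro nn_integral_mono)
          (auto split: split_indicator simp: real_distribution_def intro!: prob_space.emeasure_le_1)
      also have "\<dots> < \<infinity>" using L.emeasure_space_1 by simp
      finally show ?thesis using sets_eq_imp_space_eq[OF \<open>sets m2 = sets borel\<close>] by simp
    qed
    ultimately have fb2: "finite_borel_measure m2"
      by (intro finite_borel_measure.intro finite_measureI finite_borel_measure_axioms.intro)
    interpret m2: finite_borel_measure m2 by (rule fb2)
    have fb1: "finite_borel_measure m1"
    proof (intro finite_borel_measure.intro finite_measureI finite_borel_measure_axioms.intro)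
      show "emeasure m1 (space m1) \<noteq> \<infinity>" using m1[of UNIV] by (simp add: m1_def)
    qed (simp add: m1_def)
    interpret m1: finite_borel_measure m1 by (rule fb1)
    have le1: "cdf m1 (of_rat q) \<le> cdf m2 (of_rat q)" for q
    proof -
      have "emeasure m1 {..of_rat q} = (\<integral>\<^sup>+y\<in>A. ennreal (G q y) \<partial>L)"
        by (simp add: m1 G_int[OF A])
      also have "\<dots> \<le> emeasure m2 {..of_rat q}"
        by (auto simp: m2 \<kappa>_Iic intro!: nn_integral_mono mult_right_mono ennreal_leI H_ge)
      finally show ?thesis
        by (simp add: cdf_def m1.emeasure_eq_measure m2.emeasure_eq_measure)
    qed
    have le2: "cdf m2 x \<le> cdf m1 (of_rat q)" if "x < of_rat q" for x q
    proof -
      have "emeasure m2 {..x} \<le> (\<integral>\<^sup>+y\<in>A. ennreal (G q y) \<partial>L)"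
        using that by (auto simp: m2 \<kappa>_Iic intro!: nn_integral_mono mult_right_mono ennreal_leI H_le)
      also have "\<dots> = emeasure m1 {..of_rat q}"
        by (simp add: m1 G_int[OF A])
      finally show ?thesis
        by (simp add: cdf_def m1.emeasure_eq_measure m2.emeasure_eq_measure)
    qed
    have "cdf m1 = cdf m2"
    proof (rule ext, rule antisym)
      fix x
      have rc: "\<exists>q. x < of_rat q \<and> cdf m (of_rat q) < cdf m x + e"
        if "finite_borel_measure m" "0 < e" for m e
      proof -
        interpret m: finite_borel_measure m by fact
        obtain d where d: "0 < d" "cdf m (x + d) - cdf m x < e"
          using m.cdf_is_right_cont[of x] \<open>0 < e\<close>
          by (subst (asm) continuous_at_right_real_increasing[OF m.cdf_nondecreasing]) auto
        obtain q where q: "x < of_rat q" "of_rat q < x + d"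
          using of_rat_dense[of x "x + d"] d(1) by auto
        have "cdf m (of_rat q) \<le> cdf m (x + d)" using q by (intro m.cdf_nondecreasing) simp
        with q d show ?thesis by (intro exI[of _ q]) auto
      qed
      show "cdf m1 x \<le> cdf m2 x"
      proof (rule field_le_epsilon)
        fix e :: real assume "0 < e"
        then obtain q where q: "x < of_rat q" "cdf m2 (of_rat q) < cdf m2 x + e"
          using rc[OF fb2] by auto
        have "cdf m1 x \<le> cdf m1 (of_rat q)" using q by (intro m1.cdf_nondecreasing) simp
        then show "cdf m1 x \<le> cdf m2 x + e" using le1[of q] q(2) by simp
      qed
      show "cdf m2 x \<le> cdf m1 x"
      proof (rule field_le_epsilon)
        fix e :: real assume "0 < e"
        then obtain q where "x < of_rat q" "cdf m1 (of_rat q) < cdf m1 x + e"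
          using rc[OF fb1] by auto
        then show "cdf m2 x \<le> cdf m1 x + e" using le2[of x q] by simp
      qed
    qed
    then have "m1 = m2" by (rule cdf_unique'[OF fb1 fb2])
    then show ?thesis using m1[OF B] m2[OF B] by simp
  qed
  then show ?thesis using \<kappa> that unfolding L_def by blast
qed

text \<open>
  Transport the real case along the encoding of the Polish space into the reals: the kernel of
  the encoded variable is pushed forward by the decoder.
\<close>

lemma regular_conditional_probability:
  fixes X :: "'a \<Rightarrow> 'x::polish_space" and Y :: "'a \<Rightarrow> 'b"
  assumes P: "prob_space P"
    and Y [measurable]: "Y \<in> P \<rightarrow>\<^sub>M N" and X [measurable]: "X \<in> borel_measurable P"
  obtains \<kappa> where "\<kappa> \<in> N \<rightarrow>\<^sub>M prob_algebra borel"
    "\<And>A B. A \<in> sets N \<Longrightarrow> B \<in> sets borel \<Longrightarrow>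
       emeasure P {\<omega>\<in>space P. Y \<omega> \<in> A \<and> X \<omega> \<in> B} = (\<integral>\<^sup>+y\<in>A. emeasure (\<kappa> y) B \<partial>distr P N Y)"
proof -
  obtain \<phi> :: "'x \<Rightarrow> real" and \<psi> where [measurable]: "\<phi> \<in> borel_measurable borel" "\<psi> \<in> borel_measurable borel"
    and \<psi>\<phi>: "\<And>x. \<psi> (\<phi> x) = x" and \<phi>01: "\<And>x. 0 \<le> \<phi> x" "\<And>x. \<phi> x < 1"
    by (rule polish_borel_retract_real) blast
  obtain \<kappa>' where \<kappa>' [measurable]: "\<kappa>' \<in> N \<rightarrow>\<^sub>M prob_algebra (borel :: real measure)"
    and eq: "\<And>A B. A \<in> sets N \<Longrightarrow> B \<in> sets borel \<Longrightarrow>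
       emeasure P {\<omega>\<in>space P. Y \<omega> \<in> A \<and> \<phi> (X \<omega>) \<in> B} = (\<integral>\<^sup>+y\<in>A. emeasure (\<kappa>' y) B \<partial>distr P N Y)"
    by (rule regular_conditional_probability_real[OF P Y, of "\<lambda>\<omega>. \<phi> (X \<omega>)"]) (use \<phi>01 in auto)
  show ?thesis
  proof (rule that[of "\<lambda>y. distr (\<kappa>' y) borel \<psi>"])
    show "(\<lambda>y. distr (\<kappa>' y) borel \<psi>) \<in> N \<rightarrow>\<^sub>M prob_algebra borel" by measurable
    fix A B assume A [measurable]: "A \<in> sets N" and B [measurable]: "B \<in> sets (borel :: 'x measure)"
    have V: "\<psi> -` B \<in> sets borel" using measurable_sets[of \<psi> borel borel B] by simp
    have "emeasure (distr (\<kappa>' y) borel \<psi>) B = emeasure (\<kappa>' y) (\<psi> -` B)" if "y \<in> space N" for y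
    proof -
      have s: "sets (\<kappa>' y) = sets borel"
        using measurable_space[OF \<kappa>' that] by (simp add: space_prob_algebra)
      show ?thesis
        using sets_eq_imp_space_eq[OF s] by (subst emeasure_distr) (simp_all cong: measurable_cong_sets add: s)
    qed
    then have "(\<integral>\<^sup>+y\<in>A. emeasure (distr (\<kappa>' y) borel \<psi>) B \<partial>distr P N Y)
        = (\<integral>\<^sup>+y\<in>A. emeasure (\<kappa>' y) (\<psi> -` B) \<partial>distr P N Y)"
      by (intro nn_integral_cong) simp
    then show "emeasure P {\<omega>\<in>space P. Y \<omega> \<in> A \<and> X \<omega> \<in> B}
        = (\<integral>\<^sup>+y\<in>A. emeasure (distr (\<kappa>' y) borel \<psi>) B \<partial>distr P N Y)"
      using eq[OF A V] by (simp add: \<psi>\<phi>)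
  qed
qed

text \<open>
  This translates the almost sure identity that defines a filter version, one event at a time,
  into an identity between integrals over measurement histories, which is the form in which
  kernels are constructed and used.
\<close>

lemma AE_cond_exp_kernel_iff:
  fixes X :: "'a \<Rightarrow> 'x::topological_space" and Y :: "'a \<Rightarrow> 'b"
  assumes P: "prob_space P"
    and Y [measurable]: "Y \<in> P \<rightarrow>\<^sub>M N" and X [measurable]: "X \<in> borel_measurable P"
    and \<kappa> [measurable]: "\<kappa> \<in> N \<rightarrow>\<^sub>M prob_algebra borel" and B [measurable]: "B \<in> sets borel"
  shows "(AE \<omega> in P. measure (\<kappa> (Y \<omega>)) B
             = real_cond_exp P (vimage_algebra (space P) Y N) (indicator {\<omega>. X \<omega> \<in> B}) \<omega>)
    \<longleftrightarrow> (\<forall>A\<in>sets N. emeasure P {\<omega>\<in>space P. Y \<omega> \<in> A \<and> X \<omega> \<in> B}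
             = (\<integral>\<^sup>+y\<in>A. emeasure (\<kappa> y) B \<partial>distr P N Y))" (is "?ae \<longleftrightarrow> ?int")
proof -
  interpret P: prob_space P by (rule P)
  define F where "F = vimage_algebra (space P) Y N"
  have YN: "Y \<in> space P \<rightarrow> space N" using measurable_space[OF Y] by auto
  have sF: "sets F = {Y -` A \<inter> space P |A. A \<in> sets N}"
    unfolding F_def by (rule sets_vimage_algebra2[OF YN])
  have "subalgebra P F"
    unfolding subalgebra_def sF by (auto simp: F_def)
  then interpret F: finite_measure_subalgebra P F by unfold_locales
  define g where "g = (\<lambda>\<omega>. measure (\<kappa> (Y \<omega>)) B)"
  define f :: "'a \<Rightarrow> real" where "f = indicator {\<omega>. X \<omega> \<in> B}"
  have Y_F [measurable]: "Y \<in> F \<rightarrow>\<^sub>M N"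
    unfolding F_def by (rule measurable_vimage_algebra1[OF YN])
  have \<kappa>B: "(\<lambda>y. measure (\<kappa> y) B) \<in> borel_measurable N" by measurable
  have g_F: "g \<in> borel_measurable F"
    unfolding g_def by (rule measurable_compose[OF Y_F \<kappa>B])
  have [measurable]: "g \<in> borel_measurable P"
    unfolding g_def by (rule measurable_compose[OF Y \<kappa>B])
  have [measurable]: "f \<in> borel_measurable P" unfolding f_def by measurable
  have \<kappa>_prob: "prob_space (\<kappa> y)" if "y \<in> space N" for y
    using measurable_space[OF \<kappa> that] by (simp add: space_prob_algebra)
  have g01: "0 \<le> g \<omega>" "\<omega> \<in> space P \<Longrightarrow> g \<omega> \<le> 1" for \<omega>
    using \<kappa>_prob[THEN prob_space.prob_le_1, of "Y \<omega>" B] measurable_space[OF Y, of \<omega>]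
    by (auto simp: g_def)
  have ig: "integrable P g"
    by (rule P.integrable_const_bound[where B=1]) (auto simp: g01 intro!: AE_I2)
  have "integrable P f"
    by (rule P.integrable_const_bound[where B=1]) (auto simp: f_def split: split_indicator)
  have f_int: "ennreal (LINT \<omega>:Y -` A \<inter> space P|P. f \<omega>) = emeasure P {\<omega>\<in>space P. Y \<omega> \<in> A \<and> X \<omega> \<in> B}"
    if [measurable]: "A \<in> sets N" for A
  proof -
    have "(LINT \<omega>:Y -` A \<inter> space P|P. f \<omega>) = (LINT \<omega>|P. indicator {\<omega>\<in>space P. Y \<omega> \<in> A \<and> X \<omega> \<in> B} \<omega>)"
      unfolding set_lebesgue_integral_def f_def
      by (intro Bochner_Integration.integral_cong) (auto split: split_indicator)
    also have "\<dots> = measure P {\<omega>\<in>space P. Y \<omega> \<in> A \<and> X \<omega> \<in> B}" by simp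
    finally show ?thesis by (simp add: P.emeasure_eq_measure)
  qed
  have g_int: "ennreal (LINT \<omega>:Y -` A \<inter> space P|P. g \<omega>) = (\<integral>\<^sup>+y\<in>A. emeasure (\<kappa> y) B \<partial>distr P N Y)"
    if A [measurable]: "A \<in> sets N" for A
  proof -
    have "ennreal (LINT \<omega>:Y -` A \<inter> space P|P. g \<omega>)
        = (\<integral>\<^sup>+\<omega>. ennreal (indicator (Y -` A \<inter> space P) \<omega> *\<^sub>R g \<omega>) \<partial>P)"
      unfolding set_lebesgue_integral_def
      by (intro nn_integral_eq_integral[symmetric] integrable_mult_indicator ig) (auto simp: g01)
    also have "\<dots> = (\<integral>\<^sup>+\<omega>. emeasure (\<kappa> (Y \<omega>)) B * indicator A (Y \<omega>) \<partial>P)"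
    proof (rule nn_integral_cong)
      fix \<omega> assume "\<omega> \<in> space P"
      then interpret prob_space "\<kappa> (Y \<omega>)"
        using \<kappa>_prob measurable_space[OF Y] by auto
      show "ennreal (indicator (Y -` A \<inter> space P) \<omega> *\<^sub>R g \<omega>) = emeasure (\<kappa> (Y \<omega>)) B * indicator A (Y \<omega>)"
        using \<open>\<omega> \<in> space P\<close> by (auto simp: g_def emeasure_eq_measure split: split_indicator)
    qed
    also have "\<dots> = (\<integral>\<^sup>+y\<in>A. emeasure (\<kappa> y) B \<partial>distr P N Y)"
      using measurable_prob_algebraD[OF \<kappa>] by (subst nn_integral_distr[OF Y]) simp_all
    finally show ?thesis .
  qed
  show ?thesis
  proof
    assume ?ae
    then have ae: "AE \<omega> in P. g \<omega> = real_cond_exp P F f \<omega>"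
      by (simp add: g_def f_def F_def)
    show ?int
    proof
      fix A assume A [measurable]: "A \<in> sets N"
      have AF: "Y -` A \<inter> space P \<in> sets F" using A sF by auto
      have "(LINT \<omega>:Y -` A \<inter> space P|P. f \<omega>) = (LINT \<omega>:Y -` A \<inter> space P|P. real_cond_exp P F f \<omega>)"
        by (rule F.real_cond_exp_intA[OF \<open>integrable P f\<close> AF])
      also have "\<dots> = (LINT \<omega>:Y -` A \<inter> space P|P. g \<omega>)"
        unfolding set_lebesgue_integral_def using ae by (intro integral_cong_AE) auto
      finally show "emeasure P {\<omega>\<in>space P. Y \<omega> \<in> A \<and> X \<omega> \<in> B} = (\<integral>\<^sup>+y\<in>A. emeasure (\<kappa> y) B \<partial>distr P N Y)"
        by (simp flip: f_int[OF A] g_int[OF A])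
    qed
  next
    assume int: ?int
    have "AE \<omega> in P. real_cond_exp P F f \<omega> = g \<omega>"
    proof (rule F.real_cond_exp_charact[OF _ \<open>integrable P f\<close> ig g_F])
      fix C assume "C \<in> sets F"
      then obtain A where A: "A \<in> sets N" and C: "C = Y -` A \<inter> space P" using sF by auto
      have "0 \<le> (LINT \<omega>:C|P. f \<omega>)" "0 \<le> (LINT \<omega>:C|P. g \<omega>)"
        unfolding set_lebesgue_integral_def f_def by (auto intro!: integral_nonneg_AE simp: g01)
      moreover have "ennreal (LINT \<omega>:C|P. f \<omega>) = ennreal (LINT \<omega>:C|P. g \<omega>)"
        unfolding C f_int[OF A] g_int[OF A] using int A by blast
      ultimately show "(LINT \<omega>:C|P. f \<omega>) = (LINT \<omega>:C|P. g \<omega>)"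
        by (simp only: ennreal_inj)
    qed
    then show ?ae by (auto simp: g_def f_def F_def)
  qed
qed

text \<open>
  By the assumption, the law of \<open>(X, Y)\<close> and the composition of the law of \<open>Y\<close> with the kernel
  agree on measurable rectangles, which generate the product sigma field.
\<close>

lemma nn_integral_disintegration:
  assumes P: "prob_space P"
    and Y [measurable]: "Y \<in> P \<rightarrow>\<^sub>M N" and X [measurable]: "X \<in> P \<rightarrow>\<^sub>M M"
    and \<kappa> [measurable]: "\<kappa> \<in> N \<rightarrow>\<^sub>M prob_algebra M"
    and eq: "\<And>A B. A \<in> sets N \<Longrightarrow> B \<in> sets M \<Longrightarrow>
       emeasure P {\<omega>\<in>space P. Y \<omega> \<in> A \<and> X \<omega> \<in> B} = (\<integral>\<^sup>+y\<in>A. emeasure (\<kappa> y) B \<partial>distr P N Y)"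
    and h [measurable]: "h \<in> borel_measurable (M \<Otimes>\<^sub>M N)"
  shows "(\<integral>\<^sup>+\<omega>. h (X \<omega>, Y \<omega>) \<partial>P) = (\<integral>\<^sup>+\<omega>. \<integral>\<^sup>+x. h (x, Y \<omega>) \<partial>\<kappa> (Y \<omega>) \<partial>P)"
proof -
  interpret P: prob_space P by (rule P)
  define L where "L = distr P N Y"
  have [measurable_cong]: "sets L = sets N" by (simp add: L_def)
  have neL: "space L \<noteq> {}" using P.not_empty measurable_space[OF Y] by (auto simp: L_def)
  define K where "K = (\<lambda>y. distr (\<kappa> y) (M \<Otimes>\<^sub>M N) (\<lambda>x. (x, y)))"
  have K_prob: "K \<in> N \<rightarrow>\<^sub>M prob_algebra (M \<Otimes>\<^sub>M N)" unfolding K_def by measurable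
  have K [measurable]: "K \<in> L \<rightarrow>\<^sub>M subprob_algebra (M \<Otimes>\<^sub>M N)"
    using measurable_prob_algebraD[OF K_prob] by (simp cong: measurable_cong_sets)
  have s\<kappa>: "sets (\<kappa> y) = sets M" if "y \<in> space N" for y
    using measurable_space[OF \<kappa> that] by (simp add: space_prob_algebra)
  have pair: "(\<lambda>x. (x, y)) \<in> \<kappa> y \<rightarrow>\<^sub>M M \<Otimes>\<^sub>M N" if "y \<in> space N" for y
    using that by (simp add: measurable_cong_sets[OF s\<kappa>[OF that] refl])
  define m1 where "m1 = distr P (M \<Otimes>\<^sub>M N) (\<lambda>\<omega>. (X \<omega>, Y \<omega>))"
  define m2 where "m2 = L \<bind> K"
  have "m1 = m2"
  proof (rule measure_eqI_generator_eq[where A="\<lambda>_. space M \<times> space N"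
        and E="{a \<times> b | a b. a \<in> sets M \<and> b \<in> sets N}" and \<Omega>="space M \<times> space N"])
    show "Int_stable {a \<times> b |a b. a \<in> sets M \<and> b \<in> sets N}" by (rule Int_stable_pair_measure_generator)
    show "{a \<times> b |a b. a \<in> sets M \<and> b \<in> sets N} \<subseteq> Pow (space M \<times> space N)" by (rule pair_measure_closed)
    show "sets m1 = sigma_sets (space M \<times> space N) {a \<times> b |a b. a \<in> sets M \<and> b \<in> sets N}"
      by (simp add: m1_def sets_pair_measure)
    show "sets m2 = sigma_sets (space M \<times> space N) {a \<times> b |a b. a \<in> sets M \<and> b \<in> sets N}"
      unfolding m2_def by (subst sets_bind[OF _ neL, of _ "M \<Otimes>\<^sub>M N"])
        (auto simp: sets_pair_measure K_def)
    show "emeasure m1 (space M \<times> space N) \<noteq> \<infinity>" by (simp add: m1_def emeasure_distr)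
    fix S assume "S \<in> {a \<times> b |a b. a \<in> sets M \<and> b \<in> sets N}"
    then obtain B A where S: "S = B \<times> A" and A [measurable]: "A \<in> sets N" and B [measurable]: "B \<in> sets M"
      by auto
    have "emeasure m1 S = emeasure P {\<omega>\<in>space P. Y \<omega> \<in> A \<and> X \<omega> \<in> B}"
      unfolding m1_def S by (subst emeasure_distr) (auto intro!: arg_cong2[where f=emeasure])
    also have "\<dots> = (\<integral>\<^sup>+y\<in>A. emeasure (\<kappa> y) B \<partial>L)" unfolding L_def by (rule eq[OF A B])
    also have "\<dots> = (\<integral>\<^sup>+y. emeasure (K y) S \<partial>L)"
    proof (rule nn_integral_cong)
      fix y assume "y \<in> space L"
      then have y: "y \<in> space N" by (simp add: L_def)
      have "emeasure (K y) S = emeasure (\<kappa> y) ((\<lambda>x. (x, y)) -` S \<inter> space (\<kappa> y))"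
        unfolding K_def S by (rule emeasure_distr[OF pair[OF y]]) simp
      also have "(\<lambda>x. (x, y)) -` S \<inter> space (\<kappa> y) = (if y \<in> A then B else {})"
        using sets.sets_into_space[OF B] sets_eq_imp_space_eq[OF s\<kappa>[OF y]] by (auto simp: S)
      finally show "emeasure (\<kappa> y) B * indicator A y = emeasure (K y) S" by simp
    qed
    also have "\<dots> = emeasure m2 S"
      unfolding m2_def by (rule emeasure_bind[OF neL K, symmetric]) (simp add: S)
    finally show "emeasure m1 S = emeasure m2 S" .
  qed (auto)
  have "(\<integral>\<^sup>+\<omega>. h (X \<omega>, Y \<omega>) \<partial>P) = (\<integral>\<^sup>+z. h z \<partial>m1)"
    unfolding m1_def by (subst nn_integral_distr) auto
  also have "\<dots> = (\<integral>\<^sup>+y. \<integral>\<^sup>+z. h z \<partial>K y \<partial>L)"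
    unfolding \<open>m1 = m2\<close> m2_def by (rule nn_integral_bind[OF h K])
  also have "\<dots> = (\<integral>\<^sup>+\<omega>. \<integral>\<^sup>+z. h z \<partial>K (Y \<omega>) \<partial>P)"
    unfolding L_def using nn_integral_measurable_subprob_algebra[OF h] measurable_prob_algebraD[OF K_prob]
    by (subst nn_integral_distr[OF Y]) (auto intro: measurable_compose)
  also have "\<dots> = (\<integral>\<^sup>+\<omega>. \<integral>\<^sup>+x. h (x, Y \<omega>) \<partial>\<kappa> (Y \<omega>) \<partial>P)"
    unfolding K_def using measurable_space[OF Y]
    by (intro nn_integral_cong) (simp add: nn_integral_distr[OF pair])
  finally show ?thesis .
qed

section \<open>Measurability of the total variation norm\<close>

lemma prob_algebraD:
  assumes "P \<in> space (prob_algebra M)"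
  shows "prob_space P" "sets P = sets M" "space P = space M"
  using assms sets_eq_imp_space_eq[of P M] by (auto simp: space_prob_algebra)

text \<open>
  Squeeze \<open>B\<close> between a compact set that is almost as large for \<open>P\<close> and an open set that is
  barely larger for \<open>R\<close>; finitely many basic open sets cover the former inside the latter.
\<close>

lemma approx_by_finite_basis_union:
  fixes P R :: "'a::polish_space measure"
  assumes P: "P \<in> space (prob_algebra borel)" and R: "R \<in> space (prob_algebra borel)"
    and \<B>: "topological_basis \<B>" and B: "B \<in> sets borel" and e: "0 < e"
  obtains F where "finite F" "F \<subseteq> \<B>"
    "measure P B - measure R B \<le> measure P (\<Union>F) - measure R (\<Union>F) + e"
proof -
  interpret P: prob_space P by (rule prob_algebraD[OF P])
  interpret R: prob_space R by (rule prob_algebraD[OF R])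
  note sP = prob_algebraD(2)[OF P] and sR = prob_algebraD(2)[OF R]
  have "\<exists>K. K \<subseteq> B \<and> compact K \<and> measure P B - e / 2 \<le> measure P K"
  proof (cases "measure P B \<le> e / 2")
    case True
    then show ?thesis by (intro exI[of _ "{}"]) auto
  next
    case False
    have "ennreal (measure P B - e / 2) < emeasure P B"
      using e False by (simp add: P.emeasure_eq_measure ennreal_less_iff)
    also have "emeasure P B = (SUP K\<in>{K. K \<subseteq> B \<and> compact K}. emeasure P K)"
      by (rule inner_regular[OF sP _ B]) simp
    finally obtain K where "K \<subseteq> B" "compact K" "ennreal (measure P B - e / 2) < emeasure P K"
      unfolding less_SUP_iff by auto
    then show ?thesis using False
      by (intro exI[of _ K]) (auto simp: P.emeasure_eq_measure ennreal_less_iff)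
  qed
  then obtain K where K: "K \<subseteq> B" "compact K" "measure P B - e / 2 \<le> measure P K" by auto
  have "(INF U\<in>{U. B \<subseteq> U \<and> open U}. emeasure R U) < ennreal (measure R B + e / 2)"
    using e by (subst outer_regular[OF sR _ B, symmetric]) (simp_all add: R.emeasure_eq_measure ennreal_less_iff)
  then obtain U where U: "B \<subseteq> U" "open U" "emeasure R U < ennreal (measure R B + e / 2)"
    unfolding INF_less_iff by auto
  then have RU: "measure R U \<le> measure R B + e / 2"
    by (auto simp: R.emeasure_eq_measure ennreal_less_iff)
  obtain \<C> where \<C>: "\<C> \<subseteq> \<B>" "\<Union>\<C> = U" using \<B> U(2) unfolding topological_basis_def by blast
  have "\<And>c. c \<in> \<C> \<Longrightarrow> open c" using \<C>(1) topological_basis_open[OF \<B>] by auto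
  moreover have "K \<subseteq> \<Union>\<C>" using K(1) U(1) \<C>(2) by auto
  ultimately obtain F where F: "F \<subseteq> \<C>" "finite F" "K \<subseteq> \<Union>F"
    using compactE[OF K(2), of \<C>] by metis
  have op: "open (\<Union>F)" using F(1) \<open>\<And>c. c \<in> \<C> \<Longrightarrow> open c\<close> by (intro open_Union) auto
  have "measure P K \<le> measure P (\<Union>F)"
    using F(3) op by (intro P.finite_measure_mono) (auto simp: sP)
  moreover have "measure R (\<Union>F) \<le> measure R U"
    using F(1) \<C>(2) U(2) by (intro R.finite_measure_mono) (auto simp: sR)
  ultimately have "measure P B - measure R B \<le> measure P (\<Union>F) - measure R (\<Union>F) + e"
    using K(3) RU by simp
  then show ?thesis using F \<C>(1) that[of F] by auto
qed

text \<open>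
  A function with values in \<open>[0,1]\<close> is within \<open>1/n\<close> of the average of the indicators of its
  \<open>n\<close> superlevel sets, and the hypothesis applies to each of them.
\<close>

lemma integral_diff_le_of_measure_diff_le:
  fixes P R :: "'a measure"
  assumes P: "P \<in> space (prob_algebra M)" and R: "R \<in> space (prob_algebra M)"
    and g [measurable]: "g \<in> borel_measurable M" and g01: "\<And>x. 0 \<le> g x" "\<And>x. g x \<le> (1::real)"
    and le: "\<And>B. B \<in> sets M \<Longrightarrow> measure P B - measure R B \<le> d"
  shows "(\<integral>x. g x \<partial>P) - (\<integral>x. g x \<partial>R) \<le> d"
proof (rule field_le_epsilon)
  fix e :: real assume "0 < e"
  then obtain n where n: "0 < n" "1 / real n < e"
    by (metis nat_approx_posE zero_less_Suc)
  interpret P: prob_space P by (rule prob_algebraD[OF P])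
  interpret R: prob_space R by (rule prob_algebraD[OF R])
  note [measurable_cong] = prob_algebraD(2)[OF P] prob_algebraD(2)[OF R]
  note sp = prob_algebraD(3)[OF P] prob_algebraD(3)[OF R]
  define A where "A k = {x \<in> space M. real k \<le> real n * g x}" for k
  have [measurable]: "A k \<in> sets M" for k unfolding A_def by measurable
  have floor: "(\<Sum>k=1..n. indicator (A k) x) = real_of_int \<lfloor>real n * g x\<rfloor>" if "x \<in> space M" for x
  proof -
    have "real n * g x \<le> real n" using g01[of x] by (simp add: mult_left_le)
    then have "{k \<in> {1..n}. real k \<le> real n * g x} = {1..nat \<lfloor>real n * g x\<rfloor>}"
      by (auto simp: le_nat_floor le_floor_iff nat_le_iff) linarith+
    moreover have "(\<Sum>k=1..n. indicator (A k) x) = real (card {k \<in> {1..n}. real k \<le> real n * g x})"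
      using that by (simp add: A_def indicator_def sum.If_cases Int_def conj_commute)
    ultimately show ?thesis using g01(1)[of x] by simp
  qed
  have iP: "integrable P g"
    by (rule P.integrable_const_bound[where B=1]) (auto simp: g01)
  have iR: "integrable R g"
    by (rule R.integrable_const_bound[where B=1]) (auto simp: g01)
  have "n * (\<integral>x. g x \<partial>P) = (\<integral>x. n * g x \<partial>P)" by simp
  also have "\<dots> \<le> (\<integral>x. (\<Sum>k=1..n. indicator (A k) x) + 1 \<partial>P)"
    by (intro integral_mono integrable_mult_right iP Bochner_Integration.integrable_add
          Bochner_Integration.integrable_sum)
       (auto simp: sp floor[unfolded One_nat_def] P.emeasure_eq_measure)
  also have "\<dots> = (\<Sum>k=1..n. measure P (A k)) + 1"
    by (simp add: Bochner_Integration.integral_sum P.emeasure_eq_measure P.prob_space)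
  finally have 1: "n * (\<integral>x. g x \<partial>P) \<le> (\<Sum>k=1..n. measure P (A k)) + 1" .
  have "(\<Sum>k=1..n. measure R (A k)) = (\<integral>x. (\<Sum>k=1..n. indicator (A k) x) \<partial>R)"
    by (simp add: Bochner_Integration.integral_sum R.emeasure_eq_measure)
  also have "\<dots> \<le> (\<integral>x. n * g x \<partial>R)"
    by (intro integral_mono integrable_mult_right iR Bochner_Integration.integrable_sum)
       (auto simp: sp floor[unfolded One_nat_def] R.emeasure_eq_measure)
  finally have 2: "(\<Sum>k=1..n. measure R (A k)) \<le> n * (\<integral>x. g x \<partial>R)" by simp
  have "(\<Sum>k=1..n. measure P (A k) - measure R (A k)) \<le> (\<Sum>k=1..n. d)"
    by (intro sum_mono le) simp
  then have "n * ((\<integral>x. g x \<partial>P) - (\<integral>x. g x \<partial>R)) \<le> n * d + 1"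
    using 1 2 by (simp add: sum_subtractf right_diff_distrib)
  then have "(\<integral>x. g x \<partial>P) - (\<integral>x. g x \<partial>R) \<le> d + 1 / n"
    using n(1) by (simp add: field_simps)
  then show "(\<integral>x. g x \<partial>P) - (\<integral>x. g x \<partial>R) \<le> d + e" using n(2) by simp
qed

lemma abs_integral_le_1:
  fixes f :: "'a::topological_space \<Rightarrow> real"
  assumes P: "P \<in> space (prob_algebra borel)"
    and f: "f \<in> borel_measurable borel" "\<And>x. \<bar>f x\<bar> \<le> 1"
  shows "integrable P f" "\<bar>\<integral>x. f x \<partial>P\<bar> \<le> 1"
proof -
  interpret P: prob_space P by (rule prob_algebraD[OF P])
  show i: "integrable P f"
    using f by (intro P.integrable_const_bound[where B=1])
      (auto cong: measurable_cong_sets simp: prob_algebraD[OF P])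
  have "\<bar>\<integral>x. f x \<partial>P\<bar> \<le> (\<integral>x. \<bar>f x\<bar> \<partial>P)" by (rule integral_abs_bound)
  also have "\<dots> \<le> (\<integral>x. 1 \<partial>P)" using i f by (intro integral_mono) auto
  finally show "\<bar>\<integral>x. f x \<partial>P\<bar> \<le> 1" by (simp add: P.prob_space)
qed

context
  fixes P R :: "'a::topological_space measure"
  assumes P: "P \<in> space (prob_algebra borel)" and R: "R \<in> space (prob_algebra borel)"
begin

lemma integral_diff_le_2:
  fixes f :: "'a \<Rightarrow> real"
  assumes "f \<in> borel_measurable borel" "\<And>x. \<bar>f x\<bar> \<le> 1"
  shows "\<bar>(\<integral>x. f x \<partial>P) - (\<integral>x. f x \<partial>R)\<bar> \<le> 2"
  using abs_integral_le_1(2)[OF P assms] abs_integral_le_1(2)[OF R assms] by linarith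

lemma tv_norm_bdd:
  "bdd_above ((\<lambda>f. \<bar>(\<integral>x. f x \<partial>P) - (\<integral>x. f x \<partial>R)\<bar>) ` {f \<in> borel_measurable borel. \<forall>x. \<bar>f x\<bar> \<le> (1::real)})"
  by (rule bdd_aboveI[where M="2::real"]) (use integral_diff_le_2 in auto)

lemma integral_diff_le_tv_norm:
  fixes f :: "'a \<Rightarrow> real"
  assumes "f \<in> borel_measurable borel" "\<And>x. \<bar>f x\<bar> \<le> 1"
  shows "\<bar>(\<integral>x. f x \<partial>P) - (\<integral>x. f x \<partial>R)\<bar> \<le> tv_norm P R"
  unfolding tv_norm_def by (rule cSUP_upper[OF _ tv_norm_bdd]) (use assms in auto)

lemma tv_norm_nonneg: "0 \<le> tv_norm P R"
  using integral_diff_le_tv_norm[of "\<lambda>_. 0"] by simp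

lemma tv_norm_le_2: "tv_norm P R \<le> 2"
  unfolding tv_norm_def
proof (rule cSUP_least)
  show "{f \<in> borel_measurable (borel :: 'a measure). \<forall>x. \<bar>f x\<bar> \<le> (1::real)} \<noteq> {}"
    by (auto intro!: exI[of _ "\<lambda>_. 0"])
qed (use integral_diff_le_2 in auto)

text \<open>
  The total variation norm controls integrands bounded by 1 in absolute value, hence one with
  values in \<open>[0, M]\<close> up to the factor \<open>M\<close>.
\<close>

lemma nn_integral_le_tv_norm:
  fixes h :: "'a \<Rightarrow> ennreal"
  assumes h: "h \<in> borel_measurable borel" and hM: "\<And>x. h x \<le> ennreal M" and M: "0 < M"
  shows "(\<integral>\<^sup>+x. h x \<partial>P) \<le> (\<integral>\<^sup>+x. h x \<partial>R) + ennreal (M * tv_norm P R)"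
proof -
  define f where "f x = enn2real (h x) / M" for x
  have [measurable]: "f \<in> borel_measurable borel" unfolding f_def using h by measurable
  have hf: "h x = ennreal (M * f x)" for x
    using M hM[of x] by (simp add: f_def less_top top_unique le_less_trans)
  have f01: "0 \<le> f x" "f x \<le> 1" for x
    using hM[of x] M by (auto simp: f_def enn2real_leI)
  have int: "(\<integral>\<^sup>+x. h x \<partial>S) = ennreal (M * (\<integral>x. f x \<partial>S))" if "S \<in> space (prob_algebra borel)" for S
    unfolding hf
    by (subst nn_integral_eq_integral)
       (use abs_integral_le_1(1)[OF that, of f] f01 M in \<open>auto simp: abs_le_iff\<close>)
  have "(\<integral>x. f x \<partial>P) - (\<integral>x. f x \<partial>R) \<le> tv_norm P R"
    using integral_diff_le_tv_norm[of f] f01 by (auto simp: abs_le_iff intro: order_trans[of _ 0])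
  then have "M * (\<integral>x. f x \<partial>P) \<le> M * (\<integral>x. f x \<partial>R) + M * tv_norm P R"
    using M by (simp flip: distrib_left)
  moreover have "0 \<le> (\<integral>x. f x \<partial>R)" using f01 by (intro integral_nonneg_AE) auto
  ultimately show ?thesis
    using M tv_norm_nonneg by (simp add: int[OF P] int[OF R] flip: ennreal_plus)
qed

end

text \<open>
  A bounded function is controlled by its superlevel sets, and a Borel set is approximated by
  finite unions from a basis. With a countable basis the supremum over all measurable functions
  becomes countable, which is what makes the norm a measurable function of the two measures.
\<close>

lemma tv_norm_eq_SUP_basis:
  fixes P R :: "'a::polish_space measure"
  assumes P: "P \<in> space (prob_algebra borel)" and R: "R \<in> space (prob_algebra borel)"
    and \<B>: "topological_basis \<B>"
  shows "bdd_above ((\<lambda>F. 2 * (measure P (\<Union>F) - measure R (\<Union>F))) ` {F. finite F \<and> F \<subseteq> \<B>})"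
    and "tv_norm P R = (SUP F\<in>{F. finite F \<and> F \<subseteq> \<B>}. 2 * (measure P (\<Union>F) - measure R (\<Union>F)))"
proof -
  interpret P: prob_space P by (rule prob_algebraD[OF P])
  interpret R: prob_space R by (rule prob_algebraD[OF R])
  have sets: "sets P = sets borel" "sets R = sets borel" "space P = UNIV" "space R = UNIV"
    using prob_algebraD[OF P] prob_algebraD[OF R] by auto
  let ?s = "\<lambda>F. 2 * (measure P (\<Union>F) - measure R (\<Union>F))"
  let ?F = "{F. finite F \<and> F \<subseteq> \<B>}"
  have le: "?s F \<le> tv_norm P R" if "F \<in> ?F" for F
  proof -
    have [measurable]: "\<Union>F \<in> sets borel"
      using that topological_basis_open[OF \<B>] by (intro borel_open open_Union) auto
    have eq: "(\<integral>x. 2 * indicator (\<Union>F) x - 1 \<partial>S) = 2 * measure S (\<Union>F) - 1"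
      if "prob_space S" "sets S = sets borel" for S
    proof -
      interpret S: prob_space S by fact
      show ?thesis
        using that(2) sets_eq_imp_space_eq[OF that(2)] S.prob_space
        by (subst Bochner_Integration.integral_diff) (auto simp: S.prob_space S.emeasure_eq_measure)
    qed
    have "\<bar>(\<integral>x. 2 * indicator (\<Union>F) x - 1 \<partial>P) - (\<integral>x. 2 * indicator (\<Union>F) x - 1 \<partial>R)\<bar> \<le> tv_norm P R"
      by (rule integral_diff_le_tv_norm[OF P R]) (auto split: split_indicator)
    then show ?thesis
      by (simp add: eq sets P.prob_space_axioms R.prob_space_axioms)
  qed
  show bdd: "bdd_above (?s ` ?F)" using le by (intro bdd_aboveI[of _ "tv_norm P R"]) auto
  show "tv_norm P R = (SUP F\<in>?F. ?s F)"
  proof (rule antisym)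
    show "(SUP F\<in>?F. ?s F) \<le> tv_norm P R"
      using le by (intro cSUP_least) auto
    have sets_le: "measure P B - measure R B \<le> (SUP F\<in>?F. ?s F) / 2" if B: "B \<in> sets borel" for B
    proof (rule field_le_epsilon)
      fix e :: real assume "0 < e"
      obtain F where "finite F" "F \<subseteq> \<B>"
        "measure P B - measure R B \<le> measure P (\<Union>F) - measure R (\<Union>F) + e"
        by (rule approx_by_finite_basis_union[OF P R \<B> B \<open>0 < e\<close>])
      moreover from this have "?s F \<le> (SUP F\<in>?F. ?s F)"
        by (intro cSUP_upper[OF _ bdd]) auto
      ultimately show "measure P B - measure R B \<le> (SUP F\<in>?F. ?s F) / 2 + e" by simp
    qed
    have half: "(\<integral>x. f x \<partial>P) - (\<integral>x. f x \<partial>R) \<le> (SUP F\<in>?F. ?s F)"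
      if f [measurable]: "f \<in> borel_measurable borel" and f1: "\<And>x. \<bar>f x\<bar> \<le> 1" for f
    proof -
      have eq: "(\<integral>x. (f x + 1) / 2 \<partial>S) = ((\<integral>x. f x \<partial>S) + 1) / 2" if "S \<in> space (prob_algebra borel)" for S
      proof -
        interpret S: prob_space S by (rule prob_algebraD[OF that])
        show ?thesis using abs_integral_le_1(1)[OF that f f1] by (simp add: S.prob_space)
      qed
      have b: "0 \<le> (f x + 1) / 2" "(f x + 1) / 2 \<le> 1" for x
        using f1[of x] by auto
      have "(\<integral>x. (f x + 1) / 2 \<partial>P) - (\<integral>x. (f x + 1) / 2 \<partial>R) \<le> (SUP F\<in>?F. ?s F) / 2"
        by (rule integral_diff_le_of_measure_diff_le[OF P R _ b sets_le]) auto
      moreover have "(a + 1) / 2 - (b + 1) / 2 \<le> s / 2 \<Longrightarrow> a - b \<le> s" for a b s :: real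
        by (simp add: field_simps)
      ultimately show ?thesis unfolding eq[OF P] eq[OF R] by blast
    qed
    show "tv_norm P R \<le> (SUP F\<in>?F. ?s F)"
      unfolding tv_norm_def
    proof (rule cSUP_least)
      show "{f \<in> borel_measurable (borel :: 'a measure). \<forall>x. \<bar>f x\<bar> \<le> (1::real)} \<noteq> {}"
        by (auto intro!: exI[of _ "\<lambda>_. 0"])
      fix f :: "'a \<Rightarrow> real" assume f: "f \<in> {f \<in> borel_measurable borel. \<forall>x. \<bar>f x\<bar> \<le> 1}"
      then show "\<bar>(\<integral>x. f x \<partial>P) - (\<integral>x. f x \<partial>R)\<bar> \<le> (SUP F\<in>?F. ?s F)"
        using half[of f] half[of "\<lambda>x. - f x"] by (auto simp: abs_le_iff)
    qed
  qed
qed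

lemma measurable_tv_norm:
  fixes \<kappa> \<kappa>' :: "'b \<Rightarrow> 'a::polish_space measure"
  assumes \<kappa> [measurable]: "\<kappa> \<in> N \<rightarrow>\<^sub>M prob_algebra borel" and \<kappa>' [measurable]: "\<kappa>' \<in> N \<rightarrow>\<^sub>M prob_algebra borel"
  shows "(\<lambda>y. tv_norm (\<kappa> y) (\<kappa>' y)) \<in> borel_measurable N"
proof -
  obtain \<B> :: "'a set set" where \<B>: "countable \<B>" "topological_basis \<B>"
    using ex_countable_basis by auto
  note sp = measurable_space[OF \<kappa>] measurable_space[OF \<kappa>']
  have "(\<lambda>y. SUP F\<in>{F. finite F \<and> F \<subseteq> \<B>}. 2 * (measure (\<kappa> y) (\<Union>F) - measure (\<kappa>' y) (\<Union>F)))
      \<in> borel_measurable N"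
  proof (rule borel_measurable_cSUP)
    show "countable {F. finite F \<and> F \<subseteq> \<B>}" by (rule countable_Collect_finite_subset[OF \<B>(1)])
    fix F assume "F \<in> {F. finite F \<and> F \<subseteq> \<B>}"
    then have [measurable]: "\<Union>F \<in> sets borel"
      using topological_basis_open[OF \<B>(2)] by (intro borel_open open_Union) auto
    show "(\<lambda>y. 2 * (measure (\<kappa> y) (\<Union>F) - measure (\<kappa>' y) (\<Union>F))) \<in> borel_measurable N"
      by measurable
  qed (rule tv_norm_eq_SUP_basis(1)[OF sp \<B>(2)])
  then show ?thesis
    by (subst measurable_cong[OF tv_norm_eq_SUP_basis(2)[OF sp \<B>(2)]])
qed

section \<open>Transition operators and the strategic measure\<close>

lemma action_cong:
  assumes "\<And>i. i \<le> m \<Longrightarrow> y i = y' i"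
  shows "action \<gamma> y m = action \<gamma> y' m"
  using assms
proof (induction m rule: less_induct)
  case (less m)
  have "(\<lambda>i\<in>{..m}. y i) = (\<lambda>i\<in>{..m}. y' i)"
    using less.prems by (intro restrict_ext) auto
  moreover have "(\<lambda>i\<in>{..<m}. action \<gamma> y i) = (\<lambda>i\<in>{..<m}. action \<gamma> y' i)"
    using less by (intro restrict_ext) auto
  ultimately show ?case by (subst (1 2) action.simps) simp
qed

abbreviation seq_borel :: "(nat \<Rightarrow> 'a::topological_space) measure" where
  "seq_borel \<equiv> PiM UNIV (\<lambda>_. borel)"

text \<open>
  Functions of a measurement history are represented as functions of a full sequence that depend
  only on an initial segment. All times then share one measurable space.
\<close>

definition depends_upto :: "nat \<Rightarrow> ('x \<times> (nat \<Rightarrow> 'y) \<Rightarrow> 'c) \<Rightarrow> bool" where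
  "depends_upto n h \<longleftrightarrow> (\<forall>x y y'. (\<forall>i\<le>n. y i = y' i) \<longrightarrow> h (x, y) = h (x, y'))"

lemma depends_uptoD:
  "depends_upto n h \<Longrightarrow> (\<And>i. i \<le> n \<Longrightarrow> y i = y' i) \<Longrightarrow> h (x, y) = h (x, y')"
  by (auto simp: depends_upto_def)

lemma measurable_meas_seq [measurable]:
  "meas_seq \<in> PiM UNIV (\<lambda>_. borel :: ('x::second_countable_topology \<times> 'y::second_countable_topology) measure)
     \<rightarrow>\<^sub>M seq_borel"
  unfolding meas_seq_def borel_prod[symmetric] by (rule measurable_PiM_single') auto

lemma measurable_meas_hist [measurable]:
  "meas_hist n \<in> PiM UNIV (\<lambda>_. borel :: ('x::second_countable_topology \<times> 'y::second_countable_topology) measure)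
     \<rightarrow>\<^sub>M PiM {..n} (\<lambda>_. borel)"
  unfolding meas_hist_def meas_seq_def borel_prod[symmetric] by measurable

lemma measurable_seq_fun_upd [measurable (raw)]:
  assumes "f \<in> M \<rightarrow>\<^sub>M seq_borel" "g \<in> M \<rightarrow>\<^sub>M borel"
  shows "(\<lambda>z. (f z)(i := g z)) \<in> M \<rightarrow>\<^sub>M seq_borel"
  by (rule measurable_fun_upd[where J=UNIV]) (use assms in auto)

locale pomdp =
  fixes T :: "'x::polish_space \<times> 'u::polish_space \<Rightarrow> 'x measure"
    and Q :: "'x \<Rightarrow> 'y::polish_space measure"
  assumes T: "T \<in> borel \<rightarrow>\<^sub>M prob_algebra borel"
    and Q: "Q \<in> borel \<rightarrow>\<^sub>M prob_algebra borel"
begin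

text \<open>
  The one-step transition operator: the expectation of \<open>h (X\<^bsub>m+1\<^esub>, Y)\<close> given
  \<open>X\<^sub>m = x\<close> and the measurements \<open>y\<close> up to time \<open>m\<close>.
\<close>

definition step where
  "step \<sigma> m h = (\<lambda>(x, y). \<integral>\<^sup>+x'. \<integral>\<^sup>+y'. h (x', y(Suc m := y')) \<partial>Q x' \<partial>T (x, action \<sigma> y m))"
  for \<sigma> :: "('y, 'u) policy" and h :: "'x \<times> (nat \<Rightarrow> 'y) \<Rightarrow> ennreal"

text \<open>
  The expectation of \<open>h (X\<^bsub>m+j\<^esub>, Y)\<close> given the state and the measurements at time \<open>m\<close>.
  It does not involve the prior; the prior enters only through \<open>init\<close> below.
\<close>

primrec ahead where
  "ahead \<sigma> m 0 h = h"
| "ahead \<sigma> m (Suc j) h = step \<sigma> m (ahead \<sigma> (Suc m) j h)"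

definition init where
  "init l h = (\<integral>\<^sup>+x. \<integral>\<^sup>+y. h (x, (\<lambda>_. undefined)(0 := y)) \<partial>Q x \<partial>l)"
  for h :: "'x \<times> (nat \<Rightarrow> 'y) \<Rightarrow> ennreal"

lemma prob_T: "prob_space (T z)" and prob_Q: "prob_space (Q x)"
  using measurable_space[OF T, of z] measurable_space[OF Q, of x] by (auto dest: prob_algebraD)

lemma sets_T [measurable_cong, simp]: "sets (T z) = sets borel"
  and sets_Q [measurable_cong, simp]: "sets (Q x) = sets borel"
  using measurable_space[OF T, of z] measurable_space[OF Q, of x] by (auto dest: prob_algebraD)

lemma space_T [simp]: "space (T z) = UNIV" and space_Q [simp]: "space (Q x) = UNIV"
  using sets_eq_imp_space_eq[OF sets_T] sets_eq_imp_space_eq[OF sets_Q] by auto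

lemma measurable_Q [measurable]: "Q \<in> borel \<rightarrow>\<^sub>M subprob_algebra borel"
  by (rule measurable_prob_algebraD[OF Q])

lemma measurable_action_pair:
  fixes \<sigma> :: "('y, 'u) policy"
  assumes \<sigma>: "\<sigma> \<in> admissible" and "f \<in> M \<rightarrow>\<^sub>M borel" and "g \<in> M \<rightarrow>\<^sub>M seq_borel"
  shows "(\<lambda>z. (f z :: 'x, action \<sigma> (g z :: nat \<Rightarrow> 'y) m)) \<in> M \<rightarrow>\<^sub>M borel"
proof -
  have act: "(\<lambda>z. action \<sigma> (g z) m) \<in> M \<rightarrow>\<^sub>M borel"
    by (intro measurable_action[OF \<sigma>] measurable_compose[OF assms(3) measurable_component_singleton]) simp
  show ?thesis unfolding borel_prod[symmetric] by (rule measurable_Pair[OF assms(2) act])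
qed

lemma measurable_extend_history:
  assumes h: "h \<in> borel_measurable (borel \<Otimes>\<^sub>M seq_borel)"
  shows "(\<lambda>p. h (fst p, y(i := snd p))) \<in> borel_measurable borel"
    and "(\<lambda>y'. h (x', y(i := y'))) \<in> borel_measurable borel"
    and "(\<lambda>x'. \<integral>\<^sup>+y'. h (x', y(i := y')) \<partial>Q x') \<in> borel_measurable borel"
proof -
  have "(\<lambda>p::'x \<times> 'y. y(i := snd p)) \<in> borel \<Otimes>\<^sub>M borel \<rightarrow>\<^sub>M seq_borel"
    by (intro measurable_seq_fun_upd) (simp_all add: space_PiM)
  then have *: "(\<lambda>p::'x \<times> 'y. h (fst p, y(i := snd p))) \<in> borel_measurable (borel \<Otimes>\<^sub>M borel)"
    by (intro measurable_compose[OF measurable_Pair h]) auto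
  then show "(\<lambda>p. h (fst p, y(i := snd p))) \<in> borel_measurable borel" by (simp add: borel_prod)
  from measurable_Pair2[OF *, of x'] show "(\<lambda>y'. h (x', y(i := y'))) \<in> borel_measurable borel" by simp
  show "(\<lambda>x'. \<integral>\<^sup>+y'. h (x', y(i := y')) \<partial>Q x') \<in> borel_measurable borel"
    by (rule nn_integral_measurable_subprob_algebra2[where N=borel]) (use * in \<open>simp_all add: split_beta'\<close>)
qed

lemma measurable_step [measurable]:
  assumes \<sigma>: "\<sigma> \<in> admissible" and h [measurable]: "h \<in> borel_measurable (borel \<Otimes>\<^sub>M seq_borel)"
  shows "step \<sigma> m h \<in> borel_measurable (borel \<Otimes>\<^sub>M seq_borel)"
proof -
  have "(\<lambda>p. \<integral>\<^sup>+y'. h (snd p, (snd (fst p))(Suc m := y')) \<partial>Q (snd p))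
      \<in> borel_measurable ((borel \<Otimes>\<^sub>M seq_borel) \<Otimes>\<^sub>M borel)"
    by (rule nn_integral_measurable_subprob_algebra2[where N=borel]) measurable
  moreover have "(\<lambda>z. T (fst z, action \<sigma> (snd z) m)) \<in> borel \<Otimes>\<^sub>M seq_borel \<rightarrow>\<^sub>M subprob_algebra borel"
    by (rule measurable_compose[OF measurable_action_pair[OF \<sigma>] measurable_prob_algebraD[OF T]]) measurable
  ultimately have "(\<lambda>z. \<integral>\<^sup>+x'. \<integral>\<^sup>+y'. h (x', (snd z)(Suc m := y')) \<partial>Q x' \<partial>T (fst z, action \<sigma> (snd z) m))
      \<in> borel_measurable (borel \<Otimes>\<^sub>M seq_borel)"
    by (intro nn_integral_measurable_subprob_algebra2[where N=borel])
       (simp_all add: split_beta')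
  then show ?thesis by (simp add: step_def case_prod_beta)
qed

lemma measurable_ahead:
  assumes \<sigma>: "\<sigma> \<in> admissible" and h: "h \<in> borel_measurable (borel \<Otimes>\<^sub>M seq_borel)"
  shows "ahead \<sigma> m j h \<in> borel_measurable (borel \<Otimes>\<^sub>M seq_borel)"
  by (induction j arbitrary: m) (auto intro: measurable_step[OF \<sigma>] h)

lemma ahead_add: "ahead \<sigma> m (i + j) h = ahead \<sigma> m i (ahead \<sigma> (m + i) j h)"
  by (induction i arbitrary: m) auto

lemma depends_upto_step:
  assumes "depends_upto (Suc m) h" shows "depends_upto m (step \<sigma> m h)"
  unfolding depends_upto_def
proof safe
  fix x and y y' :: "nat \<Rightarrow> 'y" assume eq: "\<forall>i\<le>m. y i = y' i"
  then have "h (x', y(Suc m := w)) = h (x', y'(Suc m := w))" for x' w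
    by (intro depends_uptoD[OF assms]) auto
  moreover have "action \<sigma> y m = action \<sigma> y' m" using eq by (intro action_cong) auto
  ultimately show "step \<sigma> m h (x, y) = step \<sigma> m h (x, y')" by (simp add: step_def)
qed

lemma depends_upto_ahead:
  assumes "depends_upto (m + j) h" shows "depends_upto m (ahead \<sigma> m j h)"
  using assms by (induction j arbitrary: m) (auto intro: depends_upto_step)

text \<open>
  Only the continuations of \<open>y\<close> beyond time \<open>m\<close> are integrated over, so it suffices that the
  policies agree on a set of sequences that is determined by the coordinates up to \<open>m\<close>.
\<close>

lemma ahead_policy_cong_on:
  assumes "\<And>y y'. y \<in> S \<Longrightarrow> (\<And>i. i \<le> m \<Longrightarrow> y i = y' i) \<Longrightarrow> y' \<in> S"
    and "\<And>k y. y \<in> S \<Longrightarrow> m \<le> k \<Longrightarrow> k < m + j \<Longrightarrow> action \<sigma> y k = action \<sigma>' y k"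
    and "\<And>x y. y \<in> S \<Longrightarrow> h (x, y) = h' (x, y)" and "y \<in> S"
  shows "ahead \<sigma> m j h (x, y) = ahead \<sigma>' m j h' (x, y)"
  using assms
proof (induction j arbitrary: m x y)
  case 0
  show ?case using 0(3)[OF 0(4)] by simp
next
  case (Suc j)
  have "ahead \<sigma> (Suc m) j h (x', y(Suc m := w)) = ahead \<sigma>' (Suc m) j h' (x', y(Suc m := w))" for x' w
  proof (rule Suc.IH)
    show "y(Suc m := w) \<in> S" by (rule Suc.prems(1)[OF Suc.prems(4)]) simp
    show "v' \<in> S" if "v \<in> S" "\<And>i. i \<le> Suc m \<Longrightarrow> v i = v' i" for v v'
      by (rule Suc.prems(1)[OF that(1)]) (rule that(2), simp)
    show "action \<sigma> v k = action \<sigma>' v k" if "v \<in> S" "Suc m \<le> k" "k < Suc m + j" for k v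
      by (rule Suc.prems(2)) (use that in auto)
  qed (rule Suc.prems(3))
  moreover have "action \<sigma> y m = action \<sigma>' y m" by (rule Suc.prems(2)[OF Suc.prems(4)]) auto
  ultimately show ?case by (simp add: step_def)
qed

lemma ahead_le:
  assumes "\<And>z. h z \<le> C" shows "ahead \<sigma> m j h z \<le> C"
proof (induction j arbitrary: m z)
  case (Suc j)
  have "step \<sigma> m (ahead \<sigma> (Suc m) j h) (x, y) \<le> C" for x y
  proof -
    interpret T: prob_space "T (x, action \<sigma> y m)" by (rule prob_T)
    have "(\<integral>\<^sup>+y'. ahead \<sigma> (Suc m) j h (x', y(Suc m := y')) \<partial>Q x') \<le> C" for x'
    proof -
      interpret Q: prob_space "Q x'" by (rule prob_Q)
      have "(\<integral>\<^sup>+y'. ahead \<sigma> (Suc m) j h (x', y(Suc m := y')) \<partial>Q x') \<le> (\<integral>\<^sup>+y'. C \<partial>Q x')"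
        by (intro nn_integral_mono Suc.IH)
      then show ?thesis using Q.emeasure_space_1 by simp
    qed
    then have "step \<sigma> m (ahead \<sigma> (Suc m) j h) (x, y) \<le> (\<integral>\<^sup>+x'. C \<partial>T (x, action \<sigma> y m))"
      by (simp add: step_def nn_integral_mono del: nn_integral_const)
    then show ?thesis using T.emeasure_space_1 by simp
  qed
  then show ?case by (cases z) simp
qed (simp add: assms)

end

locale pomdp_run = pomdp T Q
  for T :: "'x::polish_space \<times> 'u::polish_space \<Rightarrow> 'x measure"
    and Q :: "'x \<Rightarrow> 'y::polish_space measure" +
  fixes l :: "'x measure" and \<sigma> :: "('y, 'u) policy"
  assumes l: "l \<in> space (prob_algebra borel)" and \<sigma>: "\<sigma> \<in> admissible"
begin

lemma sets_l [measurable_cong, simp]: "sets l = sets borel" and space_l [simp]: "space l = UNIV"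
  using prob_algebraD[OF l] by auto

abbreviation "SP \<equiv> strategic T Q l \<sigma>"

sublocale IT: Ionescu_Tulcea "step_kernel T Q l \<sigma>" "\<lambda>_. borel"
  by (rule Ionescu_Tulcea_step_kernel[OF T Q l \<sigma>])

lemma SP_eq: "SP = IT.PF.lim" by (simp add: strategic_def)

lemma sets_SP [measurable_cong, simp]: "sets SP = sets (PiM UNIV (\<lambda>_. borel))"
  and space_SP [simp]: "space SP = UNIV"
  by (simp_all add: SP_eq space_PiM)

text \<open>
  The coordinates before \<open>n\<close> of the projective limit have the law of the \<open>n\<close>-step composition of
  kernels; this links the strategic measure to its conditional laws.
\<close>

lemma nn_integral_SP_restrict:
  assumes g [measurable]: "g \<in> borel_measurable (PiM {0..<n} (\<lambda>_. borel))"
  shows "(\<integral>\<^sup>+\<omega>. g (restrict \<omega> {0..<n}) \<partial>SP) = (\<integral>\<^sup>+\<omega>. g \<omega> \<partial>IT.C 0 n (\<lambda>_. undefined))"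
proof -
  have up: "IT.up_to {0..<n} = n"
    using IT.up_to_iff_Ico[of "{0..<n}" n] IT.up_to[of "{0..<n}"] by (cases n) (auto intro!: antisym)
  have u: "(\<lambda>_. undefined) \<in> space (PiM {0..<0::nat} (\<lambda>_. borel :: ('x \<times> 'y) measure))" by (simp add: space_PiM)
  note [measurable_cong] = IT.sets_C[OF u]
  have "(\<integral>\<^sup>+\<omega>. g (restrict \<omega> {0..<n}) \<partial>SP)
      = (\<integral>\<^sup>+\<omega>. g \<omega> \<partial>distr SP (PiM {0..<n} (\<lambda>_. borel)) (\<lambda>\<omega>. restrict \<omega> {0..<n}))"
    by (subst nn_integral_distr) (auto intro!: measurable_restrict_subset)
  also have "\<dots> = (\<integral>\<^sup>+\<omega>. g \<omega> \<partial>distr (IT.C 0 n (\<lambda>_. undefined)) (PiM {0..<n} (\<lambda>_. borel)) (\<lambda>\<omega>. restrict \<omega> {0..<n}))"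
    unfolding SP_eq by (simp add: IT.distr_lim IT.CI_def up)
  also have "\<dots> = (\<integral>\<^sup>+\<omega>. g (restrict \<omega> {0..<n}) \<partial>IT.C 0 n (\<lambda>_. undefined))"
    by (subst nn_integral_distr) (auto intro!: measurable_restrict_subset)
  also have "\<dots> = (\<integral>\<^sup>+\<omega>. g \<omega> \<partial>IT.C 0 n (\<lambda>_. undefined))"
    by (intro nn_integral_cong arg_cong[where f=g])
       (auto simp: IT.space_C[OF u] space_PiM PiE_iff extensional_restrict)
  finally show ?thesis .
qed

lemma prob_space_SP: "prob_space SP"
proof
  have u: "(\<lambda>_. undefined) \<in> space (PiM {0..<0::nat} (\<lambda>_. borel :: ('x \<times> 'y) measure))" by (simp add: space_PiM)
  have "(\<integral>\<^sup>+\<omega>. 1 \<partial>SP) = (\<integral>\<^sup>+\<omega>. 1 \<partial>IT.C 0 0 (\<lambda>_. undefined))"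
    by (rule nn_integral_SP_restrict) simp
  then show "emeasure SP (space SP) = 1"
    using prob_space.emeasure_space_1[OF IT.prob_space_C[OF u, of 0]] by simp
qed

lemma nn_integral_SP_step:
  assumes g [measurable]: "g \<in> borel_measurable (PiM {0..<Suc n} (\<lambda>_. borel))"
  shows "(\<integral>\<^sup>+\<omega>. g (restrict \<omega> {0..<Suc n}) \<partial>SP)
    = (\<integral>\<^sup>+\<omega>. \<integral>\<^sup>+z. g ((restrict \<omega> {0..<n})(n := z)) \<partial>step_kernel T Q l \<sigma> n (restrict \<omega> {0..<n}) \<partial>SP)"
proof -
  have u: "(\<lambda>_. undefined) \<in> space (PiM {0..<0::nat} (\<lambda>_. borel :: ('x \<times> 'y) measure))" by (simp add: space_PiM)
  have sC: "sets (IT.C 0 n (\<lambda>_. undefined)) = sets (PiM {0..<n} (\<lambda>_. borel))"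
    using IT.sets_C[OF u, of n] by simp
  have eP: "IT.eP n \<in> IT.C 0 n (\<lambda>_. undefined) \<rightarrow>\<^sub>M subprob_algebra (PiM {0..<Suc n} (\<lambda>_. borel))"
    by (simp cong: measurable_cong_sets add: sC)
  have "(\<integral>\<^sup>+\<omega>. g (restrict \<omega> {0..<Suc n}) \<partial>SP) = (\<integral>\<^sup>+\<omega>. g \<omega> \<partial>(IT.C 0 n (\<lambda>_. undefined) \<bind> IT.eP n))"
    by (simp add: nn_integral_SP_restrict[OF g])
  also have "\<dots> = (\<integral>\<^sup>+\<omega>. \<integral>\<^sup>+\<omega>'. g \<omega>' \<partial>IT.eP n \<omega> \<partial>IT.C 0 n (\<lambda>_. undefined))"
    by (rule nn_integral_bind[OF g eP])
  also have "\<dots> = (\<integral>\<^sup>+\<omega>. \<integral>\<^sup>+\<omega>'. g \<omega>' \<partial>IT.eP n (restrict \<omega> {0..<n}) \<partial>SP)"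
    by (rule nn_integral_SP_restrict[symmetric])
       (rule measurable_compose[OF IT.measurable_eP nn_integral_measurable_subprob_algebra[OF g]])
  also have "\<dots> = (\<integral>\<^sup>+\<omega>. \<integral>\<^sup>+z. g ((restrict \<omega> {0..<n})(n := z)) \<partial>step_kernel T Q l \<sigma> n (restrict \<omega> {0..<n}) \<partial>SP)"
    by (intro nn_integral_cong IT.nn_integral_eP g) (auto simp: space_PiM)
  finally show ?thesis .
qed

lemma nn_integral_step_kernel:
  assumes F [measurable]: "F \<in> borel_measurable (borel :: ('x \<times> 'y) measure)"
  shows "(\<integral>\<^sup>+z. F z \<partial>step_kernel T Q l \<sigma> n \<omega>)
    = (\<integral>\<^sup>+x. \<integral>\<^sup>+y. F (x, y) \<partial>Q x \<partial>(case n of 0 \<Rightarrow> l | Suc m \<Rightarrow> T (fst (\<omega> m), action \<sigma> (meas_seq \<omega>) m)))"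
proof -
  let ?M = "case n of 0 \<Rightarrow> l | Suc m \<Rightarrow> T (fst (\<omega> m), action \<sigma> (meas_seq \<omega>) m)"
  have sM: "sets ?M = sets borel" by (auto split: nat.split)
  have "(\<lambda>x. Q x \<bind> (\<lambda>y. return borel (x, y))) \<in> borel \<rightarrow>\<^sub>M prob_algebra (borel :: ('x \<times> 'y) measure)"
    using Q unfolding borel_prod[symmetric] by measurable
  then have K: "(\<lambda>x. Q x \<bind> (\<lambda>y. return borel (x, y))) \<in> ?M \<rightarrow>\<^sub>M subprob_algebra (borel :: ('x \<times> 'y) measure)"
    by (simp add: measurable_prob_algebraD measurable_cong_sets[OF sM refl])
  have R: "(\<lambda>y. return borel (x, y)) \<in> Q x \<rightarrow>\<^sub>M subprob_algebra (borel :: ('x \<times> 'y) measure)" for x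
    unfolding borel_prod[symmetric] by measurable
  show ?thesis
    unfolding step_kernel_def nn_integral_bind[OF F K] nn_integral_bind[OF F R]
    by (simp add: nn_integral_return F)
qed

lemma measurable_at_history:
  assumes h [measurable]: "h \<in> borel_measurable (borel \<Otimes>\<^sub>M seq_borel)"
  shows "(\<lambda>\<omega>. h (fst (\<omega> n), meas_seq \<omega>)) \<in> borel_measurable (PiM {0..<Suc n} (\<lambda>_. borel :: ('x \<times> 'y) measure))"
proof -
  have comp: "(\<lambda>\<omega>. \<omega> i) \<in> PiM {0..<Suc n} (\<lambda>_. borel :: ('x \<times> 'y) measure) \<rightarrow>\<^sub>M borel \<Otimes>\<^sub>M borel"
    if "i < Suc n" for i
    using that unfolding borel_prod[symmetric] by (intro measurable_component_singleton) simp
  have "meas_seq \<in> PiM {0..<Suc n} (\<lambda>_. borel :: ('x \<times> 'y) measure) \<rightarrow>\<^sub>M seq_borel"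
    unfolding meas_seq_def
  proof (rule measurable_PiM_single')
    fix i
    show "(\<lambda>\<omega>. snd (\<omega> i)) \<in> PiM {0..<Suc n} (\<lambda>_. borel :: ('x \<times> 'y) measure) \<rightarrow>\<^sub>M borel"
    proof (cases "i < Suc n")
      case True
      then show ?thesis
        by (intro measurable_compose[OF comp measurable_snd]) simp
    next
      case False
      then have "snd (\<omega> i) = snd (undefined :: 'x \<times> 'y)" if "\<omega> \<in> space (PiM {0..<Suc n} (\<lambda>_. borel :: ('x \<times> 'y) measure))" for \<omega>
        using that by (auto simp: space_PiM PiE_iff extensional_def)
      then show ?thesis by (subst measurable_cong[where g="\<lambda>_. snd (undefined :: 'x \<times> 'y)"]) auto
    qed
  qed auto
  moreover have "(\<lambda>\<omega>. fst (\<omega> n)) \<in> PiM {0..<Suc n} (\<lambda>_. borel :: ('x \<times> 'y) measure) \<rightarrow>\<^sub>M borel"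
    by (intro measurable_compose[OF comp measurable_fst]) simp
  ultimately show ?thesis by measurable
qed

lemma meas_seq_fun_upd: "meas_seq (fun_upd \<omega> n z) = (meas_seq \<omega>)(n := snd z)"
  by (auto simp: meas_seq_def)

lemma nn_integral_SP_Suc:
  assumes h [measurable]: "h \<in> borel_measurable (borel \<Otimes>\<^sub>M seq_borel)" and dep: "depends_upto (Suc m) h"
  shows "(\<integral>\<^sup>+\<omega>. h (fst (\<omega> (Suc m)), meas_seq \<omega>) \<partial>SP) = (\<integral>\<^sup>+\<omega>. step \<sigma> m h (fst (\<omega> m), meas_seq \<omega>) \<partial>SP)"
proof -
  let ?r = "\<lambda>\<omega>. restrict \<omega> {0..<Suc m}"
  \<comment> \<open>The integrand may be evaluated at the trajectory cut off after time \<open>Suc m\<close>, which is where the kernel composition lives.\<close>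
  have "(\<integral>\<^sup>+\<omega>. h (fst (\<omega> (Suc m)), meas_seq \<omega>) \<partial>SP)
      = (\<integral>\<^sup>+\<omega>. h (fst (restrict \<omega> {0..<Suc (Suc m)} (Suc m)), meas_seq (restrict \<omega> {0..<Suc (Suc m)})) \<partial>SP)"
    by (intro nn_integral_cong) (auto simp: meas_seq_def intro!: depends_uptoD[OF dep])
  also have "\<dots> = (\<integral>\<^sup>+\<omega>. \<integral>\<^sup>+z. h (fst (((?r \<omega>)(Suc m := z)) (Suc m)), meas_seq ((?r \<omega>)(Suc m := z)))
       \<partial>step_kernel T Q l \<sigma> (Suc m) (?r \<omega>) \<partial>SP)"
    by (rule nn_integral_SP_step) (rule measurable_at_history[OF h])
  also have "\<dots> = (\<integral>\<^sup>+\<omega>. step \<sigma> m h (fst (\<omega> m), meas_seq \<omega>) \<partial>SP)"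
  proof (rule nn_integral_cong)
    fix \<omega> :: "nat \<Rightarrow> 'x \<times> 'y"
    have "(\<lambda>z. h (fst z, (meas_seq (?r \<omega>))(Suc m := snd z))) \<in> borel_measurable (borel :: ('x \<times> 'y) measure)"
      by (rule measurable_extend_history(1)[OF h])
    then have "(\<integral>\<^sup>+z. h (fst z, (meas_seq (?r \<omega>))(Suc m := snd z)) \<partial>step_kernel T Q l \<sigma> (Suc m) (?r \<omega>))
      = (\<integral>\<^sup>+x. \<integral>\<^sup>+y. h (x, (meas_seq (?r \<omega>))(Suc m := y)) \<partial>Q x \<partial>T (fst (?r \<omega> m), action \<sigma> (meas_seq (?r \<omega>)) m))"
      by (subst nn_integral_step_kernel) simp_all
    moreover have "action \<sigma> (meas_seq (?r \<omega>)) m = action \<sigma> (meas_seq \<omega>) m"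
      by (intro action_cong) (auto simp: meas_seq_def)
    moreover have "h (x, (meas_seq (?r \<omega>))(Suc m := y)) = h (x, (meas_seq \<omega>)(Suc m := y))" for x y
      by (rule depends_uptoD[OF dep]) (auto simp: meas_seq_def)
    ultimately show "(\<integral>\<^sup>+z. h (fst (((?r \<omega>)(Suc m := z)) (Suc m)), meas_seq ((?r \<omega>)(Suc m := z)))
       \<partial>step_kernel T Q l \<sigma> (Suc m) (?r \<omega>)) = step \<sigma> m h (fst (\<omega> m), meas_seq \<omega>)"
      by (simp add: step_def meas_seq_fun_upd del: restrict_upd)
  qed
  finally show ?thesis .
qed

lemma nn_integral_SP_0:
  assumes h [measurable]: "h \<in> borel_measurable (borel \<Otimes>\<^sub>M seq_borel)" and dep: "depends_upto 0 h"
  shows "(\<integral>\<^sup>+\<omega>. h (fst (\<omega> 0), meas_seq \<omega>) \<partial>SP) = init l h"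
proof -
  interpret SP: prob_space SP by (rule prob_space_SP)
  have "(\<integral>\<^sup>+\<omega>. h (fst (\<omega> 0), meas_seq \<omega>) \<partial>SP)
      = (\<integral>\<^sup>+\<omega>. h (fst (restrict \<omega> {0..<Suc 0} 0), meas_seq (restrict \<omega> {0..<Suc 0})) \<partial>SP)"
    by (intro nn_integral_cong) (auto simp: meas_seq_def intro!: depends_uptoD[OF dep])
  also have "\<dots> = (\<integral>\<^sup>+\<omega>. \<integral>\<^sup>+z. h (fst (((restrict \<omega> {0..<0})(0 := z)) 0), meas_seq ((restrict \<omega> {0..<0})(0 := z)))
       \<partial>step_kernel T Q l \<sigma> 0 (restrict \<omega> {0..<0}) \<partial>SP)"
    by (rule nn_integral_SP_step) (rule measurable_at_history[OF h])
  also have "\<dots> = (\<integral>\<^sup>+\<omega>. init l h \<partial>SP)"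
  proof (rule nn_integral_cong)
    fix \<omega> :: "nat \<Rightarrow> 'x \<times> 'y"
    let ?e = "\<lambda>_::nat. undefined :: 'x \<times> 'y"
    have "(\<lambda>z. h (fst z, (meas_seq ?e)(0 := snd z))) \<in> borel_measurable (borel :: ('x \<times> 'y) measure)"
      by (rule measurable_extend_history(1)[OF h])
    then have "(\<integral>\<^sup>+z. h (fst z, (meas_seq ?e)(0 := snd z)) \<partial>step_kernel T Q l \<sigma> 0 ?e)
      = (\<integral>\<^sup>+x. \<integral>\<^sup>+y. h (x, (meas_seq ?e)(0 := y)) \<partial>Q x \<partial>l)"
      by (subst nn_integral_step_kernel) simp_all
    moreover have "h (x, (meas_seq ?e)(0 := y)) = h (x, (\<lambda>_. undefined)(0 := y))" for x y
      by (rule depends_uptoD[OF dep]) auto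
    ultimately show "(\<integral>\<^sup>+z. h (fst (((restrict \<omega> {0..<0})(0 := z)) 0), meas_seq ((restrict \<omega> {0..<0})(0 := z)))
       \<partial>step_kernel T Q l \<sigma> 0 (restrict \<omega> {0..<0})) = init l h"
      by (simp add: init_def meas_seq_fun_upd restrict_def)
  qed
  finally show ?thesis using SP.emeasure_space_1 by simp
qed

text \<open>
  Finite-horizon expectations under the strategic measure are iterated integrals of the transition
  operators. Comparisons of different priors or policies are made on the right-hand side.
\<close>

lemma nn_integral_SP_eq_init:
  assumes "h \<in> borel_measurable (borel \<Otimes>\<^sub>M seq_borel)" and "depends_upto n h"
  shows "(\<integral>\<^sup>+\<omega>. h (fst (\<omega> n), meas_seq \<omega>) \<partial>SP) = init l (ahead \<sigma> 0 n h)"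
  using assms
proof (induction n arbitrary: h)
  case (Suc n)
  have "ahead \<sigma> 0 (Suc n) h = ahead \<sigma> 0 n (step \<sigma> n h)"
    using ahead_add[of \<sigma> 0 n 1 h] by simp
  then show ?case
    using Suc by (simp add: nn_integral_SP_Suc measurable_step[OF \<sigma>] depends_upto_step)
qed (simp add: nn_integral_SP_0)

end

section \<open>Modified policies and the filter\<close>

text \<open>
  From time \<open>n\<close> on, the measurements and actions before \<open>n\<close> are forgotten and \<open>\<tau>\<close> is used as if
  time \<open>n\<close> were time 0.
\<close>

definition restart :: "nat \<Rightarrow> ('y, 'u) policy \<Rightarrow> ('y, 'u) policy \<Rightarrow> ('y, 'u) policy" where
  "restart n \<sigma> \<tau> k = (\<lambda>(y, u). if k < n then \<sigma> k (y, u)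
     else \<tau> (k - n) (\<lambda>i\<in>{..k - n}. y (n + i), \<lambda>i\<in>{..<k - n}. u (n + i)))"

text \<open>
  At time \<open>n\<close> the event \<open>A\<close> of the measurement history decides whether to switch from \<open>\<sigma>\<close>
  to \<open>\<tau>\<close>.
\<close>

definition branch :: "nat \<Rightarrow> (nat \<Rightarrow> 'y) set \<Rightarrow> ('y, 'u) policy \<Rightarrow> ('y, 'u) policy \<Rightarrow> ('y, 'u) policy" where
  "branch n A \<sigma> \<tau> k = (\<lambda>(y, u). if n \<le> k \<and> restrict y {..n} \<in> A then \<tau> k (y, u) else \<sigma> k (y, u))"

lemma restart_admissible:
  fixes \<sigma> \<tau> :: "('y::topological_space, 'u::topological_space) policy"
  assumes \<sigma>: "\<sigma> \<in> admissible" and \<tau>: "\<tau> \<in> admissible"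
  shows "restart n \<sigma> \<tau> \<in> admissible"
  unfolding admissible_def
proof safe
  fix k :: nat
  let ?H = "PiM {..k} (\<lambda>_. borel :: 'y measure) \<Otimes>\<^sub>M PiM {..<k} (\<lambda>_. borel :: 'u measure)"
  show "restart n \<sigma> \<tau> k \<in> ?H \<rightarrow>\<^sub>M borel"
  proof (cases "k < n")
    case True
    then show ?thesis using \<sigma> by (simp add: restart_def admissible_def)
  next
    case False
    have "(\<lambda>z. (\<lambda>i\<in>{..k - n}. fst z (n + i), \<lambda>i\<in>{..<k - n}. snd z (n + i)))
        \<in> ?H \<rightarrow>\<^sub>M PiM {..k - n} (\<lambda>_. borel) \<Otimes>\<^sub>M PiM {..<k - n} (\<lambda>_. borel)"
    proof (intro measurable_Pair measurable_restrict)
      show "(\<lambda>z. fst z (n + i)) \<in> ?H \<rightarrow>\<^sub>M borel" if "i \<in> {..k - n}" for i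
        using that False by (intro measurable_compose[OF measurable_fst measurable_component_singleton]) auto
      show "(\<lambda>z. snd z (n + i)) \<in> ?H \<rightarrow>\<^sub>M borel" if "i \<in> {..<k - n}" for i
        using that False by (intro measurable_compose[OF measurable_snd measurable_component_singleton]) auto
    qed
    moreover have "\<tau> (k - n) \<in> PiM {..k - n} (\<lambda>_. borel) \<Otimes>\<^sub>M PiM {..<k - n} (\<lambda>_. borel) \<rightarrow>\<^sub>M borel"
      using \<tau> by (simp add: admissible_def)
    ultimately have "(\<lambda>z. \<tau> (k - n) (\<lambda>i\<in>{..k - n}. fst z (n + i), \<lambda>i\<in>{..<k - n}. snd z (n + i))) \<in> ?H \<rightarrow>\<^sub>M borel"
      by (rule measurable_compose)
    then show ?thesis using False by (simp add: restart_def split_beta')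
  qed
qed

lemma branch_admissible:
  fixes \<sigma> \<tau> :: "('y::topological_space, 'u::topological_space) policy"
  assumes \<sigma>: "\<sigma> \<in> admissible" and \<tau>: "\<tau> \<in> admissible"
    and A: "A \<in> sets (PiM {..n} (\<lambda>_. borel))"
  shows "branch n A \<sigma> \<tau> \<in> admissible"
  unfolding admissible_def
proof safe
  fix k :: nat
  let ?H = "PiM {..k} (\<lambda>_. borel :: 'y measure) \<Otimes>\<^sub>M PiM {..<k} (\<lambda>_. borel :: 'u measure)"
  have [measurable]: "\<sigma> k \<in> ?H \<rightarrow>\<^sub>M borel" "\<tau> k \<in> ?H \<rightarrow>\<^sub>M borel"
    using \<sigma> \<tau> by (auto simp: admissible_def)
  show "branch n A \<sigma> \<tau> k \<in> ?H \<rightarrow>\<^sub>M borel"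
  proof (cases "n \<le> k")
    case True
    then have "(\<lambda>z. restrict (fst z) {..n}) \<in> ?H \<rightarrow>\<^sub>M PiM {..n} (\<lambda>_. borel)"
      by (intro measurable_compose[OF measurable_fst measurable_restrict_subset]) auto
    then have [measurable]: "Measurable.pred ?H (\<lambda>z. restrict (fst z) {..n} \<in> A)"
      by (rule pred_sets2[OF A])
    have "(\<lambda>z. if restrict (fst z) {..n} \<in> A then \<tau> k z else \<sigma> k z) \<in> ?H \<rightarrow>\<^sub>M borel"
      by measurable
    then show ?thesis using True by (simp add: branch_def split_beta')
  qed (simp add: branch_def)
qed

lemma action_restart:
  "action (restart n \<sigma> \<tau>) y k = (if k < n then action \<sigma> y k else action \<tau> (\<lambda>i. y (n + i)) (k - n))"
proof (induction k rule: less_induct)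
  case (less k)
  show ?case
  proof (cases "k < n")
    case True
    then have "(\<lambda>i\<in>{..<k}. action (restart n \<sigma> \<tau>) y i) = (\<lambda>i\<in>{..<k}. action \<sigma> y i)"
      using less by (intro restrict_ext) auto
    with True show ?thesis
      by (subst (1 2) action.simps) (simp add: restart_def)
  next
    case False
    have "(\<lambda>i\<in>{..<k - n}. (\<lambda>i\<in>{..<k}. action (restart n \<sigma> \<tau>) y i) (n + i))
        = (\<lambda>i\<in>{..<k - n}. action \<tau> (\<lambda>i. y (n + i)) i)"
      using less False by (intro restrict_ext) auto
    moreover have "(\<lambda>i\<in>{..k - n}. (\<lambda>i\<in>{..k}. y i) (n + i)) = (\<lambda>i\<in>{..k - n}. y (n + i))"
      using False by (intro restrict_ext) auto
    ultimately show ?thesis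
      using False by (subst (1 3) action.simps) (simp add: restart_def del: restrict_apply)
  qed
qed

text \<open>
  After the switch \<open>\<tau>\<close> is fed with the actions that \<open>\<sigma>\<close> took before \<open>n\<close>. These are the ones
  \<open>\<tau>\<close> would have taken, by the assumption, so the actions on \<open>A\<close> are those of \<open>\<tau>\<close> throughout.
\<close>

lemma action_branch:
  assumes "\<And>i. i < n \<Longrightarrow> action \<tau> y i = action \<sigma> y i"
  shows "action (branch n A \<sigma> \<tau>) y k = action (if restrict y {..n} \<in> A then \<tau> else \<sigma>) y k"
proof (induction k rule: less_induct)
  case (less k)
  then have h: "(\<lambda>i\<in>{..<k}. action (branch n A \<sigma> \<tau>) y i)
      = (\<lambda>i\<in>{..<k}. action (if restrict y {..n} \<in> A then \<tau> else \<sigma>) y i)"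
    by (intro restrict_ext less) simp
  show ?case
  proof (cases "n \<le> k")
    case True
    then have r: "restrict (\<lambda>i\<in>{..k}. y i) {..n} = restrict y {..n}" by (auto simp: restrict_def)
    have "action (branch n A \<sigma> \<tau>) y k = branch n A \<sigma> \<tau> k (\<lambda>i\<in>{..k}. y i,
        \<lambda>i\<in>{..<k}. action (if restrict y {..n} \<in> A then \<tau> else \<sigma>) y i)"
      unfolding action.simps[of "branch n A \<sigma> \<tau>"] h ..
    also have "\<dots> = (if restrict y {..n} \<in> A then \<tau> else \<sigma>) k (\<lambda>i\<in>{..k}. y i,
        \<lambda>i\<in>{..<k}. action (if restrict y {..n} \<in> A then \<tau> else \<sigma>) y i)"
      unfolding branch_def prod.case r using True by presburger
    also have "\<dots> = action (if restrict y {..n} \<in> A then \<tau> else \<sigma>) y k"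
      by (rule action.simps[symmetric])
    finally show ?thesis .
  next
    case False
    then have "action (if restrict y {..n} \<in> A then \<tau> else \<sigma>) y i = action \<sigma> y i" if "i \<le> k" for i
      using assms that by auto
    then have "(\<lambda>i\<in>{..<k}. action (if restrict y {..n} \<in> A then \<tau> else \<sigma>) y i) = (\<lambda>i\<in>{..<k}. action \<sigma> y i)"
      by (intro restrict_ext) auto
    then have "action (branch n A \<sigma> \<tau>) y k = action \<sigma> y k"
      using False unfolding action.simps[of "branch n A \<sigma> \<tau>"] h
      by (simp add: branch_def action.simps[of \<sigma> y k])
    with False assms show ?thesis by auto
  qed
qed

text \<open>
  A history over \<open>{..n}\<close> is a sequence that is constantly \<open>undefined\<close> beyond \<open>n\<close>, so it can be
  used directly where a full sequence is expected.
\<close>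

lemma measurable_history_extend:
  "(\<lambda>y. y) \<in> PiM {..n::nat} (\<lambda>_. borel :: 'y::topological_space measure) \<rightarrow>\<^sub>M seq_borel"
proof (rule measurable_PiM_single')
  fix i
  show "(\<lambda>y. y i) \<in> PiM {..n} (\<lambda>_. borel :: 'y measure) \<rightarrow>\<^sub>M borel"
  proof (cases "i \<le> n")
    case False
    then have "y i = undefined" if "y \<in> space (PiM {..n} (\<lambda>_. borel :: 'y measure))" for y
      using that by (auto simp: space_PiM PiE_iff extensional_def)
    then show ?thesis by (subst measurable_cong[where g="\<lambda>_. undefined"]) auto
  qed (auto intro: measurable_component_singleton)
qed auto

lemma meas_hist_eq: "meas_hist n \<omega> = restrict (meas_seq \<omega>) {..n}"
  by (simp add: meas_hist_def)

context pomdp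
begin

lemma emeasure_Q_UNIV [simp]: "emeasure (Q x) UNIV = 1"
  using prob_space.emeasure_space_1[OF prob_Q] by simp

lemma ahead_shift:
  assumes act: "\<And>y k. n \<le> k \<Longrightarrow> action \<sigma> y k = action \<tau> (\<lambda>i. y (n + i)) (k - n)"
    and h: "\<And>x y. h (x, y) = h' (x, \<lambda>i. y (n + i))"
  shows "ahead \<sigma> (n + m) j h (x, y) = ahead \<tau> m j h' (x, \<lambda>i. y (n + i))"
proof (induction j arbitrary: m x y)
  case (Suc j)
  have e: "(\<lambda>i. (y(Suc (n + m) := w)) (n + i)) = (\<lambda>i. y (n + i))(Suc m := w)" for w
    by auto
  have "ahead \<sigma> (Suc (n + m)) j h (x', y(Suc (n + m) := w))
      = ahead \<tau> (Suc m) j h' (x', (\<lambda>i. y (n + i))(Suc m := w))" for x' w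
    using Suc.IH[of "Suc m" x' "y(Suc (n + m) := w)"] unfolding e add_Suc_right .
  then show ?case by (simp add: step_def act)
qed (simp add: h)

end

context pomdp_run
begin

lemma nn_integral_SP_cong_policy:
  assumes \<sigma>': "\<sigma>' \<in> admissible" and eq: "\<And>k y. k < n \<Longrightarrow> action \<sigma> y k = action \<sigma>' y k"
    and h: "h \<in> borel_measurable (borel \<Otimes>\<^sub>M seq_borel)" "depends_upto n h"
  shows "(\<integral>\<^sup>+\<omega>. h (fst (\<omega> n), meas_seq \<omega>) \<partial>SP) = (\<integral>\<^sup>+\<omega>. h (fst (\<omega> n), meas_seq \<omega>) \<partial>strategic T Q l \<sigma>')"
proof -
  interpret R: pomdp_run T Q l \<sigma>' by unfold_locales (rule l \<sigma>')+
  have "ahead \<sigma> 0 n h z = ahead \<sigma>' 0 n h z" for z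
    using ahead_policy_cong_on[of UNIV 0 n \<sigma> \<sigma>' h h "snd z" "fst z"] eq by simp
  then show ?thesis
    unfolding nn_integral_SP_eq_init[OF h] R.nn_integral_SP_eq_init[OF h] by presburger
qed

lemma measurable_state_meas [measurable]:
  "(\<lambda>\<omega>. (fst (\<omega> n), meas_seq \<omega>)) \<in> SP \<rightarrow>\<^sub>M borel \<Otimes>\<^sub>M seq_borel"
  "(\<lambda>\<omega>. fst (\<omega> n)) \<in> SP \<rightarrow>\<^sub>M borel" "meas_seq \<in> SP \<rightarrow>\<^sub>M seq_borel" "meas_hist n \<in> SP \<rightarrow>\<^sub>M PiM {..n} (\<lambda>_. borel)"
proof -
  have "(\<lambda>\<omega>. \<omega> n) \<in> PiM UNIV (\<lambda>_. borel) \<rightarrow>\<^sub>M (borel :: 'x measure) \<Otimes>\<^sub>M (borel :: 'y measure)"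
    unfolding borel_prod[symmetric] by (rule measurable_component_singleton) simp
  then have f: "(\<lambda>\<omega>. fst (\<omega> n)) \<in> PiM UNIV (\<lambda>_. borel :: ('x \<times> 'y) measure) \<rightarrow>\<^sub>M (borel :: 'x measure)"
    by (rule measurable_compose) (rule measurable_fst)
  then show 1: "(\<lambda>\<omega>. fst (\<omega> n)) \<in> SP \<rightarrow>\<^sub>M borel" by (simp cong: measurable_cong_sets)
  show 2: "meas_seq \<in> SP \<rightarrow>\<^sub>M seq_borel"
    using measurable_meas_seq by (simp cong: measurable_cong_sets)
  show "meas_hist n \<in> SP \<rightarrow>\<^sub>M PiM {..n} (\<lambda>_. borel)"
    using measurable_meas_hist by (simp cong: measurable_cong_sets)
  show "(\<lambda>\<omega>. (fst (\<omega> n), meas_seq \<omega>)) \<in> SP \<rightarrow>\<^sub>M borel \<Otimes>\<^sub>M seq_borel"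
    using 1 2 by (rule measurable_Pair)
qed

text \<open>
  Given \<open>X\<^sub>n\<close>, the measurement \<open>Y\<^sub>n\<close> has law \<open>Q X\<^sub>n\<close>. Hence the pair has the same law as the
  initial pair of a process whose prior is the law of \<open>X\<^sub>n\<close>.
\<close>

lemma nn_integral_SP_observation:
  assumes k [measurable]: "k \<in> borel_measurable (borel \<Otimes>\<^sub>M borel)"
  shows "(\<integral>\<^sup>+\<omega>. k (fst (\<omega> n), snd (\<omega> n)) \<partial>SP) = (\<integral>\<^sup>+\<omega>. \<integral>\<^sup>+y. k (fst (\<omega> n), y) \<partial>Q (fst (\<omega> n)) \<partial>SP)"
proof -
  define R where "R x = (\<integral>\<^sup>+y. k (x, y) \<partial>Q x)" for x
  have [measurable]: "R \<in> borel_measurable borel"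
    unfolding R_def by (rule nn_integral_measurable_subprob_algebra2[where N=borel]) simp_all
  have [measurable]: "(\<lambda>y. y n) \<in> seq_borel \<rightarrow>\<^sub>M (borel :: 'y measure)"
    by (rule measurable_component_singleton) simp
  have h1: "(\<lambda>z. k (fst z, snd z n)) \<in> borel_measurable (borel \<Otimes>\<^sub>M seq_borel)"
    "depends_upto n (\<lambda>z. k (fst z, snd z n))"
    by measurable (simp add: depends_upto_def)
  have h2: "(\<lambda>z. R (fst z)) \<in> borel_measurable (borel \<Otimes>\<^sub>M seq_borel)"
    "depends_upto n (\<lambda>z. R (fst z) :: ennreal)"
    by measurable (simp add: depends_upto_def)
  have "(\<integral>\<^sup>+\<omega>. k (fst (\<omega> n), meas_seq \<omega> n) \<partial>SP) = (\<integral>\<^sup>+\<omega>. R (fst (\<omega> n)) \<partial>SP)"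
  proof (cases n)
    case 0
    show ?thesis
      using nn_integral_SP_0[OF h1[unfolded 0]] nn_integral_SP_0[OF h2[unfolded 0]]
      by (simp add: 0 init_def) (simp add: R_def)
  next
    case (Suc m)
    have "step \<sigma> m (\<lambda>z. k (fst z, snd z n)) = step \<sigma> m (\<lambda>z. R (fst z))"
      by (rule ext) (simp add: step_def Suc split_beta' flip: R_def)
    then show ?thesis
      using nn_integral_SP_Suc[OF h1[unfolded Suc]] nn_integral_SP_Suc[OF h2[unfolded Suc]]
      by (simp add: Suc)
  qed
  then show ?thesis by (simp add: meas_seq_def R_def)
qed

text \<open>
  The filter is chosen among its versions, so it is meaningful only because a version exists; this
  is a regular conditional probability of \<open>X\<^sub>n\<close> given the measurements.
\<close>

lemma filter_version_pomdp_filter: "filter_version T Q l \<sigma> n (pomdp_filter T Q l \<sigma> n)"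
proof -
  obtain \<kappa> where \<kappa>: "\<kappa> \<in> PiM {..n} (\<lambda>_. borel) \<rightarrow>\<^sub>M prob_algebra (borel :: 'x measure)"
    and eq: "\<And>A B. A \<in> sets (PiM {..n} (\<lambda>_. borel)) \<Longrightarrow> B \<in> sets borel \<Longrightarrow>
       emeasure SP {\<omega>\<in>space SP. meas_hist n \<omega> \<in> A \<and> fst (\<omega> n) \<in> B}
         = (\<integral>\<^sup>+y\<in>A. emeasure (\<kappa> y) B \<partial>distr SP (PiM {..n} (\<lambda>_. borel)) (meas_hist n))"
    using regular_conditional_probability[OF prob_space_SP measurable_state_meas(4,2)] by blast
  have "filter_version T Q l \<sigma> n \<kappa>"
    unfolding filter_version_def
    using AE_cond_exp_kernel_iff[OF prob_space_SP measurable_state_meas(4,2) \<kappa>] \<kappa> eq by simp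
  then show ?thesis unfolding pomdp_filter_def by (rule someI[of "filter_version T Q l \<sigma> n"])
qed

lemma measurable_pomdp_filter:
  "pomdp_filter T Q l \<sigma> n \<in> PiM {..n} (\<lambda>_. borel) \<rightarrow>\<^sub>M prob_algebra borel"
  using filter_version_pomdp_filter by (simp add: filter_version_def)

lemma nn_integral_SP_filter:
  assumes h [measurable]: "h \<in> borel_measurable (borel \<Otimes>\<^sub>M seq_borel)" and dep: "depends_upto n h"
  shows "(\<integral>\<^sup>+\<omega>. h (fst (\<omega> n), meas_seq \<omega>) \<partial>SP)
    = (\<integral>\<^sup>+\<omega>. \<integral>\<^sup>+x. h (x, meas_seq \<omega>) \<partial>pomdp_filter T Q l \<sigma> n (meas_hist n \<omega>) \<partial>SP)"
proof -
  have h_hist: "h (x, meas_seq \<omega>) = h (x, meas_hist n \<omega>)" for x \<omega>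
    unfolding meas_hist_eq by (rule depends_uptoD[OF dep]) simp
  have "(\<lambda>z. (fst z, snd z)) \<in> borel \<Otimes>\<^sub>M PiM {..n} (\<lambda>_. borel) \<rightarrow>\<^sub>M borel \<Otimes>\<^sub>M seq_borel"
    by (intro measurable_Pair measurable_compose[OF measurable_snd measurable_history_extend]) simp
  from measurable_compose[OF this h]
  have hm: "h \<in> borel_measurable (borel \<Otimes>\<^sub>M PiM {..n} (\<lambda>_. borel))" by simp
  show ?thesis
    unfolding h_hist
    by (rule nn_integral_disintegration[OF prob_space_SP measurable_state_meas(4,2) measurable_pomdp_filter _ hm])
       (use filter_version_pomdp_filter AE_cond_exp_kernel_iff[OF prob_space_SP measurable_state_meas(4,2) measurable_pomdp_filter]
        in \<open>auto simp: filter_version_def\<close>)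
qed

end

context pomdp
begin

text \<open>
  The probability of an event of the measurement history is an integral, with respect to the
  prior, of a function that does not depend on the prior. If it vanishes for \<open>\<nu>\<close>, that function
  vanishes \<open>\<nu>\<close>-almost everywhere, hence \<open>\<mu>\<close>-almost everywhere.
\<close>

lemma AE_SP_absolutely_continuous:
  assumes \<mu>: "\<mu> \<in> space (prob_algebra borel)" and \<nu>: "\<nu> \<in> space (prob_algebra borel)"
    and ac: "absolutely_continuous \<nu> \<mu>" and \<sigma>: "\<sigma> \<in> admissible"
    and p [measurable]: "Measurable.pred (PiM {..n} (\<lambda>_. borel)) p"
    and ae: "AE \<omega> in strategic T Q \<nu> \<sigma>. p (meas_hist n \<omega>)"
  shows "AE \<omega> in strategic T Q \<mu> \<sigma>. p (meas_hist n \<omega>)"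
proof -
  interpret M: pomdp_run T Q \<mu> \<sigma> by unfold_locales (rule \<mu> \<sigma>)+
  interpret N: pomdp_run T Q \<nu> \<sigma> by unfold_locales (rule \<nu> \<sigma>)+
  define h :: "'x \<times> (nat \<Rightarrow> 'y) \<Rightarrow> ennreal" where "h z = indicator {y. \<not> p (restrict y {..n})} (snd z)" for z
  have [measurable]: "(\<lambda>y. restrict y {..n}) \<in> seq_borel \<rightarrow>\<^sub>M PiM {..n} (\<lambda>_. borel :: 'y measure)"
    by (rule measurable_restrict_subset) simp
  have h [measurable]: "h \<in> borel_measurable (borel \<Otimes>\<^sub>M seq_borel)"
    unfolding h_def by measurable
  have dep: "depends_upto n h"
    unfolding depends_upto_def h_def
  proof safe
    fix x :: 'x and y y' :: "nat \<Rightarrow> 'y" assume "\<forall>i\<le>n. y i = y' i"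
    then have "restrict y {..n} = restrict y' {..n}" by (intro restrict_ext) auto
    then show "indicator {y. \<not> p (restrict y {..n})} (snd (x, y)) = (indicator {y. \<not> p (restrict y {..n})} (snd (x, y')) :: ennreal)"
      by (simp add: indicator_def)
  qed
  have iff: "(AE \<omega> in strategic T Q \<kappa> \<sigma>. p (meas_hist n \<omega>)) \<longleftrightarrow> init \<kappa> (ahead \<sigma> 0 n h) = 0"
    if "pomdp_run T Q \<kappa> \<sigma>" for \<kappa>
  proof -
    interpret L: pomdp_run T Q \<kappa> \<sigma> by fact
    have "init \<kappa> (ahead \<sigma> 0 n h) = 0 \<longleftrightarrow> (AE \<omega> in L.SP. h (fst (\<omega> n), meas_seq \<omega>) = 0)"
      unfolding L.nn_integral_SP_eq_init[OF h dep, symmetric]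
      by (rule nn_integral_0_iff_AE) simp
    then show ?thesis by (simp add: h_def meas_hist_eq indicator_def)
  qed
  let ?F = "\<lambda>x. \<integral>\<^sup>+y. ahead \<sigma> 0 n h (x, (\<lambda>_. undefined)(0 := y)) \<partial>Q x"
  have F: "?F \<in> borel_measurable borel"
    by (rule measurable_extend_history(3)[OF measurable_ahead[OF \<sigma> h]])
  have "AE x in \<nu>. ?F x = 0"
    using ae iff[OF N.pomdp_run_axioms] F unfolding init_def
    by (subst (asm) nn_integral_0_iff_AE) (simp_all cong: measurable_cong_sets)
  then have "AE x in \<mu>. ?F x = 0"
    using ac prob_algebraD[OF \<mu>] prob_algebraD[OF \<nu>]
    by (intro absolutely_continuous_AE[of \<mu> \<nu>]) auto
  then have "init \<mu> (ahead \<sigma> 0 n h) = 0"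
    unfolding init_def using F
    by (subst nn_integral_0_iff_AE) (simp_all cong: measurable_cong_sets)
  then show ?thesis using iff[OF M.pomdp_run_axioms] by simp
qed

end

section \<open>Discounted cost and cost-to-go\<close>

locale pomdp_cost = pomdp T Q
  for T :: "'x::polish_space \<times> 'u::polish_space \<Rightarrow> 'x measure"
    and Q :: "'x \<Rightarrow> 'y::polish_space measure" +
  fixes c :: "'x \<times> 'u \<Rightarrow> real" and \<beta> C :: real
  assumes c_meas [measurable]: "c \<in> borel_measurable borel"
    and c_nonneg: "0 \<le> c z" and c_le: "c z \<le> C"
    and \<beta>0: "0 < \<beta>" and \<beta>1: "\<beta> < 1" and C_pos: "0 < C"
begin

definition cost_at where
  "cost_at \<sigma> i = (\<lambda>(x, y). ennreal (c (x, action \<sigma> y i)))"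
  for \<sigma> :: "('y, 'u) policy"

text \<open>
  The expected cost from time \<open>n\<close> on, discounted to time \<open>n\<close>, given the state and the
  measurements at time \<open>n\<close>.
\<close>

definition cost_to_go where
  "cost_to_go \<sigma> n z = (\<Sum>j. ennreal (\<beta> ^ j) * ahead \<sigma> n j (cost_at \<sigma> (n + j)) z)"
  for \<sigma> :: "('y, 'u) policy"

lemma summable_discounted: "summable (\<lambda>i. \<beta> ^ i * c (z i))"
proof (rule summable_comparison_test'[of "\<lambda>i. \<beta> ^ i * C" 0])
  show "summable (\<lambda>i. \<beta> ^ i * C)" using \<beta>0 \<beta>1 by (intro summable_mult2 summable_geometric) simp
qed (use \<beta>0 c_nonneg c_le in \<open>auto simp: abs_mult intro!: mult_left_mono\<close>)

lemma measurable_cost_at: "\<sigma> \<in> admissible \<Longrightarrow> cost_at \<sigma> i \<in> borel_measurable (borel \<Otimes>\<^sub>M seq_borel)"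
  unfolding cost_at_def split_beta'
  by (rule measurable_compose[OF measurable_compose[OF
        measurable_action_pair[OF _ measurable_fst measurable_snd] c_meas] measurable_ennreal])

lemma depends_upto_cost_at: "depends_upto i (cost_at \<sigma> i)"
  unfolding depends_upto_def
proof safe
  fix x and y y' :: "nat \<Rightarrow> 'y" assume "\<forall>k\<le>i. y k = y' k"
  then have "action \<sigma> y i = action \<sigma> y' i" by (intro action_cong) simp
  then show "cost_at \<sigma> i (x, y) = cost_at \<sigma> i (x, y')" by (simp add: cost_at_def)
qed

lemma cost_at_le: "cost_at \<sigma> i z \<le> ennreal C"
  by (cases z) (simp add: cost_at_def ennreal_leI c_le)

lemma measurable_cost_to_go:
  assumes "\<sigma> \<in> admissible" shows "cost_to_go \<sigma> n \<in> borel_measurable (borel \<Otimes>\<^sub>M seq_borel)"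
proof -
  note [measurable] = measurable_ahead[OF assms measurable_cost_at[OF assms]]
  show ?thesis unfolding cost_to_go_def[abs_def] by measurable
qed

lemma depends_upto_cost_to_go: "depends_upto n (cost_to_go \<sigma> n)"
  unfolding depends_upto_def
proof safe
  fix x and y y' :: "nat \<Rightarrow> 'y" assume y: "\<forall>i\<le>n. y i = y' i"
  have "ahead \<sigma> n j (cost_at \<sigma> (n + j)) (x, y) = ahead \<sigma> n j (cost_at \<sigma> (n + j)) (x, y')" for j
    by (rule depends_uptoD[OF depends_upto_ahead[OF depends_upto_cost_at]]) (use y in simp)
  then show "cost_to_go \<sigma> n (x, y) = cost_to_go \<sigma> n (x, y')" by (simp add: cost_to_go_def)
qed

lemma geometric_ennreal:
  "(\<Sum>j. ennreal (\<beta> ^ j) * ennreal C) = ennreal (C / (1 - \<beta>))"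
proof -
  have "(\<lambda>j. \<beta> ^ j * C) sums (1 / (1 - \<beta>) * C)"
    using \<beta>0 \<beta>1 by (intro sums_mult2 geometric_sums) simp
  then have "(\<Sum>j. ennreal (\<beta> ^ j * C)) = ennreal (1 / (1 - \<beta>) * C)"
    by (rule suminf_ennreal_eq[rotated]) (use \<beta>0 C_pos in simp)
  moreover have "(\<Sum>j. ennreal (\<beta> ^ j) * ennreal C) = (\<Sum>j. ennreal (\<beta> ^ j * C))"
    using \<beta>0 C_pos by (intro suminf_cong ennreal_mult[symmetric]) auto
  ultimately show ?thesis by (simp only: times_divide_eq_left mult_1_left)
qed

lemma cost_to_go_le: "cost_to_go \<sigma> n z \<le> ennreal (C / (1 - \<beta>))"
  unfolding geometric_ennreal[symmetric] cost_to_go_def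
  by (intro suminf_le summableI mult_left_mono ahead_le cost_at_le) simp

lemma cost_to_go_policy_cong_on:
  assumes "\<And>y y'. y \<in> S \<Longrightarrow> (\<And>i. i \<le> n \<Longrightarrow> y i = y' i) \<Longrightarrow> y' \<in> S"
    and "\<And>k y. y \<in> S \<Longrightarrow> action \<sigma> y k = action \<sigma>' y k" and "y \<in> S"
  shows "cost_to_go \<sigma> n (x, y) = cost_to_go \<sigma>' n (x, y)"
proof -
  have "ahead \<sigma> n j (cost_at \<sigma> (n + j)) (x, y) = ahead \<sigma>' n j (cost_at \<sigma>' (n + j)) (x, y)" for j
  proof (rule ahead_policy_cong_on)
    show "v' \<in> S" if "v \<in> S" "\<And>i. i \<le> n \<Longrightarrow> v i = v' i" for v v'
      using that by (rule assms(1))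
  qed (simp_all add: assms(2,3) cost_at_def)
  then show ?thesis by (simp add: cost_to_go_def)
qed

lemma cost_to_go_restart:
  "cost_to_go (restart n \<sigma> \<tau>) n (x, y) = cost_to_go \<tau> 0 (x, \<lambda>i. y (n + i))"
proof -
  have "ahead (restart n \<sigma> \<tau>) (n + 0) j (cost_at (restart n \<sigma> \<tau>) (n + j)) (x, y)
      = ahead \<tau> 0 j (cost_at \<tau> (0 + j)) (x, \<lambda>i. y (n + i))" for j
    by (rule ahead_shift) (auto simp: action_restart cost_at_def)
  then show ?thesis by (simp add: cost_to_go_def)
qed

end

locale pomdp_cost_run = pomdp_run T Q l \<sigma> + pomdp_cost T Q c \<beta> C
  for T :: "'x::polish_space \<times> 'u::polish_space \<Rightarrow> 'x measure"
    and Q :: "'x \<Rightarrow> 'y::polish_space measure" and l \<sigma> c \<beta> C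
begin

definition "expected_cost i = (\<integral>\<^sup>+\<omega>. cost_at \<sigma> i (fst (\<omega> i), meas_seq \<omega>) \<partial>SP)"

lemma nn_integral_cost_to_go:
  "(\<integral>\<^sup>+\<omega>. cost_to_go \<sigma> n (fst (\<omega> n), meas_seq \<omega>) \<partial>SP) = (\<Sum>j. ennreal (\<beta> ^ j) * expected_cost (n + j))"
proof -
  note m = measurable_cost_at[OF \<sigma>] and d = depends_upto_cost_at[of _ \<sigma>]
  note [measurable] = measurable_ahead[OF \<sigma> m]
  have "(\<integral>\<^sup>+\<omega>. ahead \<sigma> n j (cost_at \<sigma> (n + j)) (fst (\<omega> n), meas_seq \<omega>) \<partial>SP) = expected_cost (n + j)" for j
    unfolding expected_cost_def nn_integral_SP_eq_init[OF m d]
      nn_integral_SP_eq_init[OF measurable_ahead[OF \<sigma> m] depends_upto_ahead[OF d]]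
    using ahead_add[of \<sigma> 0 n j] by simp
  moreover have "(\<integral>\<^sup>+\<omega>. cost_to_go \<sigma> n (fst (\<omega> n), meas_seq \<omega>) \<partial>SP)
      = (\<Sum>j. \<integral>\<^sup>+\<omega>. ennreal (\<beta> ^ j) * ahead \<sigma> n j (cost_at \<sigma> (n + j)) (fst (\<omega> n), meas_seq \<omega>) \<partial>SP)"
    unfolding cost_to_go_def by (rule nn_integral_suminf) measurable
  ultimately show ?thesis by (simp add: nn_integral_cmult)
qed

lemma discounted_cost_nonneg: "0 \<le> discounted_cost T Q \<beta> c l \<sigma>"
  unfolding discounted_cost_def
  using \<beta>0 c_nonneg by (intro integral_nonneg_AE AE_I2 suminf_nonneg summable_discounted) auto

lemma ennreal_discounted_cost:
  "ennreal (discounted_cost T Q \<beta> c l \<sigma>) = (\<Sum>j. ennreal (\<beta> ^ j) * expected_cost j)"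
proof -
  interpret SP: prob_space SP by (rule prob_space_SP)
  let ?f = "\<lambda>i \<omega>. \<beta> ^ i * c (fst (\<omega> i), action \<sigma> (meas_seq \<omega>) i)"
  have smb: "summable (\<lambda>i. \<beta> ^ i * C)" "(\<Sum>i. \<beta> ^ i * C) = C / (1 - \<beta>)"
    using sums_mult2[OF geometric_sums[of \<beta>], of C] \<beta>0 \<beta>1
    by (auto simp: sums_iff field_simps)
  have sm: "summable (\<lambda>i. ?f i \<omega>)" for \<omega>
    by (rule summable_discounted)
  have f0: "0 \<le> ?f i \<omega>" for i \<omega> using \<beta>0 c_nonneg by simp
  have sum0: "0 \<le> (\<Sum>i. ?f i \<omega>)" for \<omega>
    by (rule suminf_nonneg[OF sm[of \<omega>] f0[of _ \<omega>]])
  have [measurable]: "?f i \<in> borel_measurable SP" for i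
    by (rule borel_measurable_times[OF borel_measurable_const
          measurable_compose[OF measurable_action_pair[OF \<sigma> measurable_state_meas(2,3)] c_meas]])
  have le: "(\<Sum>i. ?f i \<omega>) \<le> C / (1 - \<beta>)" for \<omega>
    unfolding smb(2)[symmetric] by (intro suminf_le sm smb mult_left_mono c_le) (use \<beta>0 in auto)
  have "integrable SP (\<lambda>\<omega>. \<Sum>i. ?f i \<omega>)"
    by (rule SP.integrable_const_bound[where B="C / (1 - \<beta>)"])
       (use le sum0 in auto)
  then have "ennreal (discounted_cost T Q \<beta> c l \<sigma>) = (\<integral>\<^sup>+\<omega>. ennreal (\<Sum>i. ?f i \<omega>) \<partial>SP)"
    unfolding discounted_cost_def by (intro nn_integral_eq_integral[symmetric] AE_I2 sum0)
  also have "\<dots> = (\<integral>\<^sup>+\<omega>. (\<Sum>i. ennreal (?f i \<omega>)) \<partial>SP)"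
  proof (rule nn_integral_cong)
    show "ennreal (\<Sum>i. ?f i \<omega>) = (\<Sum>i. ennreal (?f i \<omega>))" for \<omega>
      by (rule suminf_ennreal2[OF f0[of _ \<omega>] sm[of \<omega>], symmetric])
  qed
  also have "\<dots> = (\<Sum>i. \<integral>\<^sup>+\<omega>. ennreal (?f i \<omega>) \<partial>SP)"
    by (rule nn_integral_suminf) measurable
  also have "\<dots> = (\<Sum>i. ennreal (\<beta> ^ i) * expected_cost i)"
  proof (rule arg_cong[where f=suminf], rule ext)
    fix i
    have "(\<integral>\<^sup>+\<omega>. ennreal (?f i \<omega>) \<partial>SP) = (\<integral>\<^sup>+\<omega>. ennreal (\<beta> ^ i) * cost_at \<sigma> i (fst (\<omega> i), meas_seq \<omega>) \<partial>SP)"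
      using \<beta>0 c_nonneg by (simp add: cost_at_def ennreal_mult)
    also have "\<dots> = ennreal (\<beta> ^ i) * expected_cost i"
      unfolding expected_cost_def
      by (intro nn_integral_cmult measurable_compose[OF measurable_state_meas(1) measurable_cost_at[OF \<sigma>]])
    finally show "(\<integral>\<^sup>+\<omega>. ennreal (?f i \<omega>) \<partial>SP) = ennreal (\<beta> ^ i) * expected_cost i" .
  qed
  finally show ?thesis .
qed

text \<open>
  Two policies that agree before \<open>n\<close> share the first summand, so that comparing their values
  amounts to comparing their cost-to-go at \<open>n\<close>.
\<close>

lemma ennreal_discounted_cost_split:
  "ennreal (discounted_cost T Q \<beta> c l \<sigma>) = (\<Sum>i<n. ennreal (\<beta> ^ i) * expected_cost i)
     + ennreal (\<beta> ^ n) * (\<integral>\<^sup>+\<omega>. cost_to_go \<sigma> n (fst (\<omega> n), meas_seq \<omega>) \<partial>SP)"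
proof -
  have "ennreal (discounted_cost T Q \<beta> c l \<sigma>)
      = (\<Sum>j. ennreal (\<beta> ^ (j + n)) * expected_cost (j + n)) + (\<Sum>i<n. ennreal (\<beta> ^ i) * expected_cost i)"
    unfolding ennreal_discounted_cost by (rule suminf_offset) (rule summableI)
  also have "(\<Sum>j. ennreal (\<beta> ^ (j + n)) * expected_cost (j + n))
      = ennreal (\<beta> ^ n) * (\<Sum>j. ennreal (\<beta> ^ j) * expected_cost (n + j))"
    unfolding ennreal_suminf_cmult[symmetric] using \<beta>0
    by (simp add: power_add ennreal_mult ac_simps)
  finally show ?thesis unfolding nn_integral_cost_to_go by (simp add: add.commute)
qed

lemma expected_cost_le: "expected_cost i \<le> ennreal C"
proof -
  have "expected_cost i \<le> (\<integral>\<^sup>+\<omega>. ennreal C \<partial>SP)"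
    unfolding expected_cost_def by (intro nn_integral_mono cost_at_le)
  then show ?thesis using prob_space.emeasure_space_1[OF prob_space_SP] by simp
qed

lemma initial_cost_le: "(\<Sum>i<n. ennreal (\<beta> ^ i) * expected_cost i) \<le> ennreal (C / (1 - \<beta>) * (1 - \<beta> ^ n))"
proof -
  have "(\<Sum>i<n. ennreal (\<beta> ^ i) * expected_cost i) \<le> (\<Sum>i<n. ennreal (\<beta> ^ i) * ennreal C)"
    by (intro sum_mono mult_left_mono expected_cost_le) simp
  also have "\<dots> = ennreal (\<Sum>i<n. \<beta> ^ i * C)"
    using \<beta>0 C_pos by (simp add: ennreal_mult flip: sum_ennreal)
  also have "(\<Sum>i<n. \<beta> ^ i * C) = C / (1 - \<beta>) * (1 - \<beta> ^ n)"
    using \<beta>1 sum_gp_strict[of \<beta> n] by (simp flip: sum_distrib_right)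
  finally show ?thesis .
qed

lemma discounted_cost_le: "discounted_cost T Q \<beta> c l \<sigma> \<le> C / (1 - \<beta>)"
proof -
  have "ennreal (discounted_cost T Q \<beta> c l \<sigma>) \<le> ennreal (C / (1 - \<beta>))"
    unfolding ennreal_discounted_cost geometric_ennreal[symmetric]
    by (intro suminf_le summableI mult_left_mono expected_cost_le) simp
  then show ?thesis using C_pos \<beta>1 by (simp add: ennreal_le_iff)
qed

lemma expected_cost_cong_policy:
  assumes \<sigma>': "\<sigma>' \<in> admissible" and eq: "\<And>k y. k < n \<Longrightarrow> action \<sigma> y k = action \<sigma>' y k" and "i < n"
  shows "expected_cost i = pomdp_cost_run.expected_cost T Q l \<sigma>' c i"
proof -
  interpret R: pomdp_cost_run T Q l \<sigma>' c \<beta> C by unfold_locales (rule l \<sigma>')+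
  have "cost_at \<sigma> i = cost_at \<sigma>' i" using eq[OF \<open>i < n\<close>] by (simp add: cost_at_def)
  moreover have "(\<integral>\<^sup>+\<omega>. cost_at \<sigma> i (fst (\<omega> i), meas_seq \<omega>) \<partial>SP)
      = (\<integral>\<^sup>+\<omega>. cost_at \<sigma> i (fst (\<omega> i), meas_seq \<omega>) \<partial>R.SP)"
    by (rule nn_integral_SP_cong_policy[OF \<sigma>' _ measurable_cost_at[OF \<sigma>] depends_upto_cost_at])
       (use eq \<open>i < n\<close> in auto)
  ultimately show ?thesis by (simp add: expected_cost_def R.expected_cost_def)
qed

end

section \<open>Filter gap and optimality of continuations\<close>

lemma tv_norm_commute: "tv_norm P R = tv_norm R P"
  unfolding tv_norm_def by (simp add: abs_minus_commute)

context pomdp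
begin

abbreviation filter_gap where
  "filter_gap \<mu> \<nu> \<sigma> n \<omega> \<equiv> tv_norm (pomdp_filter T Q \<mu> \<sigma> n (meas_hist n \<omega>)) (pomdp_filter T Q \<nu> \<sigma> n (meas_hist n \<omega>))"

lemma pomdp_filter_in_prob_algebra:
  assumes "l \<in> space (prob_algebra borel)" "\<sigma> \<in> admissible"
  shows "pomdp_filter T Q l \<sigma> n (meas_hist n \<omega>) \<in> space (prob_algebra borel)"
proof -
  interpret pomdp_run T Q l \<sigma> by unfold_locales (rule assms)+
  show ?thesis
    by (rule measurable_space[OF measurable_pomdp_filter]) (auto simp: meas_hist_eq space_PiM)
qed

context
  fixes \<mu> \<nu> :: "'x measure" and \<sigma> :: "('y, 'u) policy"
  assumes \<mu>: "\<mu> \<in> space (prob_algebra borel)" and \<nu>: "\<nu> \<in> space (prob_algebra borel)"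
    and \<sigma>: "\<sigma> \<in> admissible"
begin

interpretation M: pomdp_run T Q \<mu> \<sigma> by unfold_locales (rule \<mu> \<sigma>)+
interpretation N: pomdp_run T Q \<nu> \<sigma> by unfold_locales (rule \<nu> \<sigma>)+

lemma filter_gap_bounds: "0 \<le> filter_gap \<mu> \<nu> \<sigma> n \<omega>" "filter_gap \<mu> \<nu> \<sigma> n \<omega> \<le> 2"
  by (intro tv_norm_nonneg tv_norm_le_2 pomdp_filter_in_prob_algebra \<mu> \<nu> \<sigma>)+

lemma measurable_filter_gap: "filter_gap \<mu> \<nu> \<sigma> n \<in> borel_measurable (strategic T Q \<mu> \<sigma>)"
  by (rule measurable_compose[OF M.measurable_state_meas(4)
        measurable_tv_norm[OF M.measurable_pomdp_filter N.measurable_pomdp_filter]])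

lemma integrable_filter_gap: "integrable (strategic T Q \<mu> \<sigma>) (filter_gap \<mu> \<nu> \<sigma> n)"
proof -
  interpret prob_space M.SP by (rule M.prob_space_SP)
  show ?thesis
    by (intro integrable_const_bound[where B=2] AE_I2 measurable_filter_gap)
       (simp only: real_norm_def abs_of_nonneg filter_gap_bounds)
qed

text \<open>
  Iterate the stability inequality, starting from the trivial bound 2 on total variation. The
  inequality is about genuine expectations because the gap is measurable and bounded.
\<close>

lemma expected_filter_gap_le:
  assumes stable: "universally_exponentially_stable T Q \<alpha>" and ac: "absolutely_continuous \<nu> \<mu>"
    and \<alpha>: "0 \<le> \<alpha>"
  shows "(\<integral>\<omega>. filter_gap \<mu> \<nu> \<sigma> n \<omega> \<partial>strategic T Q \<mu> \<sigma>) \<le> 2 * \<alpha> ^ n"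
proof (induction n)
  case 0
  interpret prob_space M.SP by (rule M.prob_space_SP)
  have "(\<integral>\<omega>. filter_gap \<mu> \<nu> \<sigma> 0 \<omega> \<partial>M.SP) \<le> (\<integral>\<omega>. 2 \<partial>M.SP)"
    by (intro integral_mono integrable_filter_gap filter_gap_bounds) simp
  then show ?case using prob_space by simp
next
  case (Suc n)
  have "(\<integral>\<omega>. filter_gap \<mu> \<nu> \<sigma> (Suc n) \<omega> \<partial>M.SP) \<le> \<alpha> * (\<integral>\<omega>. filter_gap \<mu> \<nu> \<sigma> n \<omega> \<partial>M.SP)"
    using stable \<mu> \<nu> \<sigma> ac unfolding universally_exponentially_stable_def by blast
  also have "\<dots> \<le> \<alpha> * (2 * \<alpha> ^ n)" by (rule mult_left_mono[OF Suc.IH \<alpha>])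
  finally show ?case by simp
qed

lemma filter_integral_le:
  assumes h: "h \<in> borel_measurable (borel \<Otimes>\<^sub>M seq_borel)" and le: "\<And>z. h z \<le> ennreal B" and B: "0 < B"
  shows "(\<integral>\<^sup>+x. h (x, meas_seq \<omega>) \<partial>pomdp_filter T Q \<mu> \<sigma> n (meas_hist n \<omega>))
      \<le> (\<integral>\<^sup>+x. h (x, meas_seq \<omega>) \<partial>pomdp_filter T Q \<nu> \<sigma> n (meas_hist n \<omega>)) + ennreal (B * filter_gap \<mu> \<nu> \<sigma> n \<omega>)"
    and "(\<integral>\<^sup>+x. h (x, meas_seq \<omega>) \<partial>pomdp_filter T Q \<nu> \<sigma> n (meas_hist n \<omega>))
      \<le> (\<integral>\<^sup>+x. h (x, meas_seq \<omega>) \<partial>pomdp_filter T Q \<mu> \<sigma> n (meas_hist n \<omega>)) + ennreal (B * filter_gap \<mu> \<nu> \<sigma> n \<omega>)"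
proof -
  note P = pomdp_filter_in_prob_algebra[OF \<mu> \<sigma>, of n \<omega>] and R = pomdp_filter_in_prob_algebra[OF \<nu> \<sigma>, of n \<omega>]
  have m: "(\<lambda>x. h (x, meas_seq \<omega>)) \<in> borel_measurable borel"
    by (rule measurable_Pair1[OF h]) (simp add: space_PiM)
  show "(\<integral>\<^sup>+x. h (x, meas_seq \<omega>) \<partial>pomdp_filter T Q \<mu> \<sigma> n (meas_hist n \<omega>))
      \<le> (\<integral>\<^sup>+x. h (x, meas_seq \<omega>) \<partial>pomdp_filter T Q \<nu> \<sigma> n (meas_hist n \<omega>)) + ennreal (B * filter_gap \<mu> \<nu> \<sigma> n \<omega>)"
    by (rule nn_integral_le_tv_norm[OF P R m le B])
  show "(\<integral>\<^sup>+x. h (x, meas_seq \<omega>) \<partial>pomdp_filter T Q \<nu> \<sigma> n (meas_hist n \<omega>))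
      \<le> (\<integral>\<^sup>+x. h (x, meas_seq \<omega>) \<partial>pomdp_filter T Q \<mu> \<sigma> n (meas_hist n \<omega>)) + ennreal (B * filter_gap \<mu> \<nu> \<sigma> n \<omega>)"
    using nn_integral_le_tv_norm[OF R P m le B] by (simp add: tv_norm_commute)
qed

end

end

context pomdp_run
begin

lemma measurable_filter_integral:
  assumes h: "h \<in> borel_measurable (borel \<Otimes>\<^sub>M seq_borel)"
  shows "(\<lambda>y. \<integral>\<^sup>+x. h (x, y) \<partial>pomdp_filter T Q l \<sigma> n y) \<in> borel_measurable (PiM {..n} (\<lambda>_. borel))"
proof -
  have "(\<lambda>z. (snd z, fst z)) \<in> PiM {..n} (\<lambda>_. borel) \<Otimes>\<^sub>M borel \<rightarrow>\<^sub>M borel \<Otimes>\<^sub>M (seq_borel :: (nat \<Rightarrow> 'y) measure)"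
    by (intro measurable_Pair measurable_compose[OF measurable_fst measurable_history_extend]) simp
  from measurable_compose[OF this h] show ?thesis
    by (intro nn_integral_measurable_subprob_algebra2[where N=borel]
          measurable_prob_algebraD[OF measurable_pomdp_filter]) (simp add: split_beta')
qed

end

context pomdp_cost_run
begin

text \<open>
  An optimal policy stays optimal after almost every measurement history. Otherwise, let \<open>A\<close> be
  the set of histories at time \<open>n\<close> after which \<open>\<sigma>'\<close> is strictly cheaper in filter expectation.
  Switching to \<open>\<sigma>'\<close> exactly on \<open>A\<close> leaves the cost before \<open>n\<close> and the cost off \<open>A\<close> unchanged, so
  optimality forces the integral over \<open>A\<close> of the strictly larger function not to exceed that of
  the smaller one, and \<open>A\<close> is a null set.
\<close>

lemma optimal_policy_cost_to_go_le:
  assumes opt: "\<And>\<tau>. \<tau> \<in> admissible \<Longrightarrow> discounted_cost T Q \<beta> c l \<sigma> \<le> discounted_cost T Q \<beta> c l \<tau>"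
    and \<sigma>': "\<sigma>' \<in> admissible" and agree: "\<And>k y. k < n \<Longrightarrow> action \<sigma>' y k = action \<sigma> y k"
  shows "AE \<omega> in SP. (\<integral>\<^sup>+x. cost_to_go \<sigma> n (x, meas_hist n \<omega>) \<partial>pomdp_filter T Q l \<sigma> n (meas_hist n \<omega>))
      \<le> (\<integral>\<^sup>+x. cost_to_go \<sigma>' n (x, meas_hist n \<omega>) \<partial>pomdp_filter T Q l \<sigma> n (meas_hist n \<omega>))"
proof -
  interpret SP: prob_space SP by (rule prob_space_SP)
  let ?H = "PiM {..n} (\<lambda>_. borel :: 'y measure)"
  define V where "V \<tau> y = (\<integral>\<^sup>+x. cost_to_go \<tau> n (x, y) \<partial>pomdp_filter T Q l \<sigma> n y)" for \<tau> y
  have V [measurable]: "V \<tau> \<in> borel_measurable ?H" if \<tau>: "\<tau> \<in> admissible" for \<tau>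
    unfolding V_def[abs_def] by (rule measurable_filter_integral[OF measurable_cost_to_go[OF \<tau>]])
  define A where "A = {y \<in> space ?H. V \<sigma>' y < V \<sigma> y}"
  have [measurable]: "A \<in> sets ?H" unfolding A_def using V[OF \<sigma>] V[OF \<sigma>'] by measurable
  define \<tau> where "\<tau> = branch n A \<sigma> \<sigma>'"
  have \<tau>: "\<tau> \<in> admissible" unfolding \<tau>_def by (rule branch_admissible[OF \<sigma> \<sigma>']) simp
  have act_\<tau>: "action \<tau> y k = action (if restrict y {..n} \<in> A then \<sigma>' else \<sigma>) y k" for y k
    unfolding \<tau>_def by (rule action_branch[OF agree])
  have agree_\<tau>: "action \<sigma> y k = action \<tau> y k" if "k < n" for y k
    using agree[OF that] by (simp add: act_\<tau>)
  have restrict_closed: "restrict y {..n} = restrict y' {..n}" if "\<And>i. i \<le> n \<Longrightarrow> y i = y' i"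
    for y y' :: "nat \<Rightarrow> 'y"
    using that by (intro restrict_ext) auto
  have togo_A: "cost_to_go \<tau> n (x, y) = cost_to_go \<sigma>' n (x, y)" if "restrict y {..n} \<in> A" for x y
  proof (rule cost_to_go_policy_cong_on[of "{y. restrict y {..n} \<in> A}"])
    show "v' \<in> {y. restrict y {..n} \<in> A}"
      if "v \<in> {y. restrict y {..n} \<in> A}" "\<And>i. i \<le> n \<Longrightarrow> v i = v' i" for v v'
      using that(1) restrict_closed[OF that(2)] by simp
  qed (use that in \<open>auto simp: act_\<tau>\<close>)
  have togo_notA: "cost_to_go \<tau> n (x, y) = cost_to_go \<sigma> n (x, y)" if "restrict y {..n} \<notin> A" for x y
  proof (rule cost_to_go_policy_cong_on[of "{y. restrict y {..n} \<notin> A}"])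
    show "v' \<in> {y. restrict y {..n} \<notin> A}"
      if "v \<in> {y. restrict y {..n} \<notin> A}" "\<And>i. i \<le> n \<Longrightarrow> v i = v' i" for v v'
      using that(1) restrict_closed[OF that(2)] by simp
  qed (use that in \<open>auto simp: act_\<tau>\<close>)
  have int_V: "(\<integral>\<^sup>+\<omega>. cost_to_go \<tau>' n (fst (\<omega> n), meas_seq \<omega>) \<partial>SP) = (\<integral>\<^sup>+\<omega>. V \<tau>' (meas_hist n \<omega>) \<partial>SP)"
    if "\<tau>' \<in> admissible" for \<tau>'
  proof -
    have "cost_to_go \<tau>' n (x, meas_seq \<omega>) = cost_to_go \<tau>' n (x, meas_hist n \<omega>)"
      for x and \<omega> :: "nat \<Rightarrow> 'x \<times> 'y"
      unfolding meas_hist_eq by (rule depends_uptoD[OF depends_upto_cost_to_go]) simp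
    then show ?thesis
      unfolding nn_integral_SP_filter[OF measurable_cost_to_go[OF that] depends_upto_cost_to_go] V_def
      by simp
  qed
  let ?W = "\<lambda>\<omega>. V \<sigma> (meas_hist n \<omega>)" and ?W' = "\<lambda>\<omega>. V \<sigma>' (meas_hist n \<omega>)"
  have W [measurable]: "?W \<in> borel_measurable SP" "?W' \<in> borel_measurable SP"
    by (rule measurable_compose[OF measurable_state_meas(4) V], rule \<sigma> \<sigma>')+
  define a where "a \<omega> = (indicator A (meas_hist n \<omega>) :: ennreal)" for \<omega> :: "nat \<Rightarrow> 'x \<times> 'y"
  define b where "b \<omega> = (indicator (- A) (meas_hist n \<omega>) :: ennreal)" for \<omega> :: "nat \<Rightarrow> 'x \<times> 'y"
  have [measurable]: "Measurable.pred SP (\<lambda>\<omega>. meas_hist n \<omega> \<in> A)" by (rule pred_sets2[OF \<open>A \<in> sets ?H\<close> measurable_state_meas(4)])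
  have [measurable]: "a \<in> borel_measurable SP" "b \<in> borel_measurable SP"
    unfolding a_def b_def indicator_def of_bool_def by simp_all
  have V_le: "V \<tau>' (meas_hist n \<omega>) \<le> ennreal (C / (1 - \<beta>))" for \<tau>' and \<omega> :: "nat \<Rightarrow> 'x \<times> 'y"
  proof -
    interpret F: prob_space "pomdp_filter T Q l \<sigma> n (meas_hist n \<omega>)"
      by (rule prob_algebraD[OF pomdp_filter_in_prob_algebra[OF l \<sigma>]])
    have "V \<tau>' (meas_hist n \<omega>) \<le> (\<integral>\<^sup>+x. ennreal (C / (1 - \<beta>)) \<partial>pomdp_filter T Q l \<sigma> n (meas_hist n \<omega>))"
      unfolding V_def by (intro nn_integral_mono cost_to_go_le)
    then show ?thesis by (simp add: F.emeasure_space_1)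
  qed
  have fin: "(\<integral>\<^sup>+\<omega>. V \<tau>' (meas_hist n \<omega>) \<partial>SP) \<noteq> \<infinity>" for \<tau>'
  proof -
    have "(\<integral>\<^sup>+\<omega>. V \<tau>' (meas_hist n \<omega>) \<partial>SP) \<le> (\<integral>\<^sup>+\<omega>. ennreal (C / (1 - \<beta>)) \<partial>SP)"
      by (intro nn_integral_mono V_le)
    also have "\<dots> < \<infinity>" by (simp only: nn_integral_const SP.emeasure_space_1) simp
    finally show ?thesis by simp
  qed
  \<comment> \<open>The stages before \<open>n\<close> have the same finite cost for both policies and cancel.\<close>
  have "(\<integral>\<^sup>+\<omega>. ?W \<omega> \<partial>SP) \<le> (\<integral>\<^sup>+\<omega>. V \<tau> (meas_hist n \<omega>) \<partial>SP)"
  proof -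
    interpret R: pomdp_cost_run T Q l \<tau> c \<beta> C by unfold_locales (rule l \<tau>)+
    have head: "(\<Sum>i<n. ennreal (\<beta> ^ i) * expected_cost i) = (\<Sum>i<n. ennreal (\<beta> ^ i) * R.expected_cost i)"
      by (intro sum.cong refl arg_cong2[where f="(*)"] expected_cost_cong_policy[OF \<tau> agree_\<tau>]) auto
    have head_fin: "(\<Sum>i<n. ennreal (\<beta> ^ i) * expected_cost i) \<noteq> \<infinity>"
      using le_less_trans[OF initial_cost_le[of n] ennreal_less_top] unfolding infinity_ennreal_def by (rule less_imp_neq)
    have "(\<integral>\<^sup>+\<omega>. cost_to_go \<tau> n (fst (\<omega> n), meas_seq \<omega>) \<partial>R.SP) = (\<integral>\<^sup>+\<omega>. cost_to_go \<tau> n (fst (\<omega> n), meas_seq \<omega>) \<partial>SP)"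
      by (rule nn_integral_SP_cong_policy[OF \<tau> agree_\<tau> measurable_cost_to_go[OF \<tau>] depends_upto_cost_to_go, symmetric])
    moreover have "ennreal (discounted_cost T Q \<beta> c l \<sigma>) \<le> ennreal (discounted_cost T Q \<beta> c l \<tau>)"
      by (intro ennreal_leI opt \<tau>)
    ultimately have "ennreal (\<beta> ^ n) * (\<integral>\<^sup>+\<omega>. ?W \<omega> \<partial>SP) \<le> ennreal (\<beta> ^ n) * (\<integral>\<^sup>+\<omega>. V \<tau> (meas_hist n \<omega>) \<partial>SP)"
      using head_fin
      unfolding ennreal_discounted_cost_split[of n] R.ennreal_discounted_cost_split[of n] head
      by (simp add: int_V \<sigma> \<tau> ennreal_add_left_cancel_le)
    then show ?thesis using \<beta>0 by (subst (asm) ennreal_mult_le_mult_iff) auto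
  qed
  also have "\<dots> = (\<integral>\<^sup>+\<omega>. ?W' \<omega> * a \<omega> + ?W \<omega> * b \<omega> \<partial>SP)"
  proof (rule nn_integral_cong)
    fix \<omega> :: "nat \<Rightarrow> 'x \<times> 'y"
    have "restrict (meas_hist n \<omega>) {..n} = meas_hist n \<omega>" by (simp add: meas_hist_eq)
    then show "V \<tau> (meas_hist n \<omega>) = ?W' \<omega> * a \<omega> + ?W \<omega> * b \<omega>"
      by (cases "meas_hist n \<omega> \<in> A") (simp_all add: V_def a_def b_def togo_A togo_notA)
  qed
  also have "\<dots> = (\<integral>\<^sup>+\<omega>. ?W' \<omega> * a \<omega> \<partial>SP) + (\<integral>\<^sup>+\<omega>. ?W \<omega> * b \<omega> \<partial>SP)"
    by (rule nn_integral_add) measurable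
  finally have "(\<integral>\<^sup>+\<omega>. ?W \<omega> * a \<omega> \<partial>SP) + (\<integral>\<^sup>+\<omega>. ?W \<omega> * b \<omega> \<partial>SP)
      \<le> (\<integral>\<^sup>+\<omega>. ?W' \<omega> * a \<omega> \<partial>SP) + (\<integral>\<^sup>+\<omega>. ?W \<omega> * b \<omega> \<partial>SP)"
  proof -
    assume le: "(\<integral>\<^sup>+\<omega>. ?W \<omega> \<partial>SP) \<le> (\<integral>\<^sup>+\<omega>. ?W' \<omega> * a \<omega> \<partial>SP) + (\<integral>\<^sup>+\<omega>. ?W \<omega> * b \<omega> \<partial>SP)"
    have "(\<integral>\<^sup>+\<omega>. ?W \<omega> \<partial>SP) = (\<integral>\<^sup>+\<omega>. ?W \<omega> * a \<omega> + ?W \<omega> * b \<omega> \<partial>SP)"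
      by (intro nn_integral_cong) (simp add: a_def b_def split: split_indicator)
    also have "\<dots> = (\<integral>\<^sup>+\<omega>. ?W \<omega> * a \<omega> \<partial>SP) + (\<integral>\<^sup>+\<omega>. ?W \<omega> * b \<omega> \<partial>SP)"
      by (rule nn_integral_add) measurable
    finally show ?thesis using le by simp
  qed
  moreover have "(\<integral>\<^sup>+\<omega>. ?W \<omega> * b \<omega> \<partial>SP) \<noteq> \<infinity>"
  proof -
    have "(\<integral>\<^sup>+\<omega>. ?W \<omega> * b \<omega> \<partial>SP) \<le> (\<integral>\<^sup>+\<omega>. ?W \<omega> \<partial>SP)"
      by (intro nn_integral_mono) (simp add: b_def split: split_indicator)
    then show ?thesis using fin[of \<sigma>] by (auto simp: top_unique)
  qed
  ultimately have "(\<integral>\<^sup>+\<omega>. ?W \<omega> * a \<omega> \<partial>SP) \<le> (\<integral>\<^sup>+\<omega>. ?W' \<omega> * a \<omega> \<partial>SP)"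
    by (simp add: add.commute[of _ "(\<integral>\<^sup>+\<omega>. ?W \<omega> * b \<omega> \<partial>SP)"] ennreal_add_left_cancel_le)
  moreover have "a \<omega> = indicator {\<omega> \<in> space SP. ?W' \<omega> < ?W \<omega>} \<omega>" for \<omega>
    using measurable_space[OF measurable_state_meas(4), of \<omega> n] by (simp add: a_def A_def indicator_def)
  ultimately have "AE \<omega> in SP. ?W \<omega> \<le> ?W' \<omega>"
    by (intro AE_le_if_set_nn_integral_le W fin) simp
  then show ?thesis by (simp add: V_def)
qed

end

section \<open>The mismatch bound\<close>

context pomdp_cost
begin

text \<open>
  The policy \<open>\<gamma>\<close> is optimal for the wrong prior \<open>\<nu>\<close>. Its cost-to-go at time \<open>n\<close> is compared with
  that of \<open>\<gamma>'\<close>, which restarts at time \<open>n\<close> with a good policy for the actual law of \<open>X\<^sub>n\<close>.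
  The comparison is possible under the filter of \<open>\<nu>\<close>, where \<open>\<gamma>\<close> is optimal. Moving there and back
  from the filter of \<open>\<mu>\<close> costs the filter gap twice, each time with factor \<open>C / (1 - \<beta>)\<close>, and
  the expected gap is at most \<open>2 * \<alpha> ^ n\<close>; this is where the constant 4 comes from.
\<close>

lemma discounted_cost_mismatched_le:
  assumes \<mu>: "\<mu> \<in> space (prob_algebra borel)" and \<nu>: "\<nu> \<in> space (prob_algebra borel)"
    and ac: "absolutely_continuous \<nu> \<mu>"
    and stable: "universally_exponentially_stable T Q \<alpha>" and \<alpha>: "0 \<le> \<alpha>"
    and \<gamma>: "\<gamma> \<in> admissible"
    and opt: "\<And>\<tau>. \<tau> \<in> admissible \<Longrightarrow> discounted_cost T Q \<beta> c \<nu> \<gamma> \<le> discounted_cost T Q \<beta> c \<nu> \<tau>"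
    and S: "\<And>l. l \<in> space (prob_algebra borel) \<Longrightarrow> \<exists>\<tau>\<in>admissible. discounted_cost T Q \<beta> c l \<tau> \<le> S"
  shows "discounted_cost T Q \<beta> c \<mu> \<gamma> \<le> C / (1 - \<beta>) * (1 - \<beta> ^ n) + \<beta> ^ n * (S + 4 * (C / (1 - \<beta>)) * \<alpha> ^ n)"
proof -
  interpret M: pomdp_cost_run T Q \<mu> \<gamma> c \<beta> C by unfold_locales (rule \<mu> \<gamma>)+
  interpret N: pomdp_cost_run T Q \<nu> \<gamma> c \<beta> C by unfold_locales (rule \<nu> \<gamma>)+
  interpret SP: prob_space M.SP by (rule M.prob_space_SP)
  define B where "B = C / (1 - \<beta>)"
  have B: "0 < B" using C_pos \<beta>1 by (simp add: B_def)
  \<comment> \<open>The unconditional law of \<open>X\<^sub>n\<close>: with it, a single policy replaces a selection of one policy for each history.\<close>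
  define p where "p = distr M.SP borel (\<lambda>\<omega>. fst (\<omega> n))"
  have p: "p \<in> space (prob_algebra borel)"
    unfolding space_prob_algebra p_def by (simp add: SP.prob_space_distr)
  obtain \<tau> where \<tau>: "\<tau> \<in> admissible" and \<tau>S: "discounted_cost T Q \<beta> c p \<tau> \<le> S" using S[OF p] by auto
  interpret P: pomdp_cost_run T Q p \<tau> c \<beta> C by unfold_locales (rule p \<tau>)+
  define \<gamma>' where "\<gamma>' = restart n \<gamma> \<tau>"
  have \<gamma>': "\<gamma>' \<in> admissible" unfolding \<gamma>'_def by (rule restart_admissible[OF \<gamma> \<tau>])
  let ?g = "cost_to_go \<gamma> n" and ?g' = "cost_to_go \<gamma>' n"
  note g = measurable_cost_to_go[OF \<gamma>, of n] and g' = measurable_cost_to_go[OF \<gamma>', of n]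
  let ?F = "\<lambda>l h \<omega>. \<integral>\<^sup>+x. h (x, meas_seq \<omega>) \<partial>pomdp_filter T Q l \<gamma> n (meas_hist n \<omega>)"
  have hist: "cost_to_go \<sigma> n (x, meas_hist n \<omega>) = cost_to_go \<sigma> n (x, meas_seq \<omega>)"
    for \<sigma> x and \<omega> :: "nat \<Rightarrow> 'x \<times> 'y"
    unfolding meas_hist_eq by (rule depends_uptoD[OF depends_upto_cost_to_go]) simp
  \<comment> \<open>Forgetting the past, the restarted process is a fresh process with prior \<open>p\<close>.\<close>
  have restart: "(\<integral>\<^sup>+\<omega>. ?g' (fst (\<omega> n), meas_seq \<omega>) \<partial>M.SP) = ennreal (discounted_cost T Q \<beta> c p \<tau>)"
  proof -
    note m\<tau> = measurable_cost_to_go[OF \<tau>, of 0]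
    let ?k = "\<lambda>z :: 'x \<times> 'y. cost_to_go \<tau> 0 (fst z, (\<lambda>_. undefined)(0 := snd z))"
    have k: "?k \<in> borel_measurable (borel \<Otimes>\<^sub>M borel)"
      using measurable_extend_history(1)[OF m\<tau>] by (simp add: borel_prod)
    have "?g' (fst (\<omega> n), meas_seq \<omega>) = ?k (fst (\<omega> n), snd (\<omega> n))" for \<omega> :: "nat \<Rightarrow> 'x \<times> 'y"
      unfolding \<gamma>'_def cost_to_go_restart fst_conv
      by (rule depends_uptoD[OF depends_upto_cost_to_go]) (simp add: meas_seq_def)
    then have "(\<integral>\<^sup>+\<omega>. ?g' (fst (\<omega> n), meas_seq \<omega>) \<partial>M.SP) = (\<integral>\<^sup>+\<omega>. ?k (fst (\<omega> n), snd (\<omega> n)) \<partial>M.SP)"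
      by simp
    also have "\<dots> = (\<integral>\<^sup>+\<omega>. \<integral>\<^sup>+y. ?k (fst (\<omega> n), y) \<partial>Q (fst (\<omega> n)) \<partial>M.SP)"
      by (rule M.nn_integral_SP_observation[OF k])
    also have "\<dots> = init p (cost_to_go \<tau> 0)"
      unfolding init_def p_def using measurable_extend_history(3)[OF m\<tau>]
      by (subst nn_integral_distr) simp_all
    also have "\<dots> = ennreal (discounted_cost T Q \<beta> c p \<tau>)"
      unfolding P.ennreal_discounted_cost_split[of 0]
      using P.nn_integral_SP_0[OF m\<tau> depends_upto_cost_to_go] by simp
    finally show ?thesis .
  qed
  have pm: "Measurable.pred (PiM {..n} (\<lambda>_. borel)) (\<lambda>y. (\<integral>\<^sup>+x. ?g (x, y) \<partial>pomdp_filter T Q \<nu> \<gamma> n y)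
      \<le> (\<integral>\<^sup>+x. ?g' (x, y) \<partial>pomdp_filter T Q \<nu> \<gamma> n y))"
    unfolding pred_def
    by (rule borel_measurable_le[OF N.measurable_filter_integral[OF g] N.measurable_filter_integral[OF g']])
  have "AE \<omega> in N.SP. (\<lambda>y. (\<integral>\<^sup>+x. ?g (x, y) \<partial>pomdp_filter T Q \<nu> \<gamma> n y)
      \<le> (\<integral>\<^sup>+x. ?g' (x, y) \<partial>pomdp_filter T Q \<nu> \<gamma> n y)) (meas_hist n \<omega>)"
    by (rule N.optimal_policy_cost_to_go_le[OF opt \<gamma>']) (auto simp: \<gamma>'_def action_restart)
  then have "AE \<omega> in M.SP. (\<lambda>y. (\<integral>\<^sup>+x. ?g (x, y) \<partial>pomdp_filter T Q \<nu> \<gamma> n y)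
      \<le> (\<integral>\<^sup>+x. ?g' (x, y) \<partial>pomdp_filter T Q \<nu> \<gamma> n y)) (meas_hist n \<omega>)"
    by (rule AE_SP_absolutely_continuous[OF \<mu> \<nu> ac \<gamma> pm])
  then have ae: "AE \<omega> in M.SP. ?F \<mu> ?g \<omega> \<le> ?F \<mu> ?g' \<omega> + ennreal (2 * B * filter_gap \<mu> \<nu> \<gamma> n \<omega>)"
  proof eventually_elim
    case (elim \<omega>)
    let ?d = "filter_gap \<mu> \<nu> \<gamma> n \<omega>"
    have le: "cost_to_go \<sigma> n z \<le> ennreal B" for \<sigma> z unfolding B_def by (rule cost_to_go_le)
    have "?F \<mu> ?g \<omega> \<le> ?F \<nu> ?g \<omega> + ennreal (B * ?d)"
      by (rule filter_integral_le(1)[OF \<mu> \<nu> \<gamma> g le B])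
    also have "?F \<nu> ?g \<omega> \<le> ?F \<nu> ?g' \<omega>" using elim by (simp add: hist)
    also have "?F \<nu> ?g' \<omega> \<le> ?F \<mu> ?g' \<omega> + ennreal (B * ?d)"
      by (rule filter_integral_le(2)[OF \<mu> \<nu> \<gamma> g' le B])
    finally have "?F \<mu> ?g \<omega> \<le> ?F \<mu> ?g' \<omega> + (ennreal (B * ?d) + ennreal (B * ?d))"
      by (simp add: add_mono add.assoc)
    also have "ennreal (B * ?d) + ennreal (B * ?d) = ennreal (2 * B * ?d)"
      using B filter_gap_bounds(1)[OF \<mu> \<nu> \<gamma>, of n \<omega>] by (simp flip: ennreal_plus)
    finally show ?case .
  qed
  have gap: "(\<integral>\<^sup>+\<omega>. ennreal (2 * B * filter_gap \<mu> \<nu> \<gamma> n \<omega>) \<partial>M.SP) \<le> ennreal (4 * B * \<alpha> ^ n)"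
  proof -
    have "(\<integral>\<^sup>+\<omega>. ennreal (2 * B * filter_gap \<mu> \<nu> \<gamma> n \<omega>) \<partial>M.SP) = ennreal (\<integral>\<omega>. 2 * B * filter_gap \<mu> \<nu> \<gamma> n \<omega> \<partial>M.SP)"
      using B by (intro nn_integral_eq_integral integrable_mult_right integrable_filter_gap[OF \<mu> \<nu> \<gamma>] AE_I2
          mult_nonneg_nonneg filter_gap_bounds(1)[OF \<mu> \<nu> \<gamma>]) simp_all
    also have "(\<integral>\<omega>. 2 * B * filter_gap \<mu> \<nu> \<gamma> n \<omega> \<partial>M.SP) = 2 * B * (\<integral>\<omega>. filter_gap \<mu> \<nu> \<gamma> n \<omega> \<partial>M.SP)"
      by simp
    also have "\<dots> \<le> 2 * B * (2 * \<alpha> ^ n)"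
      using B by (intro mult_left_mono expected_filter_gap_le[OF \<mu> \<nu> \<gamma> stable ac \<alpha>]) simp
    finally have "(\<integral>\<^sup>+\<omega>. ennreal (2 * B * filter_gap \<mu> \<nu> \<gamma> n \<omega>) \<partial>M.SP) \<le> ennreal (2 * B * (2 * \<alpha> ^ n))"
      by (simp add: ennreal_leI)
    then show ?thesis by (simp add: mult.assoc)
  qed
  have mF: "?F \<mu> ?g' \<in> borel_measurable M.SP"
    using measurable_compose[OF M.measurable_state_meas(4)[of n] M.measurable_filter_integral[OF g', of n]] by (simp add: hist)
  have "(\<integral>\<^sup>+\<omega>. ?g (fst (\<omega> n), meas_seq \<omega>) \<partial>M.SP) = (\<integral>\<^sup>+\<omega>. ?F \<mu> ?g \<omega> \<partial>M.SP)"
    by (rule M.nn_integral_SP_filter[OF g depends_upto_cost_to_go])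
  also have "\<dots> \<le> (\<integral>\<^sup>+\<omega>. ?F \<mu> ?g' \<omega> + ennreal (2 * B * filter_gap \<mu> \<nu> \<gamma> n \<omega>) \<partial>M.SP)"
    by (rule nn_integral_mono_AE[OF ae])
  also have "\<dots> = (\<integral>\<^sup>+\<omega>. ?F \<mu> ?g' \<omega> \<partial>M.SP) + (\<integral>\<^sup>+\<omega>. ennreal (2 * B * filter_gap \<mu> \<nu> \<gamma> n \<omega>) \<partial>M.SP)"
    by (rule nn_integral_add[OF mF measurable_compose[OF
          borel_measurable_times[OF borel_measurable_const measurable_filter_gap[OF \<mu> \<nu> \<gamma>]] measurable_ennreal]])
  also have "(\<integral>\<^sup>+\<omega>. ?F \<mu> ?g' \<omega> \<partial>M.SP) = ennreal (discounted_cost T Q \<beta> c p \<tau>)"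
    unfolding restart[symmetric] by (rule M.nn_integral_SP_filter[OF g' depends_upto_cost_to_go, symmetric])
  also have "\<dots> + (\<integral>\<^sup>+\<omega>. ennreal (2 * B * filter_gap \<mu> \<nu> \<gamma> n \<omega>) \<partial>M.SP) \<le> ennreal S + ennreal (4 * B * \<alpha> ^ n)"
    by (intro add_mono gap ennreal_leI \<tau>S)
  finally have tail: "(\<integral>\<^sup>+\<omega>. ?g (fst (\<omega> n), meas_seq \<omega>) \<partial>M.SP) \<le> ennreal S + ennreal (4 * B * \<alpha> ^ n)" .
  have S0: "0 \<le> S" using P.discounted_cost_nonneg \<tau>S by simp
  then have nn: "0 \<le> B * (1 - \<beta> ^ n)" "0 \<le> 4 * B * \<alpha> ^ n" "0 \<le> \<beta> ^ n" "0 \<le> S + 4 * B * \<alpha> ^ n"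
    using B \<alpha> \<beta>0 \<beta>1 by (simp_all add: power_le_one)
  have "ennreal (discounted_cost T Q \<beta> c \<mu> \<gamma>)
      \<le> ennreal (B * (1 - \<beta> ^ n)) + ennreal (\<beta> ^ n) * (ennreal S + ennreal (4 * B * \<alpha> ^ n))"
    unfolding M.ennreal_discounted_cost_split[of n] B_def
    by (intro add_mono M.initial_cost_le mult_left_mono tail[unfolded B_def]) simp
  also have "\<dots> = ennreal (B * (1 - \<beta> ^ n) + \<beta> ^ n * (S + 4 * B * \<alpha> ^ n))"
    unfolding ennreal_plus[OF S0 nn(2), symmetric] ennreal_mult[OF nn(3,4), symmetric]
    by (rule ennreal_plus[OF nn(1) mult_nonneg_nonneg[OF nn(3,4)], symmetric])
  finally show ?thesis
    unfolding B_def[symmetric]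
    by (rule ennreal_le_iff[THEN iffD1, rotated]) (intro add_nonneg_nonneg[OF nn(1)] mult_nonneg_nonneg[OF nn(3,4)])
qed

end

theorem theorem3p10:
  fixes T :: "'x::polish_space \<times> 'u::polish_space \<Rightarrow> 'x measure"
    and Q :: "'x \<Rightarrow> 'y::polish_space measure"
    and c :: "'x \<times> 'u \<Rightarrow> real"
    and opt :: "'x measure \<Rightarrow> ('y, 'u) policy"
    and \<alpha> \<beta> cnorm Jsp \<rho> nstar :: real
    and f :: "int \<Rightarrow> real"
    and \<mu> \<nu> :: "'x measure"
  assumes "sigma_compact (UNIV :: 'x set)"
    and "T \<in> borel \<rightarrow>\<^sub>M prob_algebra borel"
    and "Q \<in> borel \<rightarrow>\<^sub>M prob_algebra borel"
    and "0 < \<beta>" "\<beta> < 1"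
    and "0 < \<alpha>" "\<alpha> < 1"
    and "c \<in> borel_measurable borel" "\<And>z. 0 \<le> c z" "bounded (range c)"
    and "universally_exponentially_stable T Q \<alpha>"
    and "optimal_policies T Q \<beta> c opt"
    and "cnorm = (SUP z. \<bar>c z\<bar>)"
    and "Jsp = (SUP l\<in>space (prob_algebra borel). optimal_cost T Q \<beta> c l)
             - (INF l\<in>space (prob_algebra borel). optimal_cost T Q \<beta> c l)"
    and "\<rho> = (cnorm / (1 - \<beta>) - Jsp) * inverse (cnorm / (1 - \<beta>))"
    and "f = (\<lambda>n. \<beta> powi n * (\<rho> - 4 * \<alpha> powi n))"
    and "nstar = ln ((\<rho> / 4) * (ln \<beta> / (ln \<alpha> + ln \<beta>))) / ln \<alpha>"
    and "0 < cnorm" "0 < \<rho>"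
    and "\<mu> \<in> space (prob_algebra borel)" "\<nu> \<in> space (prob_algebra borel)"
    and "absolutely_continuous \<nu> \<mu>"
  shows "discounted_cost T Q \<beta> c \<mu> (opt \<nu>) - optimal_cost T Q \<beta> c \<mu>
         \<le> cnorm / (1 - \<beta>) * (1 - max (f \<lfloor>nstar\<rfloor>) (f \<lceil>nstar\<rceil>))"
proof -
  have c_le: "c z \<le> cnorm" for z
  proof -
    have "bdd_above (range (\<lambda>z. \<bar>c z\<bar>))"
      using \<open>bounded (range c)\<close> bdd_above_norm[of "range c"] by (simp add: image_image)
    then have "\<bar>c z\<bar> \<le> cnorm" unfolding \<open>cnorm = _\<close> by (rule cSUP_upper[OF UNIV_I])
    then show ?thesis by simp
  qed
  interpret pomdp_cost T Q c \<beta> cnorm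
    by unfold_locales (use assms c_le in auto)
  define B where "B = cnorm / (1 - \<beta>)"
  have B: "0 < B" using C_pos \<beta>1 by (simp add: B_def)
  let ?P = "space (prob_algebra borel) :: 'x measure set" and ?J = "optimal_cost T Q \<beta> c :: 'x measure \<Rightarrow> real"
  have adm: "opt l \<in> admissible" and optJ: "discounted_cost T Q \<beta> c l (opt l) = ?J l" if "l \<in> ?P" for l
    using \<open>optimal_policies T Q \<beta> c opt\<close> that by (auto simp: optimal_policies_def)
  have J0: "0 \<le> discounted_cost T Q \<beta> c l \<tau>" if "l \<in> ?P" "\<tau> \<in> admissible" for l \<tau>
  proof -
    interpret R: pomdp_cost_run T Q l \<tau> c \<beta> cnorm by unfold_locales (rule that)+
    show ?thesis by (rule R.discounted_cost_nonneg)
  qed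
  have J_le: "?J l \<le> discounted_cost T Q \<beta> c l \<tau>" if "l \<in> ?P" "\<tau> \<in> admissible" for l \<tau>
    unfolding optimal_cost_def
    by (rule cINF_lower[OF bdd_belowI2[of _ 0] that(2)]) (rule J0[OF that(1)])
  have Jstar: "0 \<le> ?J l" "?J l \<le> B" if "l \<in> ?P" for l
  proof -
    interpret R: pomdp_cost_run T Q l "opt l" c \<beta> cnorm by unfold_locales (rule that adm)+
    show "0 \<le> ?J l" "?J l \<le> B"
      using R.discounted_cost_nonneg R.discounted_cost_le by (simp_all add: optJ[OF that] B_def)
  qed
  define S where "S = (SUP l\<in>?P. ?J l)"
  define m where "m = (INF l\<in>?P. ?J l)"
  have J_le_S: "?J l \<le> S" if "l \<in> ?P" for l
    unfolding S_def by (rule cSUP_upper[OF that bdd_aboveI2]) (rule Jstar(2))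
  have m_le_J: "m \<le> ?J l" if "l \<in> ?P" for l
    unfolding m_def by (rule cINF_lower[OF bdd_belowI2 that]) (rule Jstar(1))
  have m0: "0 \<le> m" unfolding m_def using \<open>\<mu> \<in> ?P\<close> by (intro cINF_greatest Jstar(1)) auto
  have Jsp: "Jsp = S - m" using \<open>Jsp = _\<close> by (simp add: S_def m_def)
  have \<rho>: "\<rho> * B = B - Jsp" using B \<open>\<rho> = _\<close> unfolding B_def[symmetric] by simp
  have "0 \<le> Jsp" using m_le_J[OF \<open>\<mu> \<in> ?P\<close>] J_le_S[OF \<open>\<mu> \<in> ?P\<close>] by (simp add: Jsp)
  then have "\<rho> * B \<le> 1 * B" using \<rho> by simp
  then have \<rho>1: "\<rho> \<le> 1" using B by (rule mult_right_le_imp_le)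
  \<comment> \<open>The bound for one horizon; \<open>m\<close> may be discounted by \<open>\<beta> ^ n\<close> since it is nonnegative.\<close>
  have bound: "discounted_cost T Q \<beta> c \<mu> (opt \<nu>) - ?J \<mu> \<le> B * (1 - f (int n))" for n
  proof -
    have "discounted_cost T Q \<beta> c \<mu> (opt \<nu>) \<le> B * (1 - \<beta> ^ n) + \<beta> ^ n * (S + 4 * B * \<alpha> ^ n)"
      unfolding B_def
    proof (rule discounted_cost_mismatched_le)
      show "discounted_cost T Q \<beta> c \<nu> (opt \<nu>) \<le> discounted_cost T Q \<beta> c \<nu> \<tau>" if "\<tau> \<in> admissible" for \<tau>
        unfolding optJ[OF \<open>\<nu> \<in> ?P\<close>] by (rule J_le[OF \<open>\<nu> \<in> ?P\<close> that])
      show "\<exists>\<tau>\<in>admissible. discounted_cost T Q \<beta> c l \<tau> \<le> S" if "l \<in> ?P" for l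
        by (rule bexI[of _ "opt l", OF _ adm[OF that]]) (unfold optJ[OF that], rule J_le_S[OF that])
    qed (use assms adm in auto)
    moreover have "\<beta> ^ n * m \<le> ?J \<mu>"
    proof -
      have "\<beta> ^ n * m \<le> 1 * m" using \<beta>0 \<beta>1 m0 by (intro mult_right_mono power_le_one) auto
      then show ?thesis using m_le_J[OF \<open>\<mu> \<in> ?P\<close>] by simp
    qed
    moreover have "B * (1 - f (int n)) = B - \<beta> ^ n * (\<rho> * B) + \<beta> ^ n * (4 * B * \<alpha> ^ n)"
      by (simp add: \<open>f = _\<close> algebra_simps)
    ultimately show ?thesis unfolding \<rho> Jsp by (simp add: algebra_simps)
  qed
  \<comment> \<open>Positivity makes both roundings of \<open>nstar\<close> natural numbers.\<close>
  have "0 < nstar"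
  proof -
    have ln: "ln \<alpha> < 0" "ln \<beta> < 0" using assms(4-7) by auto
    define r where "r = ln \<beta> / (ln \<alpha> + ln \<beta>)"
    have r: "0 < r" "r < 1"
      using ln by (auto simp: r_def divide_neg_neg divide_less_eq)
    have "\<rho> / 4 * r < 1 * 1"
      using r \<open>0 < \<rho>\<close> \<rho>1 by (intro mult_strict_mono) auto
    moreover have "0 < \<rho> / 4 * r" using r \<open>0 < \<rho>\<close> by (intro mult_pos_pos) auto
    ultimately have "ln (\<rho> / 4 * r) < 0" by (simp only: ln_less_zero_iff mult_1)
    with ln show ?thesis unfolding \<open>nstar = _\<close> r_def by (intro divide_neg_neg)
  qed
  then obtain k k' where k: "\<lfloor>nstar\<rfloor> = int k" "\<lceil>nstar\<rceil> = int k'"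
    by (metis ceiling_mono ceiling_zero floor_mono floor_zero less_imp_le nonneg_int_cases)
  show ?thesis
    unfolding k B_def[symmetric] using bound[of k] bound[of k'] by (simp add: max_def)
qed

end
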